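(* Let $N\ge 1$, $p>1$ and $p_*:=1+\frac1N$. Assume that $$\psi(x):=|x|^{-A}\Bigl[\log\Bigl(e+\frac{1}{|x|}\Bigr)\Bigr]^{-B}\chi_{B_+(0,1)}(x)\in L^1(\mathbf{R}^N_+)\setminus L^\infty(\mathbf{R}^N_+),$$ where $0\le A\le N$ and $B<0$ if $A=0$; $B\in\mathbf{R}$ if $0<A<N$; $B>1$ if $A=N$. For $\kappa>0$ let $T(\kappa\psi)$ be the life span of solutions to the problem $$\partial_t u=\Delta u\ \ (x\in\mathbf{R}^N_+,\,t>0),\qquad -\frac{\partial u}{\partial x_N}=u^p\ \ (x\in\partial\mathbf{R}^N_+,\,t>0),\qquad u(x,0)=\kappa\psi(x).\qquad (\mathrm{P}_\kappa)$$ Then $T(\kappa\psi)\to0$ as $\kappa\to\infty$ and the following holds. (i) As $\kappa\to\infty$, $T(\kappa\psi)$ satisfies $$T(\kappa\psi)\sim\begin{cases}\bigl[\kappa(\log\kappa)^{-B}\bigr]^{-\frac{2(p-1)}{-A(p-1)+1}} & \text{if } A<\min\{N,\frac{1}{p-1}\},\\[4pt] \bigl[\kappa(\log\kappa)^{-B+1}\bigr]^{-\frac{2(p-1)}{-A(p-1)+1}} & \text{if } 1<p<p_*,\ A=N,\ B>1,\end{cases}$$ and $$|\log T(\kappa\psi)|\sim\begin{cases}\kappa^{\frac1B} & \text{if } p>p_*,\ A=\frac{1}{p-1},\ B>0,\\[4pt] \kappa^{\frac{1}{B-N-1}} & \text{if } p=p_*,\ A=N,\ B>N+1.\end{cases}$$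 (ii) Let $p>p_*$. If either $A>\frac1{p-1}$ and $B\in\mathbf{R}$, or $A=\frac1{p-1}$ and $B<0$, then problem $(\mathrm{P}_\kappa)$ possesses no local-in-time solutions for all $\kappa>0$. If $A=\frac1{p-1}$ and $B=0$, then $(\mathrm{P}_\kappa)$ possesses no local-in-time solutions for sufficiently large $\kappa>0$. (iii) Let $p=p_*$. If $A=N$ and $B<N+1$, then $(\mathrm{P}_\kappa)$ possesses no local-in-time solutions for all $\kappa>0$. If $A=N$ and $B=N+1$, then $(\mathrm{P}_\kappa)$ possesses no local-in-time solutions for sufficiently large $\kappa>0$. (Throughout (ii) and (iii), $A$ and $B$ are also subject to the constraints on $A,B$ stated at the beginning.)
   Context: Notation: $\mathbf{R}^N_+:=\{y\in\mathbf{R}^N:y_N>0\}$, $D:=\overline{\mathbf{R}^N_+}$, $y=(y',y_N)$ with $y'=(y_1,\dots,y_{N-1})$, $B_+(x,r):=\{y\in\mathbf{R}^N:|x-y|<r\}\cap D$, and $\chi_E$ is the characteristic function of $E$. $G=G(x,y,t)$ is the Green function for the heat equation on $\mathbf{R}^N_+$ with homogeneous Neumann boundary condition, i.e. $G(x,y,t)=(4\pi t)^{-N/2}\bigl[e^{-|x-y|^2/(4t)}+e^{-|x-y_*|^2/(4t)}\bigr]$ with $y_*=(y',-y_N)$. Solution: let $\varphi$ be a nonnegative measurable function in $\mathbf{R}^N_+$ and $0<T<\infty$. A nonnegative continuous function $u$ in $D\times(0,T)$ is a solution in $[0,T)$ with $u(0)=\varphi$ if $$u(x,t)=\int_D G(x,y,t)\varphi(y)\,dy+\int_0^t\int_{\mathbf{R}^{N-1}}G(x,y',0,t-s)\,u(y',0,s)^p\,dy'\,ds$$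 for all $(x,t)\in D\times(0,T)$ (for $N=1$ the inner integral is just evaluation at the boundary point $0$). It is a minimal solution in $[0,T)$ if moreover $u\le w$ in $D\times(0,T)$ for every solution $w$ in $[0,T)$ with $w(0)=\varphi$. Life span: $T(\kappa\psi)$ is the maximal existence time of the minimal solution with $u(0)=\kappa\psi$, i.e. the supremum of all $T>0$ such that a minimal solution in $[0,T)$ exists, with $T(\kappa\psi)=0$ if there is no such $T$. "No local-in-time solutions" means that for no $T>0$ does a solution in $[0,T)$ with $u(0)=\kappa\psi$ exist. For nonnegative functions $f_1,f_2$ on $(0,\infty)$, $f_1(\tau)\sim f_2(\tau)$ as $\tau\to\infty$ means that there is a constant $C>0$ with $C^{-1}f_2(\tau)\le f_1(\tau)\le Cf_2(\tau)$ for all sufficiently large $\tau>0$. *)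

theory Defs
  imports "HOL-Analysis.Analysis"
begin

text \<open>
  The space is \<open>real ^ 'n\<close> with dimension \<open>N = CARD('n)\<close>. An arbitrary index type has no
  distinguished last element, so an index \<open>k\<close> is fixed to play the role of the normal
  coordinate \<open>y\<^sub>N\<close>; the tangential variable \<open>y'\<close> consists of the coordinates in \<open>UNIV - {k}\<close>.
\<close>

definition half_space :: "'n::finite \<Rightarrow> (real ^ 'n) set" where
  "half_space k = {y. 0 < y $ k}"

definition closed_half_space :: "'n::finite \<Rightarrow> (real ^ 'n) set" where
  "closed_half_space k = closure (half_space k)"

definition half_ball :: "'n::finite \<Rightarrow> real ^ 'n \<Rightarrow> real \<Rightarrow> (real ^ 'n) set" where
  "half_ball k x r = {y. norm (x - y) < r} \<inter> closed_half_space k"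

definition reflection :: "'n::finite \<Rightarrow> real ^ 'n \<Rightarrow> real ^ 'n" where
  "reflection k y = (\<chi> i. if i = k then - y $ i else y $ i)"

definition green :: "'n::finite \<Rightarrow> real ^ 'n \<Rightarrow> real ^ 'n \<Rightarrow> real \<Rightarrow> real" where
  "green k x y t = (4 * pi * t) powr (- (real CARD('n) / 2)) *
     (exp (- (norm (x - y))\<^sup>2 / (4 * t)) + exp (- (norm (x - reflection k y))\<^sup>2 / (4 * t)))"

text \<open>
  Lebesgue measure on \<open>R\<^sup>N\<^sup>-\<^sup>1\<close> is the product measure over the tangential indices. For \<open>N = 1\<close>
  this is a unit point mass, so that integration is evaluation at the boundary point \<open>0\<close>.
\<close>

definition tangential_measure :: "'n::finite \<Rightarrow> ('n \<Rightarrow> real) measure" where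
  "tangential_measure k = Pi\<^sub>M (UNIV - {k}) (\<lambda>_. lborel)"

definition boundary_point :: "'n::finite \<Rightarrow> ('n \<Rightarrow> real) \<Rightarrow> real ^ 'n" where
  "boundary_point k y' = (\<chi> i. if i = k then 0 else y' i)"

text \<open>
  The identity is stated in \<open>ennreal\<close>, so it includes the finiteness of both integrals. The
  initial datum \<open>\<phi>\<close> is understood to be nonnegative and measurable on the half space.
\<close>

definition is_solution ::
  "'n::finite \<Rightarrow> real \<Rightarrow> (real ^ 'n \<Rightarrow> real) \<Rightarrow> real \<Rightarrow> (real ^ 'n \<Rightarrow> real \<Rightarrow> real) \<Rightarrow> bool" where
  "is_solution k p \<phi> T u \<longleftrightarrow>
     continuous_on (closed_half_space k \<times> {0<..<T}) (\<lambda>(x, t). u x t) \<and>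
     (\<forall>x\<in>closed_half_space k. \<forall>t\<in>{0<..<T}. 0 \<le> u x t) \<and>
     (\<forall>x\<in>closed_half_space k. \<forall>t\<in>{0<..<T}.
        ennreal (u x t) =
          (\<integral>\<^sup>+ y\<in>closed_half_space k. ennreal (green k x y t * \<phi> y) \<partial>lebesgue) +
          (\<integral>\<^sup>+ s\<in>{0<..<t}. (\<integral>\<^sup>+ y'. ennreal (green k x (boundary_point k y') (t - s) *
              u (boundary_point k y') s powr p) \<partial>tangential_measure k) \<partial>lborel))"

definition is_minimal_solution ::
  "'n::finite \<Rightarrow> real \<Rightarrow> (real ^ 'n \<Rightarrow> real) \<Rightarrow> real \<Rightarrow> (real ^ 'n \<Rightarrow> real \<Rightarrow> real) \<Rightarrow> bool" where
  "is_minimal_solution k p \<phi> T u \<longleftrightarrow>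
     is_solution k p \<phi> T u \<and>
     (\<forall>w. is_solution k p \<phi> T w \<longrightarrow>
        (\<forall>x\<in>closed_half_space k. \<forall>t\<in>{0<..<T}. u x t \<le> w x t))"

text \<open>The supremum in \<open>ennreal\<close> is \<open>0\<close> for the empty set and may be \<open>\<infinity>\<close>.\<close>

definition life_span :: "'n::finite \<Rightarrow> real \<Rightarrow> (real ^ 'n \<Rightarrow> real) \<Rightarrow> ennreal" where
  "life_span k p \<phi> = Sup {ennreal T | T. 0 < T \<and> (\<exists>u. is_minimal_solution k p \<phi> T u)}"

definition has_local_solution :: "'n::finite \<Rightarrow> real \<Rightarrow> (real ^ 'n \<Rightarrow> real) \<Rightarrow> bool" where
  "has_local_solution k p \<phi> \<longleftrightarrow> (\<exists>T>0. \<exists>u. is_solution k p \<phi> T u)"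

text \<open>The value of \<open>psi\<close> at the origin is irrelevant: only integrals of \<open>psi\<close> occur.\<close>

definition psi :: "'n::finite \<Rightarrow> real \<Rightarrow> real \<Rightarrow> real ^ 'n \<Rightarrow> real" where
  "psi k A B x = norm x powr (- A) * ln (exp 1 + 1 / norm x) powr (- B) *
     indicator (half_ball k 0 1) x"

definition L1_half_space :: "'n::finite \<Rightarrow> (real ^ 'n \<Rightarrow> real) set" where
  "L1_half_space k = {f. integrable (lebesgue_on (half_space k)) f}"

definition Linf_half_space :: "'n::finite \<Rightarrow> (real ^ 'n \<Rightarrow> real) set" where
  "Linf_half_space k = {f. f \<in> borel_measurable (lebesgue_on (half_space k)) \<and>
     (\<exists>C. AE x in lebesgue_on (half_space k). \<bar>f x\<bar> \<le> C)}"

definition comparable_at_top :: "(real \<Rightarrow> real) \<Rightarrow> (real \<Rightarrow> real) \<Rightarrow> bool" where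
  "comparable_at_top f g \<longleftrightarrow>
     (\<exists>C>0. \<forall>\<^sub>F \<tau> in at_top. inverse C * g \<tau> \<le> f \<tau> \<and> f \<tau> \<le> C * g \<tau>)"

text \<open>
  The life span as a real number, used only in comparisons for large \<open>\<kappa>\<close>. The conventions
  \<open>enn2real \<infinity> = 0\<close> and \<open>ln 0 = 0\<close> do no harm there: the comparison functions are
  eventually positive, so a life span of \<open>0\<close> or \<open>\<infinity>\<close> violates the lower bound.
\<close>

definition life_span_real :: "'n::finite \<Rightarrow> real \<Rightarrow> (real ^ 'n \<Rightarrow> real) \<Rightarrow> real" where
  "life_span_real k p \<phi> = enn2real (life_span k p \<phi>)"

end

theory Submission
  imports Defs "HOL-Probability.Probability" "HOL-Real_Asymp.Real_Asymp"
begin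

text \<open>
  Write \<open>N = CARD('n)\<close> and \<open>M(\<sigma>)\<close> for the integral of the datum over the half ball of radius \<open>\<sigma>\<close>.

  Necessary condition: average the boundary trace of a solution at time \<open>t\<close> against the tangential
  heat kernel at time \<open>S - t\<close>. By the semigroup property and Jensen's inequality the average \<open>F\<close>
  satisfies \<open>F(t) \<ge> H(t) + \<integral>\<^sub>0\<^sup>t (\<pi>(t-s))\<^sup>-\<^sup>1\<^sup>/\<^sup>2 F(s)\<^sup>p ds\<close>, where \<open>H(t)\<close> is at least a multiple of
  \<open>S\<^sup>-\<^sup>N\<^sup>/\<^sup>2 M(\<surd>S)\<close> for \<open>t \<ge> S/2\<close>. Doubling \<open>F\<close> repeatedly shows that it becomes infinite before
  time \<open>S\<close> unless \<open>M(\<surd>S)\<close> is at most a multiple of \<open>S\<close> to the power \<open>N/2 - 1/(2(p-1))\<close>. For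
  \<open>p = 1 + 1/N\<close> the same idea, applied to pointwise Gaussian lower bounds on all dyadic time scales
  between \<open>\<sigma>\<^sup>2\<close> and \<open>T\<close>, improves this to \<open>M(\<sigma>) \<le> C (ln (T/\<sigma>\<^sup>2))\<^sup>-\<^sup>N\<close>.

  Existence: if \<open>V\<close> is the Neumann heat flow of the \<open>r\<close>-th power of the datum, then \<open>4 V\<^sup>1\<^sup>/\<^sup>r\<close> is a
  supersolution for small times, since the boundary potential of \<open>V(s)\<close> at time \<open>t\<close> is at most a
  multiple of \<open>(t/(s(t-s)))\<^sup>1\<^sup>/\<^sup>2 V(t)\<close>. Here \<open>r > 1\<close> is needed if \<open>A < N\<close>, to make the time integral
  converge when \<open>A = 1/(p-1)\<close>, while \<open>r = 1\<close> suffices if \<open>A = N\<close>. Below a supersolution, monotone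
  iteration from \<open>0\<close> converges to the minimal solution.

  Both conditions have the form \<open>\<kappa> Q(T) \<le> const\<close> with the same \<open>Q(T) = T\<^sup>\<eta> (ln (e + 1/T))\<^sup>-\<^sup>\<beta>\<close>,
  and the theorem follows by inverting \<open>Q\<close>.
\<close>

subsection \<open>Gaussian kernels\<close>

text \<open>The obstacle is that both conditions must carry the same power of the logarithm, not
  only the same power of \<open>T\<close>. For \<open>A < CARD('n)\<close> no logarithm is lost,
  because the mass of a half ball is comparable to the value of the datum at its outer radius times
  the volume. For \<open>A = CARD('n)\<close> integration over the ball costs one logarithm, on both
  sides alike, so \<open>\<beta> = B - 1\<close>. At \<open>p = 1 + 1 / CARD('n)\<close> existence
  integrates \<open>1 / s\<close> times the power \<open>(B - 1) * (p - 1)\<close> of an inverse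
  logarithm. This costs one more before the root of order \<open>p - 1\<close> is taken, and
  \<open>1 / (p - 1) = CARD('n)\<close> yields \<open>\<beta> = B - CARD('n) - 1\<close>.
  Nonexistence cannot find these logarithms on a single time scale; hence the iteration over dyadic
  scales. Throughout \<open>\<eta> = (1 / (p - 1) - A) / 2\<close>. Positive \<open>\<eta>\<close>
  gives a life span that is a power of \<open>\<kappa>\<close> up to logarithms, and
  \<open>\<eta> = 0 < \<beta>\<close> an exponentially small one. If the threshold does not tend to
  \<open>0\<close> with \<open>T\<close>, local solutions fail for all or for all large
  \<open>\<kappa>\<close>. Integrals are kept in \<open>ennreal\<close>, so that Tonelli and Jensen
  apply before finiteness is known.\<close>

text \<open>
  The Green function is a normal factor built from the one-dimensional heat kernel \<open>hk\<close> times
  the product \<open>tg\<close> of \<open>hk\<close> over the tangential coordinates, so every convolution over the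
  boundary reduces to convolutions of one-dimensional Gaussians.
\<close>

definition hk :: "real \<Rightarrow> real \<Rightarrow> real" where
  "hk a x = exp (- x\<^sup>2 / (4 * a)) / sqrt (4 * pi * a)"

lemma hk_normal: "0 < a \<Longrightarrow> hk a x = normal_density 0 (sqrt (2 * a)) x"
  unfolding hk_def normal_density_def by (simp add: field_simps)

lemma hk_pos: "0 < a \<Longrightarrow> 0 < hk a x"
  unfolding hk_def by simp

lemma hk_nonneg: "0 \<le> hk a x" if "0 \<le> a"
  using that unfolding hk_def by simp

lemma hk_minus [simp]: "hk a (- x) = hk a x"
  unfolding hk_def by simp

lemma hk_measurable [measurable]:
  assumes [measurable]: "f \<in> borel_measurable M" "g \<in> borel_measurable M"
  shows "(\<lambda>x. hk (f x) (g x)) \<in> borel_measurable M"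
  unfolding hk_def by measurable

text \<open>Semigroup law: after translation by \<open>z\<close> this is the convolution of two
  centred normal densities, whose variances \<open>2 * a\<close> and \<open>2 * b\<close>
  add.\<close>

lemma hk_conv:
  assumes "0 < a" "0 < b"
  shows "(\<integral>\<^sup>+y. ennreal (hk a (x - y) * hk b (y - z)) \<partial>lborel) = ennreal (hk (a + b) (x - z))"
proof -
  have "(\<integral>\<^sup>+y. ennreal (hk a (x - y) * hk b (y - z)) \<partial>lborel)
     = (\<integral>\<^sup>+y. ennreal (hk a (x - (z + y)) * hk b ((z + y) - z)) \<partial>lborel)"
    by (subst nn_integral_real_affine[where c=1 and t=z]) auto
  also have "\<dots> = (\<integral>\<^sup>+y. ennreal (normal_density 0 (sqrt (2 * a)) ((x - z) - y) * normal_density 0 (sqrt (2 * b)) y) \<partial>lborel)"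
    using assms by (simp add: hk_normal algebra_simps)
  also have "\<dots> = ennreal (normal_density 0 (sqrt ((sqrt (2 * a))\<^sup>2 + (sqrt (2 * b))\<^sup>2)) (x - z))"
    using fun_cong[OF conv_normal_density_zero_mean[of "sqrt (2*a)" "sqrt (2*b)"], of "x - z"] assms by simp
  also have "\<dots> = ennreal (hk (a + b) (x - z))"
    using assms by (simp add: hk_normal algebra_simps)
  finally show ?thesis .
qed

lemma hk_integral: 
  assumes "0 < a" shows "(\<integral>\<^sup>+y. ennreal (hk a (x - y)) \<partial>lborel) = 1"
proof -
  have "(\<integral>\<^sup>+y. ennreal (hk a (x - y)) \<partial>lborel) = (\<integral>\<^sup>+y. ennreal (hk a (x - (x + (-1) * y))) \<partial>lborel)"
    by (subst nn_integral_real_affine[where c="-1" and t=x]) auto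
  also have "\<dots> = (\<integral>\<^sup>+y. ennreal (normal_density 0 (sqrt (2 * a)) y) \<partial>lborel)"
    using assms by (simp add: hk_normal)
  also have "\<dots> = 1"
    using assms by (subst nn_integral_eq_integral) (auto simp: integrable_normal_density integral_normal_density)
  finally show ?thesis .
qed

text \<open>The exponents compare because \<open>x\<^sup>2 / a\<close> is jointly convex and
  homogeneous in \<open>x\<close> and \<open>a\<close>; the square root is the ratio of the
  normalisations. This pointwise substitute for the semigroup law serves in the normal direction,
  where there is no integration.\<close>

lemma hk_mult_le:
  assumes "0 < a" "0 < b"
  shows "hk a x * hk b z \<le> sqrt ((a + b) / (4 * pi * a * b)) * hk (a + b) (x + z)"
proof -
  have "(x + z)\<^sup>2 / (a + b) \<le> x\<^sup>2 / a + z\<^sup>2 / b"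
  proof -
    have "x\<^sup>2 / a + z\<^sup>2 / b - (x + z)\<^sup>2 / (a + b) = (b * x - a * z)\<^sup>2 / (a * b * (a + b))"
      using assms by (simp add: divide_simps) (simp add: power2_eq_square algebra_simps)
    also have "\<dots> \<ge> 0" using assms by simp
    finally show ?thesis by simp
  qed
  then have "- x\<^sup>2 / (4 * a) + - z\<^sup>2 / (4 * b) \<le> - (x + z)\<^sup>2 / (4 * (a + b))"
    using divide_right_mono[of "(x + z)\<^sup>2 / (a + b)" "x\<^sup>2 / a + z\<^sup>2 / b" 4]
    by (simp add: add_divide_distrib mult.commute[of 4])
  then have *: "exp (- x\<^sup>2 / (4 * a)) * exp (- z\<^sup>2 / (4 * b)) \<le> exp (- (x + z)\<^sup>2 / (4 * (a + b)))"
    by (simp flip: exp_add)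
  have s: "sqrt ((a + b) / (4 * pi * a * b)) / sqrt (4 * pi * (a + b)) = 1 / (sqrt (4 * pi * a) * sqrt (4 * pi * b))"
  proof -
    have "(a + b) / (4 * pi * a * b) / (4 * pi * (a + b)) = 1 / ((4 * pi * a) * (4 * pi * b))"
      using assms add_pos_pos[OF assms] by (simp add: divide_simps)
    then show ?thesis by (metis real_sqrt_divide real_sqrt_mult real_sqrt_one)
  qed
  have "hk a x * hk b z = (1 / (sqrt (4 * pi * a) * sqrt (4 * pi * b))) * (exp (- x\<^sup>2 / (4 * a)) * exp (- z\<^sup>2 / (4 * b)))"
    unfolding hk_def by simp
  also have "\<dots> \<le> (1 / (sqrt (4 * pi * a) * sqrt (4 * pi * b))) * exp (- (x + z)\<^sup>2 / (4 * (a + b)))"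
    using assms by (intro mult_left_mono *) auto
  also have "\<dots> = sqrt ((a + b) / (4 * pi * a * b)) * hk (a + b) (x + z)"
    unfolding hk_def s[symmetric] by simp
  finally show ?thesis .
qed

lemma hk_le: "0 < a \<Longrightarrow> hk a x \<le> 1 / sqrt (4 * pi * a)"
  unfolding hk_def by (intro divide_right_mono) auto

lemma hk_0: "hk a 0 = 1 / sqrt (4 * pi * a)"
  unfolding hk_def by simp

text \<open>The exponential increases with time, so only the normalisation is lost.\<close>

lemma hk_time_mono:
  assumes "0 < a" "a \<le> b"
  shows "sqrt (a / b) * hk a x \<le> hk b x"
proof -
  have "sqrt (a / b) / sqrt (4 * pi * a) = 1 / sqrt (4 * pi * b)"
    using assms by (simp add: real_sqrt_mult real_sqrt_divide)
  then have "sqrt (a / b) * hk a x = exp (- x\<^sup>2 / (4 * a)) / sqrt (4 * pi * b)"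
    unfolding hk_def by (metis mult.commute times_divide_eq_left mult.right_neutral times_divide_eq_right)
  also have "\<dots> \<le> hk b x"
    unfolding hk_def using assms by (intro divide_right_mono) (auto simp: frac_le)
  finally show ?thesis .
qed

text \<open>A power of a Gaussian is again a Gaussian, at time \<open>a / p\<close>. Hence the
  nonlinearity keeps Gaussian lower bounds Gaussian.\<close>

lemma hk_powr:
  assumes "0 < a" "0 < p"
  shows "hk a x powr p = (4 * pi * a) powr (- (p - 1) / 2) * p powr (-1/2) * hk (a / p) x"
proof -
  define c where "c = 4 * pi * a"
  have c: "0 < c" using assms by (simp add: c_def)
  have eq: "hk b x = exp (- x\<^sup>2 / (4 * b)) * (4 * pi * b) powr (-1/2)" if "0 < b" for b
    unfolding hk_def using that powr_minus_divide[of "4 * pi * b" "1/2"] by (simp add: powr_half_sqrt)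
  have "hk a x powr p = exp (- x\<^sup>2 / (4 * a)) powr p * (c powr (-1/2)) powr p"
    unfolding eq[OF assms(1)] c_def[symmetric] by (simp add: powr_mult)
  also have "exp (- x\<^sup>2 / (4 * a)) powr p = exp (- x\<^sup>2 / (4 * (a / p)))"
    by (simp add: powr_def mult.commute)
  also have "(c powr (-1/2)) powr p = c powr (- (p - 1) / 2 + (-1/2))"
    unfolding powr_powr by (intro arg_cong2[where f="(powr)"]) (auto simp: field_simps)
  also have "\<dots> = c powr (- (p - 1) / 2) * c powr (-1/2)"
    by (rule powr_add)
  also have "c powr (-1/2) = (p * (c / p)) powr (-1/2)" using assms by simp
  also have "\<dots> = p powr (-1/2) * (c / p) powr (-1/2)"
    using assms c by (subst powr_mult) auto
  also have "c / p = 4 * pi * (a / p)" by (simp add: c_def)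
  finally show ?thesis using assms by (simp add: eq c_def mult_ac)
qed

text \<open>For \<open>CARD('n) = 1\<close> the product is empty and \<open>tg\<close> is constantly
  \<open>1\<close>, in accordance with the unit point mass \<open>tangential_measure\<close>; no
  case distinction on the dimension is needed later.\<close>

definition tg :: "'n::finite \<Rightarrow> real \<Rightarrow> ('n \<Rightarrow> real) \<Rightarrow> real" where
  "tg k a w = (\<Prod>i\<in>UNIV - {k}. hk a (w i))"

lemma tg_nonneg: "0 \<le> a \<Longrightarrow> 0 \<le> tg k a w"
  unfolding tg_def by (intro prod_nonneg) (auto intro: hk_nonneg)

lemma sets_tangential [measurable_cong]:
  "sets (tangential_measure k) = sets (Pi\<^sub>M (UNIV - {k}) (\<lambda>_. borel))"
  unfolding tangential_measure_def by (rule sets_PiM_cong) auto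

lemma tangential_component_measurable:
  "i \<in> UNIV - {k} \<Longrightarrow> (\<lambda>w. w i) \<in> borel_measurable (tangential_measure k)"
  by (subst measurable_cong_sets[OF sets_tangential refl]) (rule measurable_component_singleton)

lemma product_sigma_finite_lborel: "product_sigma_finite (\<lambda>_. lborel :: real measure)"
  by standard

lemma sigma_finite_tangential: "sigma_finite_measure (tangential_measure (k::'n::finite))"
  unfolding tangential_measure_def by (rule product_sigma_finite.sigma_finite[OF product_sigma_finite_lborel]) simp

lemma tg_measurable:
  assumes [measurable]: "f \<in> borel_measurable M" "\<And>i. i \<in> UNIV - {k} \<Longrightarrow> (\<lambda>x. g x i) \<in> borel_measurable M"
  shows "(\<lambda>x. tg k (f x) (g x)) \<in> borel_measurable M"
  unfolding tg_def by measurable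

lemma tangential_nn_integral_prod:
  fixes k :: "'n::finite"
  assumes [measurable]: "\<And>i. i \<in> UNIV - {k} \<Longrightarrow> f i \<in> borel_measurable borel"
  shows "(\<integral>\<^sup>+ w. (\<Prod>i\<in>UNIV - {k}. f i (w i)) \<partial>tangential_measure k) = (\<Prod>i\<in>UNIV - {k}. (\<integral>\<^sup>+ y. f i y \<partial>lborel))"
  unfolding tangential_measure_def
  by (rule product_sigma_finite.product_nn_integral_prod[OF product_sigma_finite_lborel]) auto

lemma tg_conv:
  fixes k :: "'n::finite"
  assumes "0 < a" "0 < b"
  shows "(\<integral>\<^sup>+w. ennreal (tg k a (\<lambda>i. x i - w i) * tg k b (\<lambda>i. w i - z i)) \<partial>tangential_measure k)
     = ennreal (tg k (a + b) (\<lambda>i. x i - z i))"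
proof -
  have "(\<integral>\<^sup>+w. ennreal (tg k a (\<lambda>i. x i - w i) * tg k b (\<lambda>i. w i - z i)) \<partial>tangential_measure k)
     = (\<integral>\<^sup>+w. (\<Prod>i\<in>UNIV - {k}. ennreal (hk a (x i - w i) * hk b (w i - z i))) \<partial>tangential_measure k)"
    unfolding tg_def prod.distrib[symmetric] using assms
    by (subst prod_ennreal) (auto intro!: mult_nonneg_nonneg hk_nonneg)
  also have "\<dots> = (\<Prod>i\<in>UNIV - {k}. (\<integral>\<^sup>+y. ennreal (hk a (x i - y) * hk b (y - z i)) \<partial>lborel))"
    by (rule tangential_nn_integral_prod) measurable
  also have "\<dots> = (\<Prod>i\<in>UNIV - {k}. ennreal (hk (a + b) (x i - z i)))"
    using assms by (simp add: hk_conv)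
  also have "\<dots> = ennreal (tg k (a + b) (\<lambda>i. x i - z i))"
    unfolding tg_def using assms by (subst prod_ennreal) (auto intro!: hk_nonneg)
  finally show ?thesis .
qed

lemma tg_conv_mult:
  fixes k :: "'n::finite"
  assumes "0 < a" "0 < b"
  shows "(\<integral>\<^sup>+w. ennreal (tg k a (\<lambda>i. x i - w i)) * ennreal (tg k b (\<lambda>i. w i - z i)) \<partial>tangential_measure k)
     = ennreal (tg k (a + b) (\<lambda>i. x i - z i))"
  unfolding tg_conv[OF assms, symmetric]
  using assms by (intro nn_integral_cong ennreal_mult[symmetric] tg_nonneg) auto

lemma tg_zero_diff: "tg k a (\<lambda>i. 0 - w i) = tg k a w"
  unfolding tg_def by simp

lemma tg_integral:
  fixes k :: "'n::finite"
  assumes "0 < a"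
  shows "(\<integral>\<^sup>+w. ennreal (tg k a (\<lambda>i. x i - w i)) \<partial>tangential_measure k) = 1"
proof -
  have "(\<integral>\<^sup>+w. ennreal (tg k a (\<lambda>i. x i - w i)) \<partial>tangential_measure k)
     = (\<integral>\<^sup>+w. (\<Prod>i\<in>UNIV - {k}. ennreal (hk a (x i - w i))) \<partial>tangential_measure k)"
    unfolding tg_def prod.distrib[symmetric] using assms
    by (subst prod_ennreal) (auto intro!: mult_nonneg_nonneg hk_nonneg)
  also have "\<dots> = (\<Prod>i\<in>UNIV - {k}. (\<integral>\<^sup>+y. ennreal (hk a (x i - y)) \<partial>lborel))"
    by (rule tangential_nn_integral_prod) measurable
  finally show ?thesis using assms by (simp add: hk_integral)
qed

lemma tg_0: "tg k a (\<lambda>i. 0) = (1 / sqrt (4 * pi * a)) ^ (CARD('n) - 1)" for k :: "'n::finite"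
  unfolding tg_def by (simp add: hk_0 card_Diff_singleton)

lemma tg_time_mono:
  fixes k :: "'n::finite"
  assumes "0 < a" "a \<le> b"
  shows "sqrt (a / b) ^ (CARD('n) - 1) * tg k a w \<le> tg k b w"
proof -
  have "sqrt (a / b) ^ (CARD('n) - 1) * tg k a w = (\<Prod>i\<in>UNIV - {k}. sqrt (a / b) * hk a (w i))"
    unfolding tg_def by (simp add: prod.distrib card_Diff_singleton)
  also have "\<dots> \<le> tg k b w"
    unfolding tg_def using assms by (intro prod_mono conjI hk_time_mono) (auto intro!: mult_nonneg_nonneg hk_nonneg)
  finally show ?thesis .
qed

lemma tg_powr:
  fixes k :: "'n::finite"
  assumes "0 < a" "0 < p"
  shows "tg k a w powr p = ((4 * pi * a) powr (- (p - 1) / 2) * p powr (-1/2)) ^ (CARD('n) - 1) * tg k (a / p) w"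
proof -
  have "tg k a w powr p = (\<Prod>i\<in>UNIV - {k}. hk a (w i) powr p)"
    unfolding tg_def using assms by (subst prod_powr_distrib) (auto intro: hk_nonneg)
  then show ?thesis using assms
    by (simp add: hk_powr prod.distrib tg_def card_Diff_singleton)
qed

section \<open>Factorisation of the Gaussian and of the Green function\<close>

lemma prod_hk:
  assumes "0 < a" "finite I"
  shows "(\<Prod>i\<in>I. hk a (w i)) = exp (- (\<Sum>i\<in>I. (w i)\<^sup>2) / (4 * a)) * (4 * pi * a) powr (- (real (card I) / 2))"
proof -
  have "(\<Prod>i\<in>I. hk a (w i)) = (\<Prod>i\<in>I. exp (- (w i)\<^sup>2 / (4 * a))) / sqrt (4 * pi * a) ^ card I"
    unfolding hk_def by (simp add: prod_dividef)
  also have "(\<Prod>i\<in>I. exp (- (w i)\<^sup>2 / (4 * a))) = exp (\<Sum>i\<in>I. - (w i)\<^sup>2 / (4 * a))"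
    using assms by (simp add: exp_sum)
  also have "(\<Sum>i\<in>I. - (w i)\<^sup>2 / (4 * a)) = - (\<Sum>i\<in>I. (w i)\<^sup>2) / (4 * a)"
    by (simp add: sum_negf sum_divide_distrib)
  also have "sqrt (4 * pi * a) ^ card I = (4 * pi * a) powr (real (card I) / 2)"
    using assms powr_powr[of "4 * pi * a" "1/2" "real (card I)"] powr_realpow[of "sqrt (4 * pi * a)" "card I"]
    by (simp add: powr_half_sqrt)
  finally show ?thesis by (simp add: powr_minus_divide)
qed

lemma gauss_eq_hk:
  fixes w :: "real^'n::finite"
  assumes "0 < t"
  shows "(4 * pi * t) powr (- (real CARD('n) / 2)) * exp (- (norm w)\<^sup>2 / (4 * t)) = hk t (w $ k) * tg k t (\<lambda>i. w $ i)"
proof -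
  have "(\<Prod>i\<in>UNIV. hk t (w $ i)) = hk t (w $ k) * tg k t (\<lambda>i. w $ i)"
    unfolding tg_def by (simp add: prod.remove[of UNIV k])
  moreover have "(\<Prod>i\<in>UNIV. hk t (w $ i)) = exp (- (norm w)\<^sup>2 / (4 * t)) * (4 * pi * t) powr (- (real CARD('n) / 2))"
    using prod_hk[OF assms, of UNIV "\<lambda>i. w $ i"]
    by (simp add: norm_vec_def L2_set_def sum_nonneg)
  ultimately show ?thesis by (simp add: mult.commute)
qed

text \<open>Reflection changes only coordinate \<open>k\<close>, so source and image share the
  tangential factor.\<close>

lemma green_eq:
  fixes k :: "'n::finite"
  assumes "0 < t"
  shows "green k x y t = (hk t (x $ k - y $ k) + hk t (x $ k + y $ k)) * tg k t (\<lambda>i. x $ i - y $ i)"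
proof -
  have 1: "tg k t (\<lambda>i. (x - reflection k y) $ i) = tg k t (\<lambda>i. x $ i - y $ i)"
    unfolding tg_def by (intro prod.cong) (auto simp: reflection_def)
  have 2: "(x - reflection k y) $ k = x $ k + y $ k" "(x - y) $ k = x $ k - y $ k"
    "(\<lambda>i. (x - y) $ i) = (\<lambda>i. x $ i - y $ i)"
    by (auto simp: reflection_def)
  show ?thesis
    unfolding green_def distrib_left gauss_eq_hk[OF assms, of _ k] 1 2
    by (rule distrib_right[symmetric])
qed

text \<open>On the boundary the source coincides with its image, hence the factor
  \<open>2\<close>.\<close>

lemma green_boundary_point:
  fixes k :: "'n::finite"
  assumes "0 < t"
  shows "green k x (boundary_point k y') t = 2 * hk t (x $ k) * tg k t (\<lambda>i. x $ i - y' i)"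
    and "green k (boundary_point k x') z t = 2 * hk t (z $ k) * tg k t (\<lambda>i. x' i - z $ i)"
proof -
  have "tg k t (\<lambda>i. x $ i - boundary_point k y' $ i) = tg k t (\<lambda>i. x $ i - y' i)"
    "tg k t (\<lambda>i. boundary_point k x' $ i - z $ i) = tg k t (\<lambda>i. x' i - z $ i)"
    unfolding tg_def by (auto intro!: prod.cong simp: boundary_point_def)
  then show "green k x (boundary_point k y') t = 2 * hk t (x $ k) * tg k t (\<lambda>i. x $ i - y' i)"
    "green k (boundary_point k x') z t = 2 * hk t (z $ k) * tg k t (\<lambda>i. x' i - z $ i)"
    unfolding green_eq[OF assms] by (simp_all add: boundary_point_def)
qed

lemma green_nonneg: "0 \<le> green k x y t"
  unfolding green_def by (intro mult_nonneg_nonneg) auto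

subsection \<open>Radial integrals and the logarithmic weight\<close>

text \<open>The derivative is required only in the open interval, because the integrands met below,
  such as \<open>(t - s) powr (-1/2)\<close>, are singular at an end point.\<close>

lemma nn_integral_FTC_interior:
  fixes F f :: "real \<Rightarrow> real"
  assumes "a \<le> b" "continuous_on {a..b} F"
    and "\<And>x. a < x \<Longrightarrow> x < b \<Longrightarrow> (F has_real_derivative f x) (at x)"
    and "\<And>x. a < x \<Longrightarrow> x < b \<Longrightarrow> 0 \<le> f x"
  shows "(\<integral>\<^sup>+x\<in>{a<..<b}. ennreal (f x) \<partial>lborel) = ennreal (F b - F a)"
proof (rule nn_integral_has_integral_lebesgue')
  have "(f has_integral (F b - F a)) {a..b}"
    using assms by (intro fundamental_theorem_of_calculus_interior)
      (auto simp: has_real_derivative_iff_has_vector_derivative)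
  then show "(f has_integral (F b - F a)) {a<..<b}"
    using has_integral_open_interval[of f "F b - F a" a b] by simp
qed (use assms in auto)

lemma nn_integral_powr_0:
  assumes "0 < e" "0 \<le> c"
  shows "(\<integral>\<^sup>+x\<in>{0<..<c}. ennreal (x powr (e - 1)) \<partial>lborel) = ennreal (c powr e / e)"
proof -
  have "(\<integral>\<^sup>+x\<in>{0<..<c}. ennreal (x powr (e - 1)) \<partial>lborel) = ennreal (c powr e / e - 0 powr e / e)"
  proof (rule nn_integral_FTC_interior)
    show "continuous_on {0..c} (\<lambda>x. x powr e / e)"
      using assms by (intro continuous_intros continuous_on_powr') auto
    show "((\<lambda>x. x powr e / e) has_real_derivative x powr (e - 1)) (at x)" if "0 < x" "x < c" for x
      using that assms by (auto intro!: derivative_eq_intros)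
  qed (use assms in auto)
  then show ?thesis using assms by simp
qed

lemma nn_integral_inverse_sqrt:
  assumes "a < t"
  shows "(\<integral>\<^sup>+s\<in>{a<..<t}. ennreal ((t - s) powr (-1/2)) \<partial>lborel) = ennreal (2 * sqrt (t - a))"
proof -
  have "(\<integral>\<^sup>+s\<in>{a<..<t}. ennreal ((t - s) powr (-1/2)) \<partial>lborel) = ennreal (- 2 * sqrt (t - t) - (- 2 * sqrt (t - a)))"
  proof (rule nn_integral_FTC_interior)
    show "continuous_on {a..t} (\<lambda>s. - 2 * sqrt (t - s))" by (intro continuous_intros)
    show "((\<lambda>s. - 2 * sqrt (t - s)) has_real_derivative (t - s) powr (-1/2)) (at s)" if "a < s" "s < t" for s
      using that powr_minus_divide[of "t - s" "1/2"]
      by (auto intro!: derivative_eq_intros simp: powr_half_sqrt field_simps)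
  qed (use assms in auto)
  then show ?thesis by simp
qed

text \<open>Polar coordinates without a surface measure: the law of the norm is identified on the
  generator of the sets \<open>{..a}\<close>, where both sides are the volume of a ball.\<close>

lemma distr_norm_lborel:
  "distr (lborel :: 'a::euclidean_space measure) borel norm =
     density lborel (\<lambda>r. ennreal (real DIM('a) * unit_ball_vol DIM('a) * r ^ (DIM('a) - 1)) * indicator {0<..} r)"
  (is "?M = ?N")
proof (rule measure_eqI_generator_eq[where E="range (\<lambda>a::real. {..a})" and \<Omega>=UNIV and A="\<lambda>n. {..real n}"])
  have em: "emeasure ?M {..a} = (if a < 0 then 0 else ennreal (unit_ball_vol DIM('a) * a ^ DIM('a)))" for a
  proof -
    have "norm -` {..a} \<inter> space (lborel :: 'a measure) = cball 0 a" by auto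
    then have "emeasure ?M {..a} = emeasure lborel (cball (0::'a) a)"
      by (subst emeasure_distr) auto
    then show ?thesis using emeasure_cball[of a "0::'a"] by (simp add: not_less)
  qed
  show "emeasure ?M X = emeasure ?N X" if X: "X \<in> range (\<lambda>a::real. {..a})" for X
  proof -
    obtain a where a: "X = {..a}" using X by auto
    let ?g = "\<lambda>r. real DIM('a) * unit_ball_vol DIM('a) * r ^ (DIM('a) - 1)"
    have "emeasure ?N X = (\<integral>\<^sup>+r. ennreal (?g r) * indicator {0<..} r * indicator {..a} r \<partial>lborel)"
      unfolding a by (subst emeasure_density) auto
    also have "\<dots> = (\<integral>\<^sup>+r\<in>{0<..<a}. ennreal (?g r) \<partial>lborel)"
    proof (rule nn_integral_cong_AE)
      have "AE r in lborel. r \<noteq> a" by (rule AE_lborel_singleton)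
      then show "AE r in lborel. ennreal (?g r) * indicator {0<..} r * indicator {..a} r = ennreal (?g r) * indicator {0<..<a} r"
        by eventually_elim (auto simp: indicator_def)
    qed
    also have "\<dots> = (if a < 0 then 0 else ennreal (unit_ball_vol DIM('a) * a ^ DIM('a)))"
    proof (cases "a < 0")
      case False
      have "(\<integral>\<^sup>+r\<in>{0<..<a}. ennreal (?g r) \<partial>lborel) = ennreal (unit_ball_vol DIM('a) * a ^ DIM('a) - unit_ball_vol DIM('a) * 0 ^ DIM('a))"
        using False
        by (intro nn_integral_FTC_interior) (auto intro!: continuous_intros derivative_eq_intros)
      then show ?thesis using False by simp
    next
      case True then have "{0<..<a} = {}" by auto
      then show ?thesis using True by simp
    qed
    finally show ?thesis by (simp add: em a)
  qed
  show "Int_stable (range (\<lambda>a::real. {..a}))"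
    by (auto simp: Int_stable_def)
  show "(\<Union>i. {..real i}) = UNIV"
    using real_arch_simple by auto
  show "emeasure ?M {..real i} \<noteq> \<infinity>" for i unfolding em by simp
  show "sets ?M = sigma_sets UNIV (range (\<lambda>a::real. {..a}))" "sets ?N = sigma_sets UNIV (range (\<lambda>a::real. {..a}))"
    by (auto simp: borel_eq_atMost)
qed auto

lemma nn_integral_radial:
  assumes [measurable]: "h \<in> borel_measurable borel"
  shows "(\<integral>\<^sup>+(x::'a::euclidean_space). h (norm x) \<partial>lborel) =
    ennreal (real DIM('a) * unit_ball_vol DIM('a)) * (\<integral>\<^sup>+r\<in>{0<..}. h r * ennreal (r powr (real DIM('a) - 1)) \<partial>lborel)"
proof -
  have "(\<integral>\<^sup>+(x::'a). h (norm x) \<partial>lborel) = (\<integral>\<^sup>+r. h r \<partial>distr (lborel :: 'a measure) borel norm)"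
    by (subst nn_integral_distr) auto
  also have "\<dots> = (\<integral>\<^sup>+r. ennreal (real DIM('a) * unit_ball_vol DIM('a) * r ^ (DIM('a) - 1)) * indicator {0<..} r * h r \<partial>lborel)"
    unfolding distr_norm_lborel by (subst nn_integral_density) auto
  also have "\<dots> = (\<integral>\<^sup>+r. ennreal (real DIM('a) * unit_ball_vol DIM('a)) * (h r * ennreal (r powr (real DIM('a) - 1)) * indicator {0<..} r) \<partial>lborel)"
  proof (intro nn_integral_cong)
    fix r :: real
    have "r ^ (DIM('a) - 1) = r powr (real DIM('a) - 1)" if "0 < r"
      using that DIM_positive[where 'a='a] by (simp add: powr_realpow[symmetric] of_nat_diff)
    then show "ennreal (real DIM('a) * unit_ball_vol DIM('a) * r ^ (DIM('a) - 1)) * indicator {0<..} r * h r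
       = ennreal (real DIM('a) * unit_ball_vol DIM('a)) * (h r * ennreal (r powr (real DIM('a) - 1)) * indicator {0<..} r)"
      by (auto simp: indicator_def ennreal_mult mult_ac)
  qed
  also have "\<dots> = ennreal (real DIM('a) * unit_ball_vol DIM('a)) * (\<integral>\<^sup>+r\<in>{0<..}. h r * ennreal (r powr (real DIM('a) - 1)) \<partial>lborel)"
    by (rule nn_integral_cmult) auto
  finally show ?thesis .
qed

lemma nn_integral_lborel_uminus:
  fixes f :: "'a::euclidean_space \<Rightarrow> ennreal"
  assumes [measurable]: "f \<in> borel_measurable borel"
  shows "(\<integral>\<^sup>+x. f (- x) \<partial>lborel) = (\<integral>\<^sup>+x. f x \<partial>lborel)"
proof -
  have "(\<integral>\<^sup>+x. f x \<partial>lborel) = (\<integral>\<^sup>+x. f x \<partial>density (distr lborel borel (\<lambda>x. 0 + (-1) *\<^sub>R x)) (\<lambda>_. \<bar>-1::real\<bar>^DIM('a)))"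
    by (subst lborel_affine[of "-1" 0, symmetric]) auto
  also have "\<dots> = (\<integral>\<^sup>+x. f (- x) \<partial>lborel)"
    by (simp add: nn_integral_density nn_integral_distr)
  finally show ?thesis by simp
qed

section \<open>The half space and radial integrals over it\<close>

lemma closed_half_space_eq:
  fixes k :: "'n::finite"
  shows "closed_half_space k = {y. 0 \<le> y $ k}"
proof -
  have "closure {y :: real^'n. y $ k > 0} = {y. y $ k \<ge> 0}"
    using closure_halfspace_gt[of "axis k 1 :: real^'n" 0]
    by (simp add: inner_axis' axis_eq_0_iff)
  then show ?thesis unfolding closed_half_space_def half_space_def by simp
qed

lemma closed_half_space_measurable [measurable]: "closed_half_space k \<in> sets borel"
  unfolding closed_half_space_def by simp

lemma boundary_point_mem [simp]: "boundary_point k y' \<in> closed_half_space k"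
  by (simp add: closed_half_space_eq boundary_point_def)

lemma zero_in_closed_half_space [simp]: "0 \<in> closed_half_space k"
  by (simp add: closed_half_space_eq)

text \<open>A radial integrand is invariant under \<open>x \<mapsto> - x\<close>, and the half space
  together with its mirror image covers everything.\<close>

lemma half_space_radial_ge:
  fixes k :: "'n::finite"
  assumes [measurable]: "h \<in> borel_measurable borel"
  shows "(\<integral>\<^sup>+(x::real^'n). h (norm x) \<partial>lborel) \<le> 2 * (\<integral>\<^sup>+x\<in>closed_half_space k. h (norm x) \<partial>lborel)"
proof -
  have "(\<integral>\<^sup>+(x::real^'n). h (norm x) \<partial>lborel) \<le>
     (\<integral>\<^sup>+x. h (norm x) * indicator (closed_half_space k) x + h (norm (-x)) * indicator (closed_half_space k) (-x) \<partial>lborel)"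
    by (intro nn_integral_mono) (auto simp: indicator_def closed_half_space_eq)
  also have "\<dots> = (\<integral>\<^sup>+x\<in>closed_half_space k. h (norm x) \<partial>lborel) + (\<integral>\<^sup>+x. h (norm (-x)) * indicator (closed_half_space k) (-x) \<partial>lborel)"
    by (rule nn_integral_add) measurable
  also have "(\<integral>\<^sup>+x. h (norm (-x)) * indicator (closed_half_space k) (-x) \<partial>lborel) = (\<integral>\<^sup>+x\<in>closed_half_space k. h (norm x) \<partial>lborel)"
    by (rule nn_integral_lborel_uminus[where f="\<lambda>x. h (norm x) * indicator (closed_half_space k) x"]) measurable
  finally show ?thesis by (simp add: mult_2)
qed

text \<open>The logarithmic factor of \<open>psi\<close>. The shift by \<open>exp 1\<close> keeps it
  at least \<open>1\<close> for positive arguments, so its powers are monotone in the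
  exponent.\<close>

definition LL :: "real \<Rightarrow> real" where "LL r = ln (exp 1 + 1 / r)"

lemma LL_measurable [measurable]: "LL \<in> borel_measurable borel"
  unfolding LL_def by measurable

lemma LL_ge_1: "0 < r \<Longrightarrow> 1 \<le> LL r"
  unfolding LL_def by (subst ln_ge_iff) (auto intro: add_pos_pos)

lemma LL_pos: "0 < r \<Longrightarrow> 0 < LL r"
  using LL_ge_1[of r] by simp

lemma LL_antimono: "0 < r \<Longrightarrow> r \<le> s \<Longrightarrow> LL s \<le> LL r"
  unfolding LL_def by (subst ln_le_cancel_iff) (auto intro: add_pos_pos simp: frac_le)

text \<open>For small \<open>s\<close> the shift is absorbed: \<open>exp 1 + 1 / s\<close> lies
  below \<open>2 / s\<close>, which lies below \<open>(1 / s)\<^sup>2\<close>. This converts between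
  \<open>LL\<close> and the plain logarithm that integration of \<open>1 / r\<close>
  produces.\<close>

lemma LL_le_ln: "0 < s \<Longrightarrow> s \<le> 1/16 \<Longrightarrow> LL s \<le> 2 * ln (1 / s)"
proof -
  assume s: "0 < s" "s \<le> (1/16 :: real)"
  have "exp 1 + 1 / s \<le> 3 + 1 / s" using exp_le by simp
  also have "\<dots> \<le> 1 / s + 1 / s" using s by (intro add_mono) (auto simp: field_simps)
  also have "\<dots> \<le> (1 / s)\<^sup>2" using s by (simp add: field_simps power2_eq_square)
  finally have "LL s \<le> ln ((1 / s)\<^sup>2)" unfolding LL_def using s by (subst ln_le_cancel_iff) (auto intro!: add_pos_pos)
  then show ?thesis using s by (simp add: ln_realpow)
qed

text \<open>A logarithm turns squares into factors \<open>2\<close>. This permits passing from a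
  length to the time that is its square.\<close>

lemma LL_power2_le:
  assumes "0 < r"
  shows "LL (r\<^sup>2) \<le> 2 * LL r"
proof -
  have "exp 1 + 1 / r\<^sup>2 \<le> (exp 1 + 1 / r)\<^sup>2"
  proof -
    have "exp 1 * 1 \<le> exp 1 * (exp 1 :: real)" by (intro mult_left_mono) auto
    then have "exp 1 \<le> exp 1 * exp 1 + 2 * exp 1 * (1 / r)" using assms by (simp add: add_increasing2)
    then show ?thesis unfolding power2_sum power_one_over by (simp add: power2_eq_square)
  qed
  moreover have pos: "0 < exp 1 + 1 / r" "0 < exp 1 + 1 / r\<^sup>2" using assms by (auto intro!: add_pos_pos)
  ultimately have "LL (r\<^sup>2) \<le> ln ((exp 1 + 1 / r)\<^sup>2)" unfolding LL_def by (subst ln_le_cancel_iff) auto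
  also have "\<dots> = 2 * LL r" unfolding LL_def using pos by (subst ln_realpow) auto
  finally show ?thesis .
qed

text \<open>The logarithm of the product is a sum; since \<open>LL s\<close> is at least
  \<open>1\<close>, the summand \<open>ln m\<close> may be multiplied by it, which gives a
  multiplicative estimate.\<close>

lemma LL_ratio:
  assumes "0 < r" "0 < s" "1 \<le> m" "s / r \<le> m"
  shows "LL r \<le> LL s * (1 + ln m)"
proof -
  have "exp 1 + 1 / r \<le> m * (exp 1 + 1 / s)"
  proof -
    have "1 / r \<le> m / s" using assms by (simp add: field_simps)
    moreover have "exp 1 \<le> m * exp 1" using assms by simp
    ultimately show ?thesis unfolding distrib_left by (intro add_mono) auto
  qed
  then have "LL r \<le> ln (m * (exp 1 + 1 / s))"
    unfolding LL_def using assms by (subst ln_le_cancel_iff) (auto intro!: add_pos_pos mult_pos_pos)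
  also have "\<dots> = ln m + LL s"
    unfolding LL_def using assms by (subst ln_mult_pos) (auto intro!: add_pos_pos)
  also have "\<dots> \<le> ln m * LL s + LL s"
    using LL_ge_1[of s] assms by (simp add: mult_le_cancel_left1)
  finally show ?thesis by (simp add: algebra_simps)
qed

text \<open>
  The weight \<open>LL\<close> varies slowly: changing the argument by a factor \<open>m\<close> costs at most a small
  power of \<open>m\<close>. This lets the logarithm be pulled out of all power integrals below.
\<close>

lemma LL_slow:
  fixes b \<delta> :: real
  assumes "0 < \<delta>"
  obtains C where "1 \<le> C" "\<And>r s m. 0 < r \<Longrightarrow> 0 < s \<Longrightarrow> 1 \<le> m \<Longrightarrow> s / r \<le> m \<Longrightarrow> r / s \<le> m \<Longrightarrow>
      LL r powr b \<le> C * m powr \<delta> * LL s powr b"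
proof
  \<comment> \<open>The \<open>+ 1\<close> keeps \<open>e * \<bar>b\<bar> \<le> \<delta>\<close>
    while avoiding a division by zero for \<open>b = 0\<close>.\<close>
  define e where "e = \<delta> / (\<bar>b\<bar> + 1)"
  have e: "0 < e" using assms by (simp add: e_def)
  define C where "C = (1 + 1 / e) powr \<bar>b\<bar>"
  show "1 \<le> C" unfolding C_def using e by (intro ge_one_powr_ge_zero) auto
  fix r s m :: real
  assume *: "0 < r" "0 < s" "1 \<le> m" "s / r \<le> m" "r / s \<le> m"
  have 1: "LL r powr b \<le> LL s powr b * (1 + ln m) powr \<bar>b\<bar>"
  proof (cases "b \<ge> 0")
    case True
    have "LL r powr b \<le> (LL s * (1 + ln m)) powr b"
      using * True LL_pos[of r] by (intro powr_mono2 LL_ratio) auto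
    then show ?thesis using True * LL_pos[of s] by (simp add: powr_mult)
  next
    case False
    have "LL s powr (-b) \<le> (LL r * (1 + ln m)) powr (-b)"
      using * False LL_pos[of s] by (intro powr_mono2 LL_ratio) auto
    then have "LL s powr (-b) \<le> LL r powr (-b) * (1 + ln m) powr (-b)"
      using False * LL_pos[of r] by (simp add: powr_mult)
    then have "LL r powr b * LL s powr (-b) * LL s powr b \<le> LL r powr b * (LL r powr (-b) * (1 + ln m) powr (-b)) * LL s powr b"
      by (intro mult_right_mono mult_left_mono) auto
    then have "LL r powr b * (LL s powr (-b) * LL s powr b) \<le> (LL r powr b * LL r powr (-b)) * (1 + ln m) powr (-b) * LL s powr b"
      by (simp only: mult_ac)
    then show ?thesis using False * LL_pos[of r] LL_pos[of s]
      by (simp flip: powr_add add: mult.commute)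
  qed
  have "1 + ln m \<le> (1 + 1 / e) * m powr e"
    using ln_powr_bound[of m e] ge_one_powr_ge_zero[of m e] * e by (simp add: algebra_simps)
  then have "(1 + ln m) powr \<bar>b\<bar> \<le> ((1 + 1 / e) * m powr e) powr \<bar>b\<bar>"
    using * by (intro powr_mono2) auto
  also have "\<dots> = C * m powr (e * \<bar>b\<bar>)"
    unfolding C_def using * e by (simp add: powr_mult powr_powr)
  also have "\<dots> \<le> C * m powr \<delta>"
  proof -
    have "e * \<bar>b\<bar> \<le> \<delta>" unfolding e_def using assms by (simp add: field_simps)
    then show ?thesis using * \<open>1 \<le> C\<close> by (intro mult_left_mono powr_mono) auto
  qed
  finally have "LL s powr b * (1 + ln m) powr \<bar>b\<bar> \<le> LL s powr b * (C * m powr \<delta>)"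
    by (rule mult_left_mono) simp
  then show "LL r powr b \<le> C * m powr \<delta> * LL s powr b"
    using 1 by (simp add: mult.commute)
qed

text \<open>Up to the factor \<open>q - 1\<close>, the derivative of
  \<open>LL r powr (1 - q)\<close> is the integrand divided by \<open>exp 1 * r + 1\<close>; on
  \<open>(0, 1]\<close> that divisor is at most \<open>exp 1 + 1\<close>, the constant in the bound.
  One power of the logarithm is lost.\<close>

lemma LL_int:
  assumes "1 < q" "0 < s" "s \<le> 1"
  shows "(\<integral>\<^sup>+r\<in>{0<..<s}. ennreal (r powr (-1) * LL r powr (-q)) \<partial>lborel) \<le> ennreal ((exp 1 + 1) / (q - 1) * LL s powr (1 - q))"
proof -
  \<comment> \<open>The limit at \<open>0\<close> is \<open>0\<close> because \<open>1 < q\<close>,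
    but since \<open>1 / 0 = 0\<close> the formula itself would give \<open>LL 0 = 1\<close> there;
    the value must be set by hand to make \<open>F\<close> continuous on
    \<open>{0..s}\<close>.\<close>
  define F where "F r = (if r = 0 then 0 else (exp 1 + 1) / (q - 1) * LL r powr (1 - q))" for r :: real
  define f where "f r = (exp 1 + 1) * LL r powr (- q) / (r * (exp 1 * r + 1))" for r :: real
  have F_der: "(F has_real_derivative f x) (at x)" if "0 < x" for x
  proof (rule has_field_derivative_transform_within_open)
    have p: "0 < exp 1 + 1 / x" using that by (intro add_pos_pos) auto
    have e: "(1 + exp 1) * (q - 1) / (q - 1) = (1 + exp 1 :: real)" using assms by simp
    show "((\<lambda>r. (exp 1 + 1) / (q - 1) * LL r powr (1 - q)) has_real_derivative f x) (at x)"
      using that assms LL_pos[of x] p unfolding LL_def f_def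
      apply (auto intro!: derivative_eq_intros)
      apply (simp add: divide_simps power2_eq_square)
      apply (simp add: algebra_simps)
      done
    show "open {0::real<..}" "x \<in> {0<..}" using that by auto
    show "\<And>y. y \<in> {0<..} \<Longrightarrow> (exp 1 + 1) / (q - 1) * LL y powr (1 - q) = F y" by (auto simp: F_def)
  qed
  have lim: "((\<lambda>r. (exp 1 + 1) / (q - 1) * LL r powr (1 - q)) \<longlongrightarrow> 0) (at_right 0)"
    unfolding LL_def using assms by real_asymp
  have cont: "continuous_on {0..s} F"
  proof (rule continuous_on_IccI)
    have "\<forall>\<^sub>F r in at_right 0. (exp 1 + 1) / (q - 1) * LL r powr (1 - q) = F r"
      unfolding F_def by (auto simp: eventually_at_filter)
    from Lim_transform_eventually[OF lim this] have "(F \<longlongrightarrow> 0) (at_right 0)" .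
    then show "(F \<longlongrightarrow> F 0) (at_right 0)" by (simp add: F_def[of 0])
    show "F \<midarrow>x\<rightarrow> F x" if "0 < x" "x < s" for x
      using DERIV_isCont[OF F_der[OF that(1)]] by (simp add: isCont_def)
    show "(F \<longlongrightarrow> F s) (at_left s)"
      using DERIV_isCont[OF F_der[OF assms(2)]] unfolding isCont_def by (rule filterlim_mono[OF _ order_refl at_le]) simp
  qed fact
  have "(\<integral>\<^sup>+r\<in>{0<..<s}. ennreal (r powr (-1) * LL r powr (-q)) \<partial>lborel) \<le> (\<integral>\<^sup>+r\<in>{0<..<s}. ennreal (f r) \<partial>lborel)"
  proof (intro nn_integral_mono)
    fix r :: real
    have "r powr (-1) * LL r powr (-q) \<le> f r" if "0 < r" "r < s"
    proof -
      have "exp 1 * r + 1 \<le> exp 1 + 1" using that assms by simp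
      then have "1 \<le> (exp 1 + 1) / (exp 1 * r + 1)" using that by (simp add: add_pos_pos)
      then have "LL r powr (-q) / r * 1 \<le> LL r powr (-q) / r * ((exp 1 + 1) / (exp 1 * r + 1))"
        using that by (intro mult_left_mono) auto
      then show ?thesis using that unfolding f_def by (simp add: powr_minus_divide mult_ac)
    qed
    then show "ennreal (r powr (-1) * LL r powr (-q)) * indicator {0<..<s} r \<le> ennreal (f r) * indicator {0<..<s} r"
      by (auto simp: indicator_def intro: ennreal_leI)
  qed
  also have "\<dots> = ennreal (F s - F 0)"
    using assms cont F_der unfolding f_def by (intro nn_integral_FTC_interior) auto
  also have "\<dots> = ennreal ((exp 1 + 1) / (q - 1) * LL s powr (1 - q))"
    using assms by (simp add: F_def)
  finally show ?thesis .
qed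

text \<open>One profile for three purposes: the datum as a function of the radius, bounds on its
  heat flow as a function of time, and the threshold \<open>Q(T)\<close> of the overview, which is
  \<open>prof (- \<eta>) \<beta> T\<close>. Mind the signs of the exponents.\<close>

definition prof :: "real \<Rightarrow> real \<Rightarrow> real \<Rightarrow> real" where
  "prof a b r = r powr (- a) * LL r powr (- b)"

lemma prof_nonneg: "0 \<le> prof a b r"
  unfolding prof_def by simp

lemma prof_pos: "0 < r \<Longrightarrow> 0 < prof a b r"
  unfolding prof_def using LL_pos[of r] by simp

lemma prof_measurable [measurable]: "prof a b \<in> borel_measurable borel"
  unfolding prof_def by measurable

lemma nn_integral_radial_ball:
  assumes [measurable]: "h \<in> borel_measurable borel"
  shows "(\<integral>\<^sup>+(x::'a::euclidean_space)\<in>ball 0 \<sigma>. ennreal (h (norm x)) \<partial>lborel) =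
    ennreal (real DIM('a) * unit_ball_vol DIM('a)) * (\<integral>\<^sup>+r\<in>{0<..<\<sigma>}. ennreal (r powr (real DIM('a) - 1) * h r) \<partial>lborel)"
proof -
  have "(\<integral>\<^sup>+(x::'a)\<in>ball 0 \<sigma>. ennreal (h (norm x)) \<partial>lborel) = (\<integral>\<^sup>+(x::'a). (\<lambda>r. ennreal (h r) * indicator {..<\<sigma>} r) (norm x) \<partial>lborel)"
    by (intro nn_integral_cong) (auto simp: indicator_def)
  also have "\<dots> = ennreal (real DIM('a) * unit_ball_vol DIM('a)) *
      (\<integral>\<^sup>+r\<in>{0<..}. (ennreal (h r) * indicator {..<\<sigma>} r) * ennreal (r powr (real DIM('a) - 1)) \<partial>lborel)"
    by (rule nn_integral_radial) measurable
  also have "(\<integral>\<^sup>+r\<in>{0<..}. (ennreal (h r) * indicator {..<\<sigma>} r) * ennreal (r powr (real DIM('a) - 1)) \<partial>lborel) =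
     (\<integral>\<^sup>+r\<in>{0<..<\<sigma>}. ennreal (r powr (real DIM('a) - 1) * h r) \<partial>lborel)"
    by (intro nn_integral_cong) (auto simp: indicator_def ennreal_mult'' mult.commute)
  finally show ?thesis .
qed

lemma powr_mult_prof: "r powr x * prof a b r = r powr (x - a) * LL r powr (- b)"
  unfolding prof_def by (simp flip: powr_add mult.assoc)

text \<open>The radial integrand has the spare exponent \<open>real DIM('a) - a > 0\<close>. Half of
  it pays for freezing the logarithm at \<open>\<sigma>\<close>, the other half keeps the integral
  at \<open>0\<close> convergent.\<close>

lemma prof_ball_le:
  fixes a b :: real
  assumes "a < real DIM('a::euclidean_space)"
  obtains C where "0 < C" "\<And>\<sigma>. 0 < \<sigma> \<Longrightarrow>
    (\<integral>\<^sup>+(x::'a)\<in>ball 0 \<sigma>. ennreal (prof a b (norm x)) \<partial>lborel) \<le> ennreal (C * (\<sigma> powr real DIM('a) * prof a b \<sigma>))"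
proof -
  define N where "N = real DIM('a)"
  define \<delta> where "\<delta> = (N - a) / 2"
  define V where "V = real DIM('a) * unit_ball_vol DIM('a)"
  have V: "0 < V" unfolding V_def by simp
  have d: "0 < \<delta>" using assms by (simp add: \<delta>_def N_def)
  obtain C where C: "1 \<le> C" "\<And>r s m. 0 < r \<Longrightarrow> 0 < s \<Longrightarrow> 1 \<le> m \<Longrightarrow> s / r \<le> m \<Longrightarrow> r / s \<le> m \<Longrightarrow>
      LL r powr (-b) \<le> C * m powr \<delta> * LL s powr (-b)" using LL_slow[OF d] by blast
  show ?thesis
  proof (rule that[of "V * (C / \<delta>)"])
    show "0 < V * (C / \<delta>)" using V C d by simp
    fix \<sigma> :: real assume s: "0 < \<sigma>"
    have "(\<integral>\<^sup>+(x::'a)\<in>ball 0 \<sigma>. ennreal (prof a b (norm x)) \<partial>lborel) =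
      ennreal V * (\<integral>\<^sup>+r\<in>{0<..<\<sigma>}. ennreal (r powr (N - 1) * prof a b r) \<partial>lborel)"
      unfolding V_def N_def by (rule nn_integral_radial_ball) measurable
    also have "\<dots> \<le> ennreal V * (\<integral>\<^sup>+r\<in>{0<..<\<sigma>}. ennreal (C * \<sigma> powr \<delta> * LL \<sigma> powr (-b)) * ennreal (r powr (\<delta> - 1)) \<partial>lborel)"
    proof (intro mult_left_mono nn_integral_mono)
      fix r :: real
      have "r powr (N - 1) * prof a b r \<le> C * \<sigma> powr \<delta> * LL \<sigma> powr (-b) * r powr (\<delta> - 1)" if r: "0 < r" "r < \<sigma>"
      proof -
        have "r / \<sigma> \<le> \<sigma> / r" using r s by (simp add: field_simps mult_mono)
        then have "LL r powr (-b) \<le> C * (\<sigma> / r) powr \<delta> * LL \<sigma> powr (-b)"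
          using r s by (intro C) auto
        then have "r powr (N - 1 - a) * LL r powr (-b) \<le> r powr (N - 1 - a) * (C * (\<sigma> / r) powr \<delta> * LL \<sigma> powr (-b))"
          by (rule mult_left_mono) simp
        also have "\<dots> = C * \<sigma> powr \<delta> * LL \<sigma> powr (-b) * (r powr (N - 1 - a) * r powr (-\<delta>))"
          using r s by (simp add: powr_divide powr_minus_divide mult_ac)
        also have "r powr (N - 1 - a) * r powr (-\<delta>) = r powr (\<delta> - 1)"
          unfolding \<delta>_def by (simp flip: powr_add) (simp add: field_simps)
        finally show ?thesis unfolding powr_mult_prof by (simp add: mult.assoc)
      qed
      then show "ennreal (r powr (N - 1) * prof a b r) * indicator {0<..<\<sigma>} r
         \<le> ennreal (C * \<sigma> powr \<delta> * LL \<sigma> powr (-b)) * ennreal (r powr (\<delta> - 1)) * indicator {0<..<\<sigma>} r"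
        using C by (auto simp: indicator_def intro!: ennreal_leI simp flip: ennreal_mult)
    qed simp
    also have "\<dots> = ennreal V * (ennreal (C * \<sigma> powr \<delta> * LL \<sigma> powr (-b)) * (\<integral>\<^sup>+r\<in>{0<..<\<sigma>}. ennreal (r powr (\<delta> - 1)) \<partial>lborel))"
      by (subst nn_integral_cmult[symmetric]) (auto simp: mult.assoc)
    also have "\<dots> = ennreal (V * (C * \<sigma> powr \<delta> * LL \<sigma> powr (-b) * (\<sigma> powr \<delta> / \<delta>)))"
      using s d C V by (subst nn_integral_powr_0) (auto simp: ennreal_mult[symmetric])
    also have "V * (C * \<sigma> powr \<delta> * LL \<sigma> powr (-b) * (\<sigma> powr \<delta> / \<delta>)) = V * (C / \<delta>) * (\<sigma> powr N * prof a b \<sigma>)"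
    proof -
      have "\<sigma> powr \<delta> * \<sigma> powr \<delta> = \<sigma> powr N * \<sigma> powr (-a)"
        unfolding \<delta>_def by (simp flip: powr_add)
      then show ?thesis unfolding prof_def by (simp add: mult_ac)
    qed
    finally show "(\<integral>\<^sup>+(x::'a)\<in>ball 0 \<sigma>. ennreal (prof a b (norm x)) \<partial>lborel) \<le> ennreal (V * (C / \<delta>) * (\<sigma> powr real DIM('a) * prof a b \<sigma>))"
      by (simp add: N_def)
  qed
qed

text \<open>Here the radial integrand is \<open>1 / r\<close> times a power of the logarithm, so
  convergence rests on \<open>1 < b\<close> alone and costs one logarithm.\<close>

lemma prof_ball_le_critical:
  fixes b :: real
  assumes "1 < b"
  obtains C where "0 < C" "\<And>\<sigma>. 0 < \<sigma> \<Longrightarrow> \<sigma> \<le> 1 \<Longrightarrow>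
    (\<integral>\<^sup>+(x::'a::euclidean_space)\<in>ball 0 \<sigma>. ennreal (prof (real DIM('a)) b (norm x)) \<partial>lborel) \<le> ennreal (C * LL \<sigma> powr (1 - b))"
proof -
  define V where "V = real DIM('a) * unit_ball_vol DIM('a)"
  have V: "0 < V" unfolding V_def by simp
  show ?thesis
  proof (rule that[of "V * ((exp 1 + 1) / (b - 1))"])
    show "0 < V * ((exp 1 + 1) / (b - 1))" using V assms by (simp add: add_pos_pos)
    fix \<sigma> :: real assume s: "0 < \<sigma>" "\<sigma> \<le> 1"
    have "(\<integral>\<^sup>+(x::'a)\<in>ball 0 \<sigma>. ennreal (prof (real DIM('a)) b (norm x)) \<partial>lborel) =
      ennreal V * (\<integral>\<^sup>+r\<in>{0<..<\<sigma>}. ennreal (r powr (real DIM('a) - 1) * prof (real DIM('a)) b r) \<partial>lborel)"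
      unfolding V_def by (rule nn_integral_radial_ball) measurable
    also have "(\<lambda>r. r powr (real DIM('a) - 1) * prof (real DIM('a)) b r) = (\<lambda>r. r powr (-1) * LL r powr (-b))"
      unfolding prof_def by (auto simp flip: powr_add mult.assoc)
    also have "ennreal V * (\<integral>\<^sup>+r\<in>{0<..<\<sigma>}. ennreal (r powr (-1) * LL r powr (-b)) \<partial>lborel)
       \<le> ennreal V * ennreal ((exp 1 + 1) / (b - 1) * LL \<sigma> powr (1 - b))"
      using assms s by (intro mult_left_mono LL_int) auto
    also have "\<dots> = ennreal (V * ((exp 1 + 1) / (b - 1)) * LL \<sigma> powr (1 - b))"
      using V by (simp add: ennreal_mult'[symmetric] mult.assoc)
    finally show "(\<integral>\<^sup>+(x::'a)\<in>ball 0 \<sigma>. ennreal (prof (real DIM('a)) b (norm x)) \<partial>lborel)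
        \<le> ennreal (V * ((exp 1 + 1) / (b - 1)) * LL \<sigma> powr (1 - b))" .
  qed
qed

text \<open>If \<open>0 < a\<close>, the decaying power outweighs the slowly varying logarithm; if
  \<open>a = 0\<close>, the sign of \<open>b\<close> makes the profile decreasing.\<close>

lemma prof_outside_le:
  fixes a b :: real
  assumes "0 < a \<or> a = 0 \<and> b \<le> 0"
  obtains C where "1 \<le> C" "\<And>r \<sigma>. 0 < \<sigma> \<Longrightarrow> \<sigma> \<le> r \<Longrightarrow> prof a b r \<le> C * prof a b \<sigma>"
proof (cases "0 < a")
  case True
  obtain C where C: "1 \<le> C" "\<And>r s m. 0 < r \<Longrightarrow> 0 < s \<Longrightarrow> 1 \<le> m \<Longrightarrow> s / r \<le> m \<Longrightarrow> r / s \<le> m \<Longrightarrow>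
      LL r powr (-b) \<le> C * m powr a * LL s powr (-b)" using LL_slow[OF True] by blast
  show ?thesis
  proof (rule that[OF C(1)])
    fix r \<sigma> :: real assume *: "0 < \<sigma>" "\<sigma> \<le> r"
    have "\<sigma> / r \<le> r / \<sigma>" using * by (simp add: field_simps mult_mono)
    then have "LL r powr (-b) \<le> C * (r / \<sigma>) powr a * LL \<sigma> powr (-b)"
      using * by (intro C) auto
    then have "r powr (-a) * LL r powr (-b) \<le> r powr (-a) * (C * (r / \<sigma>) powr a * LL \<sigma> powr (-b))"
      by (rule mult_left_mono) simp
    also have "\<dots> = C * prof a b \<sigma>"
      unfolding prof_def using * by (simp add: powr_divide powr_minus field_simps)
    finally show "prof a b r \<le> C * prof a b \<sigma>" by (simp add: prof_def)
  qed
next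
  case False
  show ?thesis
  proof (rule that[of 1])
    fix r \<sigma> :: real assume *: "0 < \<sigma>" "\<sigma> \<le> r"
    then have "LL r powr (-b) \<le> LL \<sigma> powr (-b)"
      using False assms LL_pos[of r] by (intro powr_mono2 LL_antimono) auto
    then show "prof a b r \<le> 1 * prof a b \<sigma>" using False assms * by (simp add: prof_def)
  qed simp
qed

text \<open>The annulus between \<open>\<sigma> / 2\<close> and \<open>\<sigma>\<close> is enough:
  there the profile is comparable to its value at \<open>\<sigma>\<close>, whatever the signs of the
  exponents.\<close>

lemma half_ball_mass_ge:
  fixes k :: "'n::finite" and a b :: real
  obtains c where "0 < c" "\<And>\<sigma>. 0 < \<sigma> \<Longrightarrow>
    ennreal (c * (\<sigma> powr real CARD('n) * prof a b \<sigma>)) \<le>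
    (\<integral>\<^sup>+x\<in>closed_half_space k. ennreal (prof a b (norm x)) * indicator (ball 0 \<sigma>) x \<partial>lborel)"
proof -
  define N where "N = real CARD('n)"
  define V where "V = N * unit_ball_vol N"
  have V: "0 < V" unfolding V_def N_def by simp
  obtain C where C: "1 \<le> C" "\<And>r s m. 0 < r \<Longrightarrow> 0 < s \<Longrightarrow> 1 \<le> m \<Longrightarrow> s / r \<le> m \<Longrightarrow> r / s \<le> m \<Longrightarrow>
      LL r powr (-b) \<le> C * m powr 1 * LL s powr (-b)" using LL_slow[of 1 "-b"] by auto
  \<comment> \<open>The minimum covers both signs of \<open>N - 1 - a\<close>; the factor
    \<open>2 * C\<close> is the price of \<open>LL_slow\<close> with \<open>m = 2\<close> and
    exponent \<open>1\<close>.\<close>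
  define c0 where "c0 = min (2 powr (-(N - 1 - a))) 1 / (2 * C)"
  have c0: "0 < c0" using C by (simp add: c0_def)
  show ?thesis
  proof (rule that[of "V * c0 / 4"])
    show "0 < V * c0 / 4" using V c0 by simp
    fix \<sigma> :: real assume s: "0 < \<sigma>"
    let ?I = "\<integral>\<^sup>+x\<in>closed_half_space k. ennreal (prof a b (norm x)) * indicator (ball 0 \<sigma>) x \<partial>lborel"
    have "ennreal V * ennreal (c0 * \<sigma> powr (N - 1) * prof a b \<sigma> * (\<sigma> / 2)) =
       ennreal V * (\<integral>\<^sup>+r. ennreal (c0 * \<sigma> powr (N - 1) * prof a b \<sigma>) * indicator {\<sigma>/2<..<\<sigma>} r \<partial>lborel)"
      using s c0 prof_nonneg[of a b \<sigma>] by (simp add: nn_integral_cmult_indicator ennreal_mult[symmetric])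
    also have "\<dots> \<le> ennreal V * (\<integral>\<^sup>+r\<in>{0<..<\<sigma>}. ennreal (r powr (N - 1) * prof a b r) \<partial>lborel)"
    proof (intro mult_left_mono nn_integral_mono)
      fix r :: real
      have "c0 * \<sigma> powr (N - 1) * prof a b \<sigma> \<le> r powr (N - 1) * prof a b r" if r: "\<sigma>/2 < r" "r < \<sigma>"
      proof -
        have r0: "0 < r" using r s by simp
        have L: "LL \<sigma> powr (-b) / (2 * C) \<le> LL r powr (-b)"
          using C(2)[of \<sigma> r 2] C(1) r s r0 by (simp add: field_simps)
        have "min (2 powr (-(N - 1 - a))) 1 * \<sigma> powr (N - 1 - a) \<le> r powr (N - 1 - a)"
        proof (cases "N - 1 - a \<ge> 0")
          case True
          have "min (2 powr (-(N - 1 - a))) 1 * \<sigma> powr (N - 1 - a) \<le> 2 powr (-(N - 1 - a)) * \<sigma> powr (N - 1 - a)"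
            by (intro mult_right_mono) auto
          also have "\<dots> = (\<sigma> / 2) powr (N - 1 - a)" unfolding powr_minus_divide using s by (simp add: powr_divide)
          also have "\<dots> \<le> r powr (N - 1 - a)" using True r s by (intro powr_mono2) auto
          finally show ?thesis .
        next
          case False
          have "min (2 powr (-(N - 1 - a))) 1 * \<sigma> powr (N - 1 - a) \<le> 1 * \<sigma> powr (N - 1 - a)"
            by (intro mult_right_mono) auto
          also have "\<dots> \<le> r powr (N - 1 - a)" using False r r0 s powr_mono2'[of "N - 1 - a" r \<sigma>] by auto
          finally show ?thesis .
        qed
        from mult_mono[OF this L] have "min (2 powr (-(N - 1 - a))) 1 * \<sigma> powr (N - 1 - a) * (LL \<sigma> powr (-b) / (2 * C)) \<le> r powr (N - 1 - a) * LL r powr (-b)"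
          using C by simp
        moreover have "\<sigma> powr (N - 1 - a) = \<sigma> powr (N - 1) * \<sigma> powr (-a)" "r powr (N - 1 - a) = r powr (N - 1) * r powr (-a)"
          by (simp_all flip: powr_add)
        ultimately show ?thesis
          unfolding prof_def c0_def by (simp add: mult_ac)
      qed
      then show "ennreal (c0 * \<sigma> powr (N - 1) * prof a b \<sigma>) * indicator {\<sigma>/2<..<\<sigma>} r
         \<le> ennreal (r powr (N - 1) * prof a b r) * indicator {0<..<\<sigma>} r"
        using s by (auto simp: indicator_def intro!: ennreal_leI)
    qed simp
    also have "\<dots> = (\<integral>\<^sup>+(x::real^'n)\<in>ball 0 \<sigma>. ennreal (prof a b (norm x)) \<partial>lborel)"
      unfolding V_def N_def by (subst nn_integral_radial_ball) auto
    also have "\<dots> \<le> 2 * ?I"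
      using half_space_radial_ge[of "\<lambda>r. ennreal (prof a b r) * indicator {..<\<sigma>} r" k]
      by (simp add: indicator_def mult_ac)
    finally have "ennreal V * ennreal (c0 * \<sigma> powr (N - 1) * prof a b \<sigma> * (\<sigma> / 2)) \<le> 2 * ?I" .
    moreover have "ennreal V * ennreal (c0 * \<sigma> powr (N - 1) * prof a b \<sigma> * (\<sigma> / 2)) = 2 * ennreal (V * c0 / 4 * (\<sigma> powr N * prof a b \<sigma>))"
      using s V by (simp add: ennreal_mult'[symmetric] powr_diff mult.assoc flip: ennreal_numeral)
    ultimately show "ennreal (V * c0 / 4 * (\<sigma> powr real CARD('n) * prof a b \<sigma>)) \<le> ?I"
      unfolding N_def by (simp add: ennreal_mult_le_mult_iff)
  qed
qed

text \<open>A dyadic annulus would lose the logarithm gained by integrating \<open>1 / r\<close>.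
  The annulus from \<open>\<sigma>\<^sup>2\<close> to \<open>\<sigma>\<close> retains it:
  \<open>LL\<close> at most doubles there, while the integral of \<open>1 / r\<close> is
  \<open>ln (1 / \<sigma>)\<close>.\<close>

lemma half_ball_mass_ge_critical:
  fixes k :: "'n::finite" and b :: real
  assumes "0 \<le> b"
  obtains c where "0 < c" "\<And>\<sigma>. 0 < \<sigma> \<Longrightarrow> \<sigma> \<le> 1/16 \<Longrightarrow>
    ennreal (c * LL \<sigma> powr (1 - b)) \<le>
    (\<integral>\<^sup>+x\<in>closed_half_space k. ennreal (prof (real CARD('n)) b (norm x)) * indicator (ball 0 \<sigma>) x \<partial>lborel)"
proof -
  define N where "N = real CARD('n)"
  define V where "V = N * unit_ball_vol N"
  have V: "0 < V" unfolding V_def N_def by simp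
  define c0 where "c0 = (2 powr (-b)) / 2"
  show ?thesis
  proof (rule that[of "V * c0 / 2"])
    show "0 < V * c0 / 2" using V by (simp add: c0_def)
    fix \<sigma> :: real assume s: "0 < \<sigma>" "\<sigma> \<le> 1/16"
    let ?I = "\<integral>\<^sup>+x\<in>closed_half_space k. ennreal (prof (real CARD('n)) b (norm x)) * indicator (ball 0 \<sigma>) x \<partial>lborel"
    have s2: "\<sigma>\<^sup>2 \<le> \<sigma>" using s by (simp add: power2_eq_square)
    have LL1: "LL \<sigma> \<le> 2 * ln (1 / \<sigma>)" using s by (rule LL_le_ln)
    have LL2: "LL (\<sigma>\<^sup>2) \<le> 2 * LL \<sigma>" using s(1) by (rule LL_power2_le)
    have "ennreal V * ennreal (c0 * LL \<sigma> powr (1 - b)) \<le>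
       ennreal V * ennreal ((2 * LL \<sigma>) powr (-b) * ln (1 / \<sigma>))"
    proof (intro mult_left_mono ennreal_leI)
      have "c0 * LL \<sigma> powr (1 - b) = 2 powr (-b) * LL \<sigma> powr (-b) * (LL \<sigma> / 2)"
        using LL_pos[of \<sigma>] s by (simp add: c0_def powr_diff powr_minus field_simps)
      also have "\<dots> \<le> 2 powr (-b) * LL \<sigma> powr (-b) * ln (1 / \<sigma>)"
        using LL1 by (intro mult_left_mono) auto
      finally show "c0 * LL \<sigma> powr (1 - b) \<le> (2 * LL \<sigma>) powr (-b) * ln (1 / \<sigma>)"
        using LL_pos[of \<sigma>] s by (simp add: powr_mult)
    qed simp
    also have "\<dots> = ennreal V * (\<integral>\<^sup>+r\<in>{\<sigma>\<^sup>2<..<\<sigma>}. ennreal ((2 * LL \<sigma>) powr (-b) * (1 / r)) \<partial>lborel)"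
    proof -
      have "(\<integral>\<^sup>+r\<in>{\<sigma>\<^sup>2<..<\<sigma>}. ennreal ((2 * LL \<sigma>) powr (-b) * (1 / r)) \<partial>lborel) =
         ennreal ((2 * LL \<sigma>) powr (-b) * ln \<sigma> - (2 * LL \<sigma>) powr (-b) * ln (\<sigma>\<^sup>2))"
      proof (intro nn_integral_FTC_interior s2)
        show "continuous_on {\<sigma>\<^sup>2..\<sigma>} (\<lambda>x. (2 * LL \<sigma>) powr - b * ln x)"
          using s by (auto intro!: continuous_intros)
        fix x assume x: "\<sigma>\<^sup>2 < x"
        then have "0 < x" by (meson le_less_trans zero_le_power2)
        then show "((\<lambda>x. (2 * LL \<sigma>) powr - b * ln x) has_real_derivative (2 * LL \<sigma>) powr - b * (1 / x)) (at x)"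
          "0 \<le> (2 * LL \<sigma>) powr - b * (1 / x)"
          by (auto intro!: derivative_eq_intros)
      qed
      also have "(2 * LL \<sigma>) powr (-b) * ln \<sigma> - (2 * LL \<sigma>) powr (-b) * ln (\<sigma>\<^sup>2) = (2 * LL \<sigma>) powr (-b) * ln (1 / \<sigma>)"
        using s by (simp add: ln_realpow ln_div algebra_simps)
      finally show ?thesis by simp
    qed
    also have "\<dots> \<le> ennreal V * (\<integral>\<^sup>+r\<in>{0<..<\<sigma>}. ennreal (r powr (N - 1) * prof N b r) \<partial>lborel)"
    proof (intro mult_left_mono nn_integral_mono)
      fix r :: real
      have "(2 * LL \<sigma>) powr (-b) * (1 / r) \<le> r powr (N - 1) * prof N b r" if r: "\<sigma>\<^sup>2 < r" "r < \<sigma>"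
      proof -
        have r0: "0 < r" using r by (meson le_less_trans zero_le_power2)
        have "LL r \<le> LL (\<sigma>\<^sup>2)" using r s by (intro LL_antimono) auto
        then have "LL r \<le> 2 * LL \<sigma>" using LL2 by simp
        then have "(2 * LL \<sigma>) powr (-b) \<le> LL r powr (-b)"
          using assms LL_pos[OF r0] powr_mono2'[of "-b" "LL r" "2 * LL \<sigma>"] by simp
        then have "(2 * LL \<sigma>) powr (-b) * (1 / r) \<le> LL r powr (-b) * (1 / r)"
          using r0 by (intro mult_right_mono) auto
        then show ?thesis unfolding prof_def using r0 by (simp add: powr_diff powr_minus field_simps)
      qed
      moreover have "0 < r" if "\<sigma>\<^sup>2 < r" using that by (meson le_less_trans zero_le_power2)
      ultimately show "ennreal ((2 * LL \<sigma>) powr (-b) * (1 / r)) * indicator {\<sigma>\<^sup>2<..<\<sigma>} r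
         \<le> ennreal (r powr (N - 1) * prof N b r) * indicator {0<..<\<sigma>} r"
        by (auto simp: indicator_def intro!: ennreal_leI)
    qed simp
    also have "\<dots> = (\<integral>\<^sup>+(x::real^'n)\<in>ball 0 \<sigma>. ennreal (prof N b (norm x)) \<partial>lborel)"
      unfolding V_def N_def by (subst nn_integral_radial_ball) auto
    also have "\<dots> \<le> 2 * ?I"
      using half_space_radial_ge[of "\<lambda>r. ennreal (prof N b r) * indicator {..<\<sigma>} r" k]
      by (simp add: indicator_def mult_ac N_def)
    finally have "ennreal V * ennreal (c0 * LL \<sigma> powr (1 - b)) \<le> 2 * ?I" .
    moreover have "ennreal V * ennreal (c0 * LL \<sigma> powr (1 - b)) = 2 * ennreal (V * c0 / 2 * LL \<sigma> powr (1 - b))"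
      using s V by (simp add: ennreal_mult'[symmetric] mult.assoc flip: ennreal_numeral)
    ultimately show "ennreal (V * c0 / 2 * LL \<sigma> powr (1 - b)) \<le> ?I"
      by (simp add: ennreal_mult_le_mult_iff)
  qed
qed

lemma closed_half_space_pred [measurable]:
  assumes [measurable]: "f \<in> borel_measurable M"
  shows "Measurable.pred M (\<lambda>x. f x \<in> closed_half_space k)"
  unfolding closed_half_space_eq mem_Collect_eq by measurable

lemma ball_pred [measurable]:
  assumes [measurable]: "f \<in> borel_measurable M"
  shows "Measurable.pred M (\<lambda>x. (f x :: 'a::euclidean_space) \<in> ball 0 s)"
  unfolding mem_ball dist_0_norm by measurable

subsection \<open>Heat flow of the singular datum\<close>

definition heat :: "'n::finite \<Rightarrow> (real^'n \<Rightarrow> real) \<Rightarrow> real^'n \<Rightarrow> real \<Rightarrow> ennreal" where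
  "heat k f x t = (\<integral>\<^sup>+z\<in>closed_half_space k. ennreal (green k x z t * f z) \<partial>lborel)"

lemma heat_lebesgue: "(\<integral>\<^sup>+z\<in>closed_half_space k. ennreal (green k x z t * f z) \<partial>lebesgue) = heat k f x t"
  unfolding heat_def by (rule nn_integral_completion)

definition gauss :: "real \<Rightarrow> real^'n::finite \<Rightarrow> real" where
  "gauss t w = (4 * pi * t) powr (- (real CARD('n) / 2)) * exp (- (norm w)\<^sup>2 / (4 * t))"

lemma gauss_nonneg: "0 \<le> gauss t w"
  unfolding gauss_def by simp

lemma gauss_measurable [measurable]: "gauss t \<in> borel_measurable borel"
  unfolding gauss_def by measurable

lemma gauss_le: "0 < t \<Longrightarrow> gauss t (w :: real^'n::finite) \<le> (4 * pi * t) powr (- (real CARD('n) / 2))"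
  unfolding gauss_def by (intro mult_left_le) auto

lemma gauss_eq_prod: "0 < t \<Longrightarrow> gauss t (w :: real^'n::finite) = (\<Prod>b\<in>Basis. hk t (w \<bullet> b))"
proof -
  assume t: "0 < t"
  have "(norm w)\<^sup>2 = w \<bullet> w" by (rule power2_norm_eq_inner)
  also have "\<dots> = (\<Sum>b\<in>Basis. (w \<bullet> b) * (w \<bullet> b))" by (rule euclidean_inner)
  finally have "(\<Sum>b\<in>Basis. (w \<bullet> b)\<^sup>2) = (norm w)\<^sup>2" by (simp add: power2_eq_square)
  then show ?thesis
    using prod_hk[OF t, of "Basis :: (real^'n) set" "\<lambda>b. w \<bullet> b"] unfolding gauss_def by simp
qed

lemma gauss_integral:
  fixes x :: "real^'n::finite"
  assumes t: "0 < t"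
  shows "(\<integral>\<^sup>+y. ennreal (gauss t (x - y)) \<partial>lborel) = 1"
proof -
  have "(\<integral>\<^sup>+y. ennreal (gauss t (x - y)) \<partial>lborel) = (\<integral>\<^sup>+y. (\<Prod>b\<in>Basis. ennreal (hk t (x \<bullet> b - y \<bullet> b))) \<partial>lborel)"
    using t by (simp add: gauss_eq_prod prod_ennreal hk_nonneg inner_diff_left)
  also have "\<dots> = (\<Prod>b\<in>(Basis :: (real^'n) set). (\<integral>\<^sup>+y. ennreal (hk t (x \<bullet> b - y)) \<partial>lborel))"
    by (rule nn_integral_lborel_prod) auto
  finally show ?thesis using t by (simp add: hk_integral)
qed

text \<open>Within the half space the image of \<open>y\<close> is at least as far from
  \<open>x\<close> as \<open>y\<close> itself, so each of the two Gaussians is at most the direct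
  one.\<close>

lemma green_le_gauss:
  assumes "x \<in> closed_half_space k" "y \<in> closed_half_space k" "0 < t"
  shows "green k x y t \<le> 2 * gauss t (x - y)"
proof -
  have "norm (x - y) \<le> norm (x - reflection k y)"
  proof (rule norm_le_componentwise_cart)
    fix i show "norm ((x - y) $ i) \<le> norm ((x - reflection k y) $ i)"
      using assms by (auto simp: reflection_def closed_half_space_eq)
  qed
  then have "(norm (x - y))\<^sup>2 \<le> (norm (x - reflection k y))\<^sup>2" by (intro power_mono) auto
  then have "exp (- (norm (x - reflection k y))\<^sup>2 / (4 * t)) \<le> exp (- (norm (x - y))\<^sup>2 / (4 * t))"
    using assms by (simp add: divide_right_mono)
  then have "(4 * pi * t) powr (- (real CARD('a) / 2)) * (exp (- (norm (x - y))\<^sup>2 / (4 * t)) + exp (- (norm (x - reflection k y))\<^sup>2 / (4 * t)))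
    \<le> (4 * pi * t) powr (- (real CARD('a) / 2)) * (2 * exp (- (norm (x - y))\<^sup>2 / (4 * t)))"
    by (intro mult_left_mono) auto
  then show ?thesis unfolding green_def gauss_def by (simp add: mult_ac)
qed

lemma reflection_continuous [continuous_intros]:
  assumes [continuous_intros]: "continuous_on S g"
  shows "continuous_on S (\<lambda>x. reflection k (g x))"
  unfolding reflection_def
proof (intro continuous_on_vec_lambda)
  fix i show "continuous_on S (\<lambda>x. if i = k then - g x $ i else g x $ i)"
    by (cases "i = k") (auto intro!: continuous_intros)
qed

lemma reflection_measurable [measurable]: "reflection k \<in> borel_measurable borel"
  by (intro borel_measurable_continuous_onI continuous_intros)

lemma green_measurable [measurable]:
  assumes [measurable]: "f \<in> borel_measurable M" "g \<in> borel_measurable M" "h \<in> borel_measurable M"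
  shows "(\<lambda>x. green k (f x) (g x) (h x)) \<in> borel_measurable M"
  unfolding green_def by measurable

text \<open>Inside radius \<open>\<sigma>\<close> the kernel is bounded by its maximum and the datum
  by its mass \<open>m1\<close>; outside, the datum is bounded by \<open>m2\<close> and the kernel
  by its total mass.\<close>

lemma heat_le:
  fixes k :: "'n::finite"
  assumes [measurable]: "f \<in> borel_measurable borel" and nn: "\<And>y. 0 \<le> f y"
    and t: "0 < t" and x: "x \<in> closed_half_space k"
    and 1: "(\<integral>\<^sup>+y\<in>closed_half_space k. ennreal (f y) * indicator (ball 0 \<sigma>) y \<partial>lborel) \<le> ennreal m1" "0 \<le> m1"
    and 2: "\<And>y. y \<in> closed_half_space k \<Longrightarrow> \<sigma> \<le> norm y \<Longrightarrow> f y \<le> m2" "0 \<le> m2"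
  shows "heat k f x t \<le> ennreal (2 * (4 * pi * t) powr (- (real CARD('n) / 2)) * m1 + 2 * m2)"
proof -
  define q where "q = (4 * pi * t) powr (- (real CARD('n) / 2))"
  have "heat k f x t \<le> (\<integral>\<^sup>+y. ennreal (2 * q) * (ennreal (f y) * indicator (ball 0 \<sigma>) y * indicator (closed_half_space k) y) + ennreal (2 * m2) * ennreal (gauss t (x - y)) \<partial>lborel)"
    unfolding heat_def
  proof (rule nn_integral_mono)
    fix y :: "real^'n"
    show "ennreal (green k x y t * f y) * indicator (closed_half_space k) y \<le>
       ennreal (2 * q) * (ennreal (f y) * indicator (ball 0 \<sigma>) y * indicator (closed_half_space k) y) + ennreal (2 * m2) * ennreal (gauss t (x - y))"
    proof (cases "y \<in> closed_half_space k")
      case True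
      have g: "green k x y t \<le> 2 * gauss t (x - y)" by (rule green_le_gauss[OF x True t])
      show ?thesis
      proof (cases "norm y < \<sigma>")
        case N: True
        have "green k x y t * f y \<le> 2 * q * f y"
          using g gauss_le[OF t, of "x - y"] nn by (intro mult_right_mono) (auto simp: q_def)
        then have "ennreal (green k x y t * f y) \<le> ennreal (2 * q) * ennreal (f y)"
          by (simp add: q_def ennreal_mult[symmetric] nn ennreal_leI)
        then show ?thesis using True N by (simp add: add_increasing2)
      next
        case False
        have "green k x y t * f y \<le> (2 * gauss t (x - y)) * m2"
          using g 2(1)[OF True] False nn gauss_nonneg by (intro mult_mono) auto
        then have "ennreal (green k x y t * f y) \<le> ennreal (2 * m2) * ennreal (gauss t (x - y))"
          using 2 gauss_nonneg[of t "x - y"] by (simp add: ennreal_mult[symmetric] ennreal_leI mult_ac)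
        then show ?thesis using True False by simp
      qed
    qed simp
  qed
  also have "\<dots> = ennreal (2 * q) * (\<integral>\<^sup>+y\<in>closed_half_space k. ennreal (f y) * indicator (ball 0 \<sigma>) y \<partial>lborel) + ennreal (2 * m2)"
    using t by (subst nn_integral_add, measurable) (simp add: nn_integral_cmult gauss_integral)
  also have "\<dots> \<le> ennreal (2 * q) * ennreal m1 + ennreal (2 * m2)"
    using 1 by (intro add_right_mono mult_left_mono) auto
  also have "\<dots> = ennreal (2 * q * m1 + 2 * m2)"
    using 1 2 by (simp add: q_def ennreal_mult[symmetric] ennreal_plus[symmetric] del: ennreal_plus)
  finally show ?thesis by (simp add: q_def)
qed

section \<open>Heat flow bounds for the datum\<close>

lemma psi_prof: "psi k a b x = prof a b (norm x) * indicator (ball 0 1 \<inter> closed_half_space k) x"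
  unfolding psi_def prof_def LL_def half_ball_def by (auto simp: indicator_def)

lemma psi_nonneg: "0 \<le> psi k a b x"
  unfolding psi_prof by (simp add: prof_nonneg)

lemma psi_measurable [measurable]: "psi k a b \<in> borel_measurable borel"
  unfolding psi_prof by measurable

text \<open>The family of data is closed under powers, so bounds for the heat flow of
  \<open>psi\<close> apply to its \<open>r\<close>-th power as well.\<close>

lemma psi_powr: "0 < r \<Longrightarrow> psi k a b x powr r = psi k (a * r) (b * r) x"
  unfolding psi_prof prof_def by (simp add: indicator_def powr_mult powr_powr)

text \<open>The diffusive scaling \<open>\<sigma> = sqrt t\<close> halves the exponent of the power
  and changes the logarithm by a factor of at most \<open>2\<close>.\<close>

lemma prof_sqrt_le:
  obtains C where "0 < C" "\<And>t. 0 < t \<Longrightarrow> t \<le> 1 \<Longrightarrow> prof a b (sqrt t) \<le> C * prof (a / 2) b t"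
    "\<And>t. 0 < t \<Longrightarrow> t \<le> 1 \<Longrightarrow> prof (a / 2) b t \<le> C * prof a b (sqrt t)"
proof -
  have *: "LL (sqrt t) powr (-b) \<le> 2 powr \<bar>b\<bar> * LL t powr (-b) \<and> LL t powr (-b) \<le> 2 powr \<bar>b\<bar> * LL (sqrt t) powr (-b)" if t: "0 < t" "t \<le> 1" for t
  proof -
    have st: "0 < sqrt t" "t \<le> sqrt t" "sqrt t * sqrt t = t" using t real_le_rsqrt[of t t] by (auto simp: power2_eq_square mult_le_one mult_left_le)
    have 1: "LL (sqrt t) \<le> LL t" using st t by (intro LL_antimono) auto
    have 2: "LL t \<le> 2 * LL (sqrt t)" using LL_power2_le[OF st(1)] t by simp
    have p: "0 < LL t" "0 < LL (sqrt t)" using LL_pos t st by auto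
    have one: "1 \<le> 2 powr \<bar>b\<bar>" by (intro ge_one_powr_ge_zero) auto
    have o: "1 * LL (sqrt t) powr (-b) \<le> 2 powr \<bar>b\<bar> * LL (sqrt t) powr (-b)"
      "1 * LL t powr (-b) \<le> 2 powr \<bar>b\<bar> * LL t powr (-b)" by (intro mult_right_mono one; simp)+
    show ?thesis
    proof (cases "b \<ge> 0")
      case True
      have a: "LL t powr (-b) \<le> LL (sqrt t) powr (-b)" using 1 p True by (intro powr_mono2') auto
      have "(2 * LL (sqrt t)) powr (-b) \<le> LL t powr (-b)" using 2 p True by (intro powr_mono2') auto
      then have "LL (sqrt t) powr (-b) \<le> 2 powr \<bar>b\<bar> * LL t powr (-b)"
        using p True by (simp add: powr_mult powr_minus[of 2] field_simps)
      moreover have "LL t powr (-b) \<le> 2 powr \<bar>b\<bar> * LL (sqrt t) powr (-b)"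
        using a o(1) by linarith
      ultimately show ?thesis by blast
    next
      case False
      have a: "LL (sqrt t) powr (-b) \<le> LL t powr (-b)" using 1 p False by (intro powr_mono2) auto
      have "LL t powr (-b) \<le> (2 * LL (sqrt t)) powr (-b)" using 2 p False by (intro powr_mono2) auto
      then have "LL t powr (-b) \<le> 2 powr \<bar>b\<bar> * LL (sqrt t) powr (-b)"
        using p False by (simp add: powr_mult)
      moreover have "LL (sqrt t) powr (-b) \<le> 2 powr \<bar>b\<bar> * LL t powr (-b)"
        using a o(2) by linarith
      ultimately show ?thesis by blast
    qed
  qed
  have s: "sqrt t powr (-a) = t powr (- (a / 2))" if "0 < t" for t
    using that by (simp add: powr_half_sqrt[symmetric] powr_powr)
  show ?thesis
  proof (rule that[of "2 powr \<bar>b\<bar>"])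
    fix t :: real assume t: "0 < t" "t \<le> 1"
    show "prof a b (sqrt t) \<le> 2 powr \<bar>b\<bar> * prof (a / 2) b t"
      using mult_left_mono[OF conjunct1[OF *[OF t]], of "t powr (- (a / 2))"] unfolding prof_def s[OF t(1)] by (simp add: mult_ac)
    show "prof (a / 2) b t \<le> 2 powr \<bar>b\<bar> * prof a b (sqrt t)"
      using mult_left_mono[OF conjunct2[OF *[OF t]], of "t powr (- (a / 2))"] unfolding prof_def s[OF t(1)] by (simp add: mult_ac)
  qed simp
qed

lemma psi_ball_le:
  fixes k :: "'n::finite"
  shows "(\<integral>\<^sup>+y\<in>closed_half_space k. ennreal (psi k a b y) * indicator (ball 0 \<sigma>) y \<partial>lborel)
    \<le> (\<integral>\<^sup>+(y::real^'n)\<in>ball 0 \<sigma>. ennreal (prof a b (norm y)) \<partial>lborel)"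
  by (intro nn_integral_mono) (auto simp: indicator_def psi_prof)

text \<open>The splitting radius is \<open>sqrt t\<close>, so the kernel maximum of order
  \<open>t\<close> to the power \<open>- CARD('n) / 2\<close> cancels the volume of the ball.
  Allowing \<open>\<beta> \<le> b\<close> accommodates the logarithm lost in the mass when
  \<open>a = CARD('n)\<close>.\<close>

lemma heat_psi_le_aux:
  fixes k :: "'n::finite"
  assumes ab: "0 < a \<or> a = 0 \<and> b \<le> 0" and bb: "\<beta> \<le> b"
    and C1: "0 < C1" "\<And>\<sigma>. 0 < \<sigma> \<Longrightarrow> \<sigma> \<le> 1 \<Longrightarrow> (\<integral>\<^sup>+(x::real^'n)\<in>ball 0 \<sigma>. ennreal (prof a b (norm x)) \<partial>lborel) \<le> ennreal (C1 * (\<sigma> powr real CARD('n) * prof a \<beta> \<sigma>))"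
  obtains C where "0 < C" "\<And>x t. x \<in> closed_half_space k \<Longrightarrow> 0 < t \<Longrightarrow> t \<le> 1 \<Longrightarrow> heat k (psi k a b) x t \<le> ennreal (C * prof (a / 2) \<beta> t)"
proof -
  obtain C2 where C2: "1 \<le> C2" "\<And>r \<sigma>. 0 < \<sigma> \<Longrightarrow> \<sigma> \<le> r \<Longrightarrow> prof a b r \<le> C2 * prof a b \<sigma>"
    using prof_outside_le[OF ab] by metis
  obtain C3 where C3: "0 < C3" "\<And>t. 0 < t \<Longrightarrow> t \<le> 1 \<Longrightarrow> prof a \<beta> (sqrt t) \<le> C3 * prof (a / 2) \<beta> t"
    using prof_sqrt_le[of a \<beta>] by metis
  define q where "q = (4 * pi) powr (- (real CARD('n) / 2))"
  show ?thesis
  proof (rule that[of "(2 * q * C1 + 2 * C2) * C3"])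
    show "0 < (2 * q * C1 + 2 * C2) * C3" using C1 C2 C3 by (intro mult_pos_pos add_pos_pos) (auto simp: q_def)
    fix x t assume x: "x \<in> closed_half_space k" and t: "0 < t" "t \<le> (1::real)"
    have s: "0 < sqrt t" "sqrt t \<le> 1" using t by auto
    have "prof a b (sqrt t) \<le> prof a \<beta> (sqrt t)"
      unfolding prof_def using LL_ge_1[OF s(1)] bb by (intro mult_left_mono powr_mono) auto
    then have bb2: "C2 * prof a b (sqrt t) \<le> C2 * prof a \<beta> (sqrt t)" using C2(1) by (intro mult_left_mono) auto
    have psi_p: "psi k a b y \<le> prof a b (norm y)" for y
      unfolding psi_prof by (auto simp: indicator_def prof_nonneg)
    have "heat k (psi k a b) x t \<le> ennreal (2 * (4 * pi * t) powr (- (real CARD('n) / 2)) * (C1 * (sqrt t powr real CARD('n) * prof a \<beta> (sqrt t))) + 2 * (C2 * prof a \<beta> (sqrt t)))"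
    proof (rule heat_le[where \<sigma>="sqrt t"])
      show "(\<integral>\<^sup>+ y\<in>closed_half_space k. ennreal (psi k a b y) * indicator (ball 0 (sqrt t)) y \<partial>lborel)
          \<le> ennreal (C1 * (sqrt t powr real CARD('n) * prof a \<beta> (sqrt t)))"
        using psi_ball_le C1(2)[OF s] order_trans by blast
      show "psi k a b y \<le> C2 * prof a \<beta> (sqrt t)" if "sqrt t \<le> norm y" for y
        using psi_p[of y] C2(2)[OF s(1) that] bb2 by linarith
    qed (use x t C1 C2 prof_nonneg psi_nonneg in auto)
    also have "(4 * pi * t) powr (- (real CARD('n) / 2)) = q * t powr (- (real CARD('n) / 2))"
      unfolding q_def using t by (simp add: powr_mult)
    also have "2 * (q * t powr (- (real CARD('n) / 2))) * (C1 * (sqrt t powr real CARD('n) * prof a \<beta> (sqrt t))) = 2 * q * C1 * prof a \<beta> (sqrt t)"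
    proof -
      have "t powr (- (real CARD('n) / 2)) * sqrt t powr real CARD('n) = 1"
        using t by (simp add: powr_half_sqrt[symmetric] powr_powr flip: powr_add)
      then show ?thesis by (simp add: mult_ac)
    qed
    also have "2 * q * C1 * prof a \<beta> (sqrt t) + 2 * (C2 * prof a \<beta> (sqrt t)) = (2 * q * C1 + 2 * C2) * prof a \<beta> (sqrt t)"
      by (simp add: algebra_simps)
    also have "ennreal \<dots> \<le> ennreal ((2 * q * C1 + 2 * C2) * (C3 * prof (a / 2) \<beta> t))"
      using C1 C2 C3(2)[OF t] by (intro ennreal_leI mult_left_mono) (auto simp: q_def)
    finally show "heat k (psi k a b) x t \<le> ennreal ((2 * q * C1 + 2 * C2) * C3 * prof (a / 2) \<beta> t)"
      by (simp add: mult_ac)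
  qed
qed

lemma heat_psi_le:
  fixes k :: "'n::finite"
  assumes "0 < a \<or> a = 0 \<and> b \<le> 0" "a < real CARD('n)"
  obtains C where "0 < C" "\<And>x t. x \<in> closed_half_space k \<Longrightarrow> 0 < t \<Longrightarrow> t \<le> 1 \<Longrightarrow> heat k (psi k a b) x t \<le> ennreal (C * prof (a / 2) b t)"
proof -
  obtain C1 where "0 < C1" "\<And>\<sigma>. 0 < \<sigma> \<Longrightarrow>
    (\<integral>\<^sup>+(x::real^'n)\<in>ball 0 \<sigma>. ennreal (prof a b (norm x)) \<partial>lborel) \<le> ennreal (C1 * (\<sigma> powr real DIM(real^'n) * prof a b \<sigma>))"
    using prof_ball_le[where 'a="real^'n", of a b] assms(2) by auto
  then show ?thesis using heat_psi_le_aux[OF assms(1) order_refl, of C1 k] that by auto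
qed

lemma heat_psi_le_critical:
  fixes k :: "'n::finite"
  assumes "1 < b"
  obtains C where "0 < C" "\<And>x t. x \<in> closed_half_space k \<Longrightarrow> 0 < t \<Longrightarrow> t \<le> 1 \<Longrightarrow>
    heat k (psi k (real CARD('n)) b) x t \<le> ennreal (C * prof (real CARD('n) / 2) (b - 1) t)"
proof -
  obtain C1 where C1: "0 < C1" "\<And>\<sigma>. 0 < \<sigma> \<Longrightarrow> \<sigma> \<le> 1 \<Longrightarrow>
    (\<integral>\<^sup>+(x::real^'n)\<in>ball 0 \<sigma>. ennreal (prof (real DIM(real^'n)) b (norm x)) \<partial>lborel) \<le> ennreal (C1 * LL \<sigma> powr (1 - b))"
    using prof_ball_le_critical[where 'a="real^'n", OF assms] by auto
  show ?thesis
  proof (rule heat_psi_le_aux[of "real CARD('n)" b "b - 1" C1 k])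
    show "(\<integral>\<^sup>+(x::real^'n)\<in>ball 0 \<sigma>. ennreal (prof (real CARD('n)) b (norm x)) \<partial>lborel) \<le> ennreal (C1 * (\<sigma> powr real CARD('n) * prof (real CARD('n)) (b - 1) \<sigma>))"
      if "0 < \<sigma>" "\<sigma> \<le> 1" for \<sigma>
      using C1(2)[OF that] that unfolding powr_mult_prof by simp
  qed (use C1 that in auto)
qed

subsection \<open>Jensen inequality and blow-up of Volterra inequalities\<close>

lemma bernoulli_powr:
  fixes x p :: real
  assumes "1 \<le> p" "0 \<le> x"
  shows "p * x \<le> x powr p + (p - 1)"
proof (cases "x = 0")
  case False
  have "x powr p - 1 powr p \<ge> p * (x - 1)"
  proof (rule convex_on_imp_above_tangent)
    show "convex_on {0<..} (\<lambda>x. x powr p)" by (rule powr_convex) fact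
    show "((\<lambda>x. x powr p) has_real_derivative p) (at 1 within {0<..})"
      by (auto intro!: derivative_eq_intros)
  qed (use assms False in \<open>auto simp: interior_open\<close>)
  then show ?thesis by (simp add: algebra_simps)
qed (use assms in simp)

text \<open>The tangent of the convex function \<open>g powr p\<close> at \<open>m\<close>. Being
  linear in \<open>g\<close>, it can be integrated against a weight; both \<open>jensen_powr\<close>
  and \<open>holder_weighted\<close> arise in this way.\<close>

lemma young_tangent:
  fixes g m p :: real
  assumes "1 < p" "0 < m" "0 \<le> g"
  shows "p * m powr (p - 1) * g \<le> g powr p + (p - 1) * m powr p"
proof -
  have "m powr p * (p * (g / m)) \<le> m powr p * ((g / m) powr p + (p - 1))"
    using assms by (intro mult_left_mono bernoulli_powr) auto
  moreover have "m powr p * (p * (g / m)) = p * m powr (p - 1) * g"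
    using assms by (simp add: powr_diff)
  moreover have "m powr p * ((g / m) powr p + (p - 1)) = g powr p + (p - 1) * m powr p"
    using assms by (simp add: distrib_left powr_divide)
  ultimately show ?thesis by simp
qed

text \<open>The tangent at \<open>m\<close> is integrated and the finite term
  \<open>(p - 1) * m powr p\<close> cancelled. Stating the claim for every lower bound
  \<open>m\<close>, rather than for the mean itself, covers means that are infinite.\<close>

lemma jensen_powr:
  fixes w g :: "'a \<Rightarrow> real"
  assumes [measurable]: "w \<in> borel_measurable M" "g \<in> borel_measurable M"
    and nn: "\<And>x. 0 \<le> w x" "\<And>x. 0 \<le> g x"
    and w1: "(\<integral>\<^sup>+x. ennreal (w x) \<partial>M) = 1" and p: "1 < p" and m: "0 < m"
    and ge: "ennreal m \<le> (\<integral>\<^sup>+x. ennreal (w x * g x) \<partial>M)"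
  shows "ennreal (m powr p) \<le> (\<integral>\<^sup>+x. ennreal (w x * g x powr p) \<partial>M)"
proof -
  have e: "p * m powr (p - 1) * m = p * m powr p" using m by (simp add: powr_diff)
  have "ennreal ((p - 1) * m powr p) + ennreal (m powr p) = ennreal (p * m powr (p - 1)) * ennreal m"
    using p m e by (simp add: ennreal_plus[symmetric] ennreal_mult[symmetric] algebra_simps del: ennreal_plus)
  also have "\<dots> \<le> ennreal (p * m powr (p - 1)) * (\<integral>\<^sup>+x. ennreal (w x * g x) \<partial>M)"
    by (intro mult_left_mono ge) simp
  also have "\<dots> = (\<integral>\<^sup>+x. ennreal (p * m powr (p - 1) * (w x * g x)) \<partial>M)"
    using p m nn by (subst nn_integral_cmult[symmetric]) (auto simp: ennreal_mult)
  also have "\<dots> \<le> (\<integral>\<^sup>+x. ennreal ((p - 1) * m powr p) * ennreal (w x) + ennreal (w x * g x powr p) \<partial>M)"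
  proof (intro nn_integral_mono)
    fix x
    have "w x * (p * m powr (p - 1) * g x) \<le> w x * (g x powr p + (p - 1) * m powr p)"
      using nn p m by (intro mult_left_mono young_tangent) auto
    then have "p * m powr (p - 1) * (w x * g x) \<le> (p - 1) * m powr p * w x + w x * g x powr p"
      by (simp add: algebra_simps)
    then show "ennreal (p * m powr (p - 1) * (w x * g x)) \<le> ennreal ((p - 1) * m powr p) * ennreal (w x) + ennreal (w x * g x powr p)"
      using nn p m by (simp add: ennreal_plus[symmetric] ennreal_mult[symmetric] ennreal_leI del: ennreal_plus)
  qed
  also have "\<dots> = ennreal ((p - 1) * m powr p) + (\<integral>\<^sup>+x. ennreal (w x * g x powr p) \<partial>M)"
    by (subst nn_integral_add) (auto simp: nn_integral_cmult w1)
  finally show ?thesis by (simp add: ennreal_add_left_cancel_le)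
qed

text \<open>
  Doubling: once \<open>F \<ge> 2\<^sup>j m\<close> on \<open>[t\<^sub>j, b)\<close>, the integral inequality yields \<open>F \<ge> 2\<^sup>j\<^sup>+\<^sup>1 m\<close> after a
  further time proportional to \<open>(2\<^sup>j m)\<^sup>1\<^sup>-\<^sup>p\<close>, and these times form a convergent geometric series.
\<close>

lemma volterra_blowup:
  fixes F X :: "real \<Rightarrow> ennreal" and a b c m p :: real
  assumes ab: "a < b" and c: "0 < c" and m: "0 < m" and p: "1 < p"
    and F0: "\<And>t. a \<le> t \<Longrightarrow> t < b \<Longrightarrow> ennreal m \<le> F t"
    and F1: "\<And>t. a < t \<Longrightarrow> t < b \<Longrightarrow> (\<integral>\<^sup>+s\<in>{a<..<t}. ennreal c * X s \<partial>lborel) \<le> F t"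
    and X: "\<And>s m'. a < s \<Longrightarrow> s < b \<Longrightarrow> 0 < m' \<Longrightarrow> ennreal m' \<le> F s \<Longrightarrow> ennreal (m' powr p) \<le> X s"
    and fin: "(\<integral>\<^sup>+s\<in>{a<..<b}. X s \<partial>lborel) < \<infinity>"
  shows "m powr (p - 1) * (b - a) * c \<le> 4 / (1 - 2 powr (1 - p))"
proof (rule ccontr)
  assume neg: "\<not> ?thesis"
  define q where "q = 2 powr (1 - p)"
  have q: "0 < q" "q < 1" unfolding q_def using p by (auto simp: powr_less_one)
  \<comment> \<open>Chosen so that
    \<open>c * (2 ^ j * m) powr p * \<delta> j = 2 ^ Suc j * m\<close>: waiting for
    \<open>\<delta> j\<close> gains exactly one doubling.\<close>
  define \<delta> where "\<delta> i = 2 * m powr (1 - p) / c * q ^ i" for i :: nat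
  have dpos: "0 < \<delta> i" for i unfolding \<delta>_def using c m q by simp
  define t where "t j = a + (\<Sum>i<j. \<delta> i)" for j :: nat
  have tS: "t (Suc j) = t j + \<delta> j" for j unfolding t_def by simp
  have ta: "a \<le> t j" for j unfolding t_def using dpos by (simp add: sum_nonneg less_imp_le)
  have th: "t j \<le> (a + b) / 2" for j
  proof -
    have "(\<Sum>i<j. \<delta> i) = 2 * m powr (1 - p) / c * (\<Sum>i<j. q ^ i)"
      unfolding \<delta>_def by (simp add: sum_distrib_left)
    also have "(\<Sum>i<j. q ^ i) \<le> 1 / (1 - q)"
      using q by (simp add: sum_gp_strict divide_right_mono)
    then have "2 * m powr (1 - p) / c * (\<Sum>i<j. q ^ i) \<le> 2 * m powr (1 - p) / c * (1 / (1 - q))"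
      using c m by (intro mult_left_mono) auto
    also have "\<dots> \<le> (b - a) / 2"
    proof -
      have "4 / (1 - q) < m powr (p - 1) * (b - a) * c" using neg by (simp add: q_def)
      then have "m powr (1 - p) * (4 / (1 - q)) < m powr (1 - p) * (m powr (p - 1) * (b - a) * c)"
        using m by (intro mult_strict_left_mono) auto
      also have "\<dots> = (b - a) * c" using m by (simp add: mult.assoc[symmetric] powr_add[symmetric])
      finally show ?thesis using c q by (simp add: field_simps)
    qed
    finally show ?thesis unfolding t_def by (simp add: field_simps)
  qed
  have claim: "ennreal (2 ^ j * m) \<le> F s" if "t j \<le> s" "s < b" for j s
    using that
  proof (induction j arbitrary: s)
    case 0 then show ?case using F0 by (simp add: t_def)
  next
    case (Suc j)
    have sa: "a < s" using Suc.prems ta[of j] dpos[of j] tS[of j] by simp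
    have "ennreal (2 ^ Suc j * m) = (\<integral>\<^sup>+r. ennreal (c * (2 ^ j * m) powr p) * indicator {t j<..<t (Suc j)} r \<partial>lborel)"
    proof -
      have "(2 ^ j * m) powr p = 2 ^ j * m * (2 ^ j * m) powr (p - 1)" using m by (simp add: powr_diff)
      also have "(2 ^ j * m) powr (p - 1) = m powr (p - 1) * inverse (q ^ j)"
        using m by (simp add: powr_mult q_def powr_realpow[symmetric] powr_powr powr_minus[symmetric] algebra_simps)
      finally have "c * (2 ^ j * m) powr p * \<delta> j = 2 ^ Suc j * m * (m powr (p - 1) * m powr (1 - p))"
        unfolding \<delta>_def using c q by (simp add: field_simps)
      also have "\<dots> = 2 ^ Suc j * m" using m by (simp flip: powr_add)
      finally show ?thesis using c dpos[of j] by (simp add: nn_integral_cmult_indicator tS less_imp_le flip: ennreal_mult)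
    qed
    also have "\<dots> \<le> (\<integral>\<^sup>+r\<in>{a<..<s}. ennreal c * X r \<partial>lborel)"
    proof (intro nn_integral_mono)
      fix r
      show "ennreal (c * (2 ^ j * m) powr p) * indicator {t j<..<t (Suc j)} r \<le> ennreal c * X r * indicator {a<..<s} r"
      proof (cases "r \<in> {t j<..<t (Suc j)}")
        case True
        then have r: "t j \<le> r" "r < s" "a < r" using Suc.prems ta[of j] by auto
        then have "ennreal ((2 ^ j * m) powr p) \<le> X r"
          using Suc.IH[of r] Suc.prems m by (intro X) auto
        then have "ennreal c * ennreal ((2 ^ j * m) powr p) \<le> ennreal c * X r" by (intro mult_left_mono) auto
        then show ?thesis using True r c by (simp add: ennreal_mult)
      qed simp
    qed
    also have "\<dots> \<le> F s" using F1[OF sa] Suc.prems by simp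
    finally show ?case .
  qed
  \<comment> \<open>All waiting times together stay within the first half of the interval, so on the
    second half every power of two is a lower bound. This contradicts the integrability of
    \<open>X\<close>.\<close>
  have "X s = \<infinity>" if s: "(a + b) / 2 < s" "s < b" for s
  proof -
    have "ennreal (real n) \<le> X s" for n
    proof -
      obtain j where j: "real n / m powr p < 2 ^ j" using real_arch_pow[of 2 "real n / m powr p"] by auto
      have "ennreal ((2 ^ j * m) powr p) \<le> X s"
        using s th[of j] ab m by (intro X claim) auto
      moreover have "real n \<le> (2 ^ j * m) powr p"
      proof -
        have "real n \<le> 2 ^ j * m powr p" using j m by (simp add: field_simps)
        also have "\<dots> \<le> (2 ^ j) powr p * m powr p"
          using p powr_mono[of 1 p "2 ^ j"] by (intro mult_right_mono) auto
        finally show ?thesis using m by (simp add: powr_mult)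
      qed
      ultimately show ?thesis using ennreal_leI order_trans by blast
    qed
    then have "X s \<noteq> r" if "r < top" for r
      using ennreal_Ex_less_of_nat[OF that] by (metis ennreal_of_nat_eq_real_of_nat not_le)
    then show ?thesis by (metis infinity_ennreal_def top.not_eq_extremum)
  qed
  then have "(\<integral>\<^sup>+s. \<infinity> * indicator {(a+b)/2<..<b} s \<partial>lborel) \<le> (\<integral>\<^sup>+s\<in>{a<..<b}. X s \<partial>lborel)"
    using ab by (intro nn_integral_mono) (auto simp: indicator_def)
  moreover have "(\<integral>\<^sup>+s. \<infinity> * indicator {(a+b)/2<..<b} s \<partial>lborel) = \<infinity>"
    using ab by (subst nn_integral_cmult_indicator) (auto simp: ennreal_top_mult field_simps)
  ultimately show False using fin by simp
qed

subsection \<open>The Duhamel term\<close>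

lemma vec_nth_measurable [measurable]:
  fixes f :: "'a \<Rightarrow> real^'n::finite"
  assumes "f \<in> borel_measurable M"
  shows "(\<lambda>x. f x $ i) \<in> borel_measurable M"
  by (rule measurable_compose[OF assms]) (intro borel_measurable_continuous_onI continuous_intros)

lemma measurable_tangential_component:
  "g \<in> M \<rightarrow>\<^sub>M tangential_measure k \<Longrightarrow> i \<noteq> k \<Longrightarrow> (\<lambda>x. g x i) \<in> borel_measurable M"
  using measurable_compose[OF _ tangential_component_measurable, of g M k i] by simp

lemma tg_measurable_app [measurable]:
  assumes [measurable]: "f \<in> borel_measurable M" "g \<in> M \<rightarrow>\<^sub>M tangential_measure k"
  shows "(\<lambda>x. tg k (f x) (g x)) \<in> borel_measurable M"
  by (rule tg_measurable) (auto intro: measurable_tangential_component assms)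

lemma tg_measurable_diff [measurable]:
  assumes f: "f \<in> borel_measurable M" and g: "g \<in> M \<rightarrow>\<^sub>M tangential_measure k" and h: "h \<in> M \<rightarrow>\<^sub>M tangential_measure k"
  shows "(\<lambda>x. tg k (f x) (\<lambda>i. g x i - h x i)) \<in> borel_measurable M"
proof (rule tg_measurable[OF f])
  fix i assume "i \<in> UNIV - {k}"
  then show "(\<lambda>x. g x i - h x i) \<in> borel_measurable M"
    using measurable_tangential_component[OF g, of i] measurable_tangential_component[OF h, of i] by simp
qed

lemma tg_measurable_vec_diff [measurable]:
  fixes g :: "'a \<Rightarrow> real^'n::finite"
  assumes f: "f \<in> borel_measurable M" and g: "g \<in> borel_measurable M" and h: "h \<in> M \<rightarrow>\<^sub>M tangential_measure k"
  shows "(\<lambda>x. tg k (f x) (\<lambda>i. g x $ i - h x i)) \<in> borel_measurable M"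
proof (rule tg_measurable[OF f])
  fix i assume "i \<in> UNIV - {k}"
  then show "(\<lambda>x. g x $ i - h x i) \<in> borel_measurable M"
    using vec_nth_measurable[OF g, of i] measurable_tangential_component[OF h, of i] by simp
qed

lemma tg_measurable_diff_vec [measurable]:
  fixes g :: "'a \<Rightarrow> real^'n::finite"
  assumes f: "f \<in> borel_measurable M" and g: "g \<in> borel_measurable M" and h: "h \<in> M \<rightarrow>\<^sub>M tangential_measure k"
  shows "(\<lambda>x. tg k (f x) (\<lambda>i. h x i - g x $ i)) \<in> borel_measurable M"
proof (rule tg_measurable[OF f])
  fix i assume "i \<in> UNIV - {k}"
  then show "(\<lambda>x. h x i - g x $ i) \<in> borel_measurable M"
    using vec_nth_measurable[OF g, of i] measurable_tangential_component[OF h, of i] by simp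
qed

text \<open>
  Needed besides \<open>tg_measurable_diff\<close>: an arbitrary function \<open>y\<close> is not a point of
  \<open>space (tangential_measure k)\<close>, whose elements are \<open>undefined\<close> at \<open>k\<close>.
\<close>

lemma tg_measurable_diff_const [measurable]:
  assumes f: "f \<in> borel_measurable M" and g: "g \<in> M \<rightarrow>\<^sub>M tangential_measure k"
  shows "(\<lambda>x. tg k (f x) (\<lambda>i. g x i - y i)) \<in> borel_measurable M"
    "(\<lambda>x. tg k (f x) (\<lambda>i. y i - g x i)) \<in> borel_measurable M"
  using measurable_tangential_component[OF g] by (auto intro!: tg_measurable[OF f] borel_measurable_diff)

lemma boundary_point_measurable [measurable]: "boundary_point k \<in> borel_measurable (tangential_measure k)"
proof (rule borel_measurable_euclidean_space[THEN iffD2], rule)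
  fix b :: "real^'a" assume "b \<in> Basis"
  then obtain j where b: "b = axis j 1" by (auto simp: Basis_vec_def)
  have e: "(\<lambda>x. boundary_point k x \<bullet> b) = (\<lambda>x. if j = k then 0 else x j)"
    by (auto simp: b inner_axis boundary_point_def)
  show "(\<lambda>x. boundary_point k x \<bullet> b) \<in> borel_measurable (tangential_measure k)"
    unfolding e using measurable_tangential_component[of "\<lambda>x. x" "tangential_measure k" k j] by (cases "j = k") auto
qed

lemma tangential_Fubini:
  fixes k :: "'n::finite"
  assumes "sigma_finite_measure N" "(\<lambda>(x, y). f x y) \<in> borel_measurable (N \<Otimes>\<^sub>M tangential_measure k)"
  shows "(\<integral>\<^sup>+y. (\<integral>\<^sup>+x. f x y \<partial>N) \<partial>tangential_measure k) = (\<integral>\<^sup>+x. (\<integral>\<^sup>+y. f x y \<partial>tangential_measure k) \<partial>N)"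
proof -
  interpret pair_sigma_finite N "tangential_measure k"
    using assms sigma_finite_tangential by (simp add: pair_sigma_finite_def)
  show ?thesis using Fubini'[of f] assms(2) by simp
qed

lemma tangential_nn_integral_measurable [measurable]:
  fixes k :: "'n::finite"
  assumes "(\<lambda>(x, y). f x y) \<in> borel_measurable (N \<Otimes>\<^sub>M tangential_measure k)"
  shows "(\<lambda>x. \<integral>\<^sup>+y. f x y \<partial>tangential_measure k) \<in> borel_measurable N"
  using sigma_finite_measure.borel_measurable_nn_integral[OF sigma_finite_tangential assms] .

definition jointly_measurable :: "'n::finite \<Rightarrow> (('n \<Rightarrow> real) \<Rightarrow> real \<Rightarrow> real) \<Rightarrow> bool" where
  "jointly_measurable k v \<longleftrightarrow> (\<lambda>(y, s). v y s) \<in> borel_measurable (tangential_measure k \<Otimes>\<^sub>M borel)"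

lemma jointly_measurable_comp:
  assumes "jointly_measurable k v" "f \<in> M \<rightarrow>\<^sub>M tangential_measure k" "g \<in> borel_measurable M"
  shows "(\<lambda>x. v (f x) (g x)) \<in> borel_measurable M"
  using measurable_compose[OF measurable_Pair[OF assms(2,3)] assms(1)[unfolded jointly_measurable_def]] by simp

lemma heat_measurable [measurable]:
  assumes [measurable]: "\<phi> \<in> borel_measurable borel" "f \<in> borel_measurable M" "g \<in> borel_measurable M"
  shows "(\<lambda>x. heat k \<phi> (f x) (g x)) \<in> borel_measurable M"
proof -
  have "(\<lambda>z. heat k \<phi> (fst z) (snd z)) \<in> borel_measurable (borel \<Otimes>\<^sub>M borel)"
    unfolding heat_def by measurable
  from measurable_compose[OF measurable_Pair[OF assms(2,3)] this] show ?thesis by simp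
qed

text \<open>The boundary integral of the solution identity with its kernel factorised by
  \<open>green_boundary_point\<close>. The boundary trace is a separate total function
  \<open>v\<close>, so the same operator serves solutions, supersolutions and iterates.\<close>

definition duhamel :: "'n::finite \<Rightarrow> real \<Rightarrow> (('n \<Rightarrow> real) \<Rightarrow> real \<Rightarrow> real) \<Rightarrow> real^'n \<Rightarrow> real \<Rightarrow> ennreal" where
  "duhamel k p v x t = (\<integral>\<^sup>+s\<in>{0<..<t}. ennreal (2 * hk (t - s) (x $ k)) *
     (\<integral>\<^sup>+y'. ennreal (tg k (t - s) (\<lambda>i. x $ i - y' i) * v y' s powr p) \<partial>tangential_measure k) \<partial>lborel)"

lemma duhamel_eq:
  fixes k :: "'n::finite"
  assumes v: "jointly_measurable k v" and eq: "\<And>y' s. 0 < s \<Longrightarrow> s < t \<Longrightarrow> u (boundary_point k y') s = v y' s"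
  shows "(\<integral>\<^sup>+ s\<in>{0<..<t}. (\<integral>\<^sup>+ y'. ennreal (green k x (boundary_point k y') (t - s) *
              u (boundary_point k y') s powr p) \<partial>tangential_measure k) \<partial>lborel) = duhamel k p v x t"
  unfolding duhamel_def
proof (intro nn_integral_cong)
  fix s :: real
  note [measurable] = jointly_measurable_comp[OF v]
  show "(\<integral>\<^sup>+ y'. ennreal (green k x (boundary_point k y') (t - s) * u (boundary_point k y') s powr p) \<partial>tangential_measure k) * indicator {0<..<t} s
     = ennreal (2 * hk (t - s) (x $ k)) *
     (\<integral>\<^sup>+y'. ennreal (tg k (t - s) (\<lambda>i. x $ i - y' i) * v y' s powr p) \<partial>tangential_measure k) * indicator {0<..<t} s"
  proof (cases "s \<in> {0<..<t}")
    case True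
    have "(\<integral>\<^sup>+ y'. ennreal (green k x (boundary_point k y') (t - s) * u (boundary_point k y') s powr p) \<partial>tangential_measure k)
      = (\<integral>\<^sup>+ y'. ennreal (2 * hk (t - s) (x $ k)) * ennreal (tg k (t - s) (\<lambda>i. x $ i - y' i) * v y' s powr p) \<partial>tangential_measure k)"
      using True hk_nonneg[of "t - s"] by (simp add: green_boundary_point eq ennreal_mult' mult.assoc)
    also have "\<dots> = ennreal (2 * hk (t - s) (x $ k)) * (\<integral>\<^sup>+ y'. ennreal (tg k (t - s) (\<lambda>i. x $ i - y' i) * v y' s powr p) \<partial>tangential_measure k)"
      by (rule nn_integral_cmult) measurable
    finally show ?thesis by simp
  qed simp
qed

text \<open>A solution is controlled only on the closed half space and for times in
  \<open>(0, T)\<close>; elsewhere its values are arbitrary. Continuity on that Borel set makes the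
  extension by zero Borel measurable, and \<open>v\<close> is its boundary trace.\<close>

lemma solution_boundary:
  fixes k :: "'n::finite"
  assumes sol: "is_solution k p \<phi> T u"
  obtains v where "jointly_measurable k v" "\<And>y s. 0 \<le> v y s" "\<And>y s. 0 < s \<Longrightarrow> s < T \<Longrightarrow> v y s = u (boundary_point k y) s"
    "\<And>x t. x \<in> closed_half_space k \<Longrightarrow> 0 < t \<Longrightarrow> t < T \<Longrightarrow> ennreal (u x t) = heat k \<phi> x t + duhamel k p v x t"
proof -
  define D where "D = closed_half_space k \<times> {0<..<T}"
  define U where "U z = indicator D z *\<^sub>R (case z of (x, t) \<Rightarrow> u x t)" for z
  have [measurable]: "U \<in> borel_measurable borel"
    unfolding U_def
  proof (rule borel_measurable_continuous_on_indicator)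
    show "D \<in> sets borel" unfolding D_def by (intro borel_Times) auto
    show "continuous_on D (\<lambda>z. case z of (x, t) \<Rightarrow> u x t)" using sol unfolding is_solution_def D_def by simp
  qed
  define v where "v y s = U (boundary_point k y, s)" for y s
  have v: "jointly_measurable k v"
    unfolding jointly_measurable_def v_def by measurable
  have eq: "v y s = u (boundary_point k y) s" if "0 < s" "s < T" for y s
    using that unfolding v_def U_def D_def by simp
  show ?thesis
  proof (rule that[OF v _ eq])
    show "0 \<le> v y s" for y s
      using sol unfolding v_def U_def D_def is_solution_def by (auto simp: indicator_def)
    show "ennreal (u x t) = heat k \<phi> x t + duhamel k p v x t" if "x \<in> closed_half_space k" "0 < t" "t < T" for x t
    proof -
      have "ennreal (u x t) =
          (\<integral>\<^sup>+ y\<in>closed_half_space k. ennreal (green k x y t * \<phi> y) \<partial>lebesgue) +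
          (\<integral>\<^sup>+ s\<in>{0<..<t}. (\<integral>\<^sup>+ y'. ennreal (green k x (boundary_point k y') (t - s) *
              u (boundary_point k y') s powr p) \<partial>tangential_measure k) \<partial>lborel)"
        using sol that unfolding is_solution_def by auto
      then show ?thesis
        using that by (subst (asm) duhamel_eq[OF v, where u=u]) (auto simp: heat_lebesgue eq)
    qed
  qed
qed

lemma solution_mono: "is_solution k p \<phi> T u \<Longrightarrow> T' \<le> T \<Longrightarrow> is_solution k p \<phi> T' u"
  unfolding is_solution_def by (auto intro: continuous_on_subset)

subsection \<open>Necessary conditions for solvability\<close>

text \<open>Tonelli moves the average under the time integral, where \<open>tg k (S - t)\<close> and
  \<open>tg k (t - s)\<close> merge into \<open>tg k (S - s)\<close>. The family of weights thus
  reproduces itself, which closes the inequality; the nonnegative heat term is dropped.\<close>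

lemma flux_functional_ge:
  fixes k :: "'n::finite"
  assumes v: "jointly_measurable k v" "\<And>y s. 0 \<le> v y s" and t: "0 < t" "t < S"
    and vt: "\<And>y. ennreal (v y t) = heat k \<phi> (boundary_point k y) t + duhamel k p v (boundary_point k y) t"
  shows "(\<integral>\<^sup>+s\<in>{0<..<t}. ennreal (2 * hk (t - s) 0) * (\<integral>\<^sup>+y. ennreal (tg k (S - s) y * v y s powr p) \<partial>tangential_measure k) \<partial>lborel)
     \<le> (\<integral>\<^sup>+y. ennreal (tg k (S - t) y * v y t) \<partial>tangential_measure k)"
proof -
  let ?m = "tangential_measure k"
  note [measurable] = jointly_measurable_comp[OF v(1)]
  interpret T: sigma_finite_measure ?m by (rule sigma_finite_tangential)
  have conv: "(\<integral>\<^sup>+x. ennreal (tg k (S - t) x) * ennreal (tg k (t - s) (\<lambda>i. x i - y i)) \<partial>?m) = ennreal (tg k (S - s) y)"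
    if "0 < s" "s < t" for s y
    using tg_conv_mult[of "S - t" "t - s" k "\<lambda>_. 0" y] t that unfolding tg_zero_diff by simp
  have "(\<integral>\<^sup>+s\<in>{0<..<t}. ennreal (2 * hk (t - s) 0) * (\<integral>\<^sup>+y. ennreal (tg k (S - s) y * v y s powr p) \<partial>?m) \<partial>lborel)
     = (\<integral>\<^sup>+s\<in>{0<..<t}. (\<integral>\<^sup>+y. (\<integral>\<^sup>+x. ennreal (2 * hk (t - s) 0) * (ennreal (v y s powr p) * (ennreal (tg k (S - t) x) * ennreal (tg k (t - s) (\<lambda>i. x i - y i)))) \<partial>?m) \<partial>?m) \<partial>lborel)"
  proof (intro nn_integral_cong)
    fix s :: real
    show "ennreal (2 * hk (t - s) 0) * (\<integral>\<^sup>+y. ennreal (tg k (S - s) y * v y s powr p) \<partial>?m) * indicator {0<..<t} s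
      = (\<integral>\<^sup>+y. (\<integral>\<^sup>+x. ennreal (2 * hk (t - s) 0) * (ennreal (v y s powr p) * (ennreal (tg k (S - t) x) * ennreal (tg k (t - s) (\<lambda>i. x i - y i)))) \<partial>?m) \<partial>?m) * indicator {0<..<t} s"
    proof (cases "s \<in> {0<..<t}")
      case True
      have "(\<integral>\<^sup>+y. (\<integral>\<^sup>+x. ennreal (2 * hk (t - s) 0) * (ennreal (v y s powr p) * (ennreal (tg k (S - t) x) * ennreal (tg k (t - s) (\<lambda>i. x i - y i)))) \<partial>?m) \<partial>?m)
         = (\<integral>\<^sup>+y. ennreal (2 * hk (t - s) 0) * ennreal (tg k (S - s) y * v y s powr p) \<partial>?m)"
      proof (intro nn_integral_cong)
        fix y
        have "(\<integral>\<^sup>+x. ennreal (2 * hk (t - s) 0) * (ennreal (v y s powr p) * (ennreal (tg k (S - t) x) * ennreal (tg k (t - s) (\<lambda>i. x i - y i)))) \<partial>?m)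
          = ennreal (2 * hk (t - s) 0) * (ennreal (v y s powr p) * ennreal (tg k (S - s) y))"
          using True by (subst nn_integral_cmult, measurable, subst nn_integral_cmult, measurable, subst conv, auto)
        also have "ennreal (v y s powr p) * ennreal (tg k (S - s) y) = ennreal (tg k (S - s) y * v y s powr p)"
          by (subst ennreal_mult'') (auto simp: mult.commute)
        finally show "(\<integral>\<^sup>+x. ennreal (2 * hk (t - s) 0) * (ennreal (v y s powr p) * (ennreal (tg k (S - t) x) * ennreal (tg k (t - s) (\<lambda>i. x i - y i)))) \<partial>?m)
          = ennreal (2 * hk (t - s) 0) * ennreal (tg k (S - s) y * v y s powr p)" .
      qed
      then show ?thesis by (simp add: nn_integral_cmult)
    qed simp
  qed
  also have "\<dots> = (\<integral>\<^sup>+s. (\<integral>\<^sup>+x. (\<integral>\<^sup>+y. ennreal (2 * hk (t - s) 0) * (ennreal (v y s powr p) * (ennreal (tg k (S - t) x) * ennreal (tg k (t - s) (\<lambda>i. x i - y i)))) * indicator {0<..<t} s \<partial>?m) \<partial>?m) \<partial>lborel)"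
    by (subst tangential_Fubini[OF sigma_finite_tangential]) (auto simp: nn_integral_multc)
  also have "\<dots> = (\<integral>\<^sup>+x. (\<integral>\<^sup>+s. (\<integral>\<^sup>+y. ennreal (2 * hk (t - s) 0) * (ennreal (v y s powr p) * (ennreal (tg k (S - t) x) * ennreal (tg k (t - s) (\<lambda>i. x i - y i)))) * indicator {0<..<t} s \<partial>?m) \<partial>lborel) \<partial>?m)"
    by (rule tangential_Fubini[OF sigma_finite_lborel, symmetric]) measurable
  also have "\<dots> = (\<integral>\<^sup>+x. ennreal (tg k (S - t) x) * duhamel k p v (boundary_point k x) t \<partial>?m)"
  proof (intro nn_integral_cong)
    fix x
    have e: "tg k a (\<lambda>i. boundary_point k x $ i - y i) = tg k a (\<lambda>i. x i - y i)" for a y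
      unfolding tg_def by (auto intro!: prod.cong simp: boundary_point_def)
    have "ennreal (tg k (S - t) x) * duhamel k p v (boundary_point k x) t =
      (\<integral>\<^sup>+s. ennreal (tg k (S - t) x) * (ennreal (2 * hk (t - s) 0) *
     (\<integral>\<^sup>+y'. ennreal (tg k (t - s) (\<lambda>i. x i - y' i) * v y' s powr p) \<partial>?m) * indicator {0<..<t} s) \<partial>lborel)"
      unfolding duhamel_def e by (subst nn_integral_cmult) (auto simp: boundary_point_def)
    also have "\<dots> = (\<integral>\<^sup>+s. (\<integral>\<^sup>+y. ennreal (2 * hk (t - s) 0) * (ennreal (v y s powr p) * (ennreal (tg k (S - t) x) * ennreal (tg k (t - s) (\<lambda>i. x i - y i)))) * indicator {0<..<t} s \<partial>?m) \<partial>lborel)"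
    proof (intro nn_integral_cong)
      fix s :: real
      show "ennreal (tg k (S - t) x) * (ennreal (2 * hk (t - s) 0) *
         (\<integral>\<^sup>+y'. ennreal (tg k (t - s) (\<lambda>i. x i - y' i) * v y' s powr p) \<partial>?m) * indicator {0<..<t} s)
         = (\<integral>\<^sup>+y. ennreal (2 * hk (t - s) 0) * (ennreal (v y s powr p) * (ennreal (tg k (S - t) x) * ennreal (tg k (t - s) (\<lambda>i. x i - y i)))) * indicator {0<..<t} s \<partial>?m)"
      proof (cases "s \<in> {0<..<t}")
        case True
        have "(\<integral>\<^sup>+y. ennreal (2 * hk (t - s) 0) * (ennreal (v y s powr p) * (ennreal (tg k (S - t) x) * ennreal (tg k (t - s) (\<lambda>i. x i - y i)))) * indicator {0<..<t} s \<partial>?m)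
          = (\<integral>\<^sup>+y. (ennreal (2 * hk (t - s) 0) * ennreal (tg k (S - t) x)) * ennreal (tg k (t - s) (\<lambda>i. x i - y i) * v y s powr p) \<partial>?m)"
          using True by (intro nn_integral_cong) (simp add: ennreal_mult' tg_nonneg mult_ac)
        also have "\<dots> = (ennreal (2 * hk (t - s) 0) * ennreal (tg k (S - t) x)) * (\<integral>\<^sup>+y. ennreal (tg k (t - s) (\<lambda>i. x i - y i) * v y s powr p) \<partial>?m)"
          by (rule nn_integral_cmult) measurable
        finally show ?thesis using True by (simp add: mult_ac)
      qed simp
    qed
    finally show "(\<integral>\<^sup>+s. (\<integral>\<^sup>+y. ennreal (2 * hk (t - s) 0) * (ennreal (v y s powr p) * (ennreal (tg k (S - t) x) * ennreal (tg k (t - s) (\<lambda>i. x i - y i)))) * indicator {0<..<t} s \<partial>?m) \<partial>lborel) =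
       ennreal (tg k (S - t) x) * duhamel k p v (boundary_point k x) t" by simp
  qed
  also have "\<dots> \<le> (\<integral>\<^sup>+y. ennreal (tg k (S - t) y * v y t) \<partial>?m)"
    using t by (intro nn_integral_mono) (simp add: ennreal_mult' tg_nonneg vt distrib_left)
  finally show ?thesis .
qed

text \<open>Jensen turns \<open>flux_functional_ge\<close> into the hypothesis of
  \<open>volterra_blowup\<close> on \<open>(S / 2, S)\<close>. A finite solution value at time
  \<open>S\<close> excludes the blow-up, which limits \<open>m\<close>.\<close>

lemma flux_functional_bound:
  fixes k :: "'n::finite"
  assumes p: "1 < p" and v: "jointly_measurable k v" "\<And>y s. 0 \<le> v y s" and S: "0 < S" "S < T" and m: "0 < m"
    and eq: "\<And>x t. x \<in> closed_half_space k \<Longrightarrow> 0 < t \<Longrightarrow> t < T \<Longrightarrow> ennreal (u x t) = heat k \<phi> x t + duhamel k p v x t"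
    and vu: "\<And>y s. 0 < s \<Longrightarrow> s < T \<Longrightarrow> v y s = u (boundary_point k y) s"
    and lower: "\<And>t. S / 2 \<le> t \<Longrightarrow> t < S \<Longrightarrow> ennreal m \<le> (\<integral>\<^sup>+y. ennreal (tg k (S - t) y * v y t) \<partial>tangential_measure k)"
  shows "m powr (p - 1) * sqrt S \<le> 2 * sqrt pi * (4 / (1 - 2 powr (1 - p)))"
proof -
  let ?m = "tangential_measure k"
  note [measurable] = jointly_measurable_comp[OF v(1)]
  define X where "X s = (\<integral>\<^sup>+y. ennreal (tg k (S - s) y * v y s powr p) \<partial>?m)" for s
  define F where "F t = (\<integral>\<^sup>+y. ennreal (tg k (S - t) y * v y t) \<partial>?m)" for t
  \<comment> \<open>The least value of the normal kernel
    \<open>2 * hk (t - s) 0 = 1 / sqrt (pi * (t - s))\<close> for time differences up to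
    \<open>S\<close>.\<close>
  define c where "c = 1 / sqrt (pi * S)"
  have c: "0 < c" using S by (simp add: c_def)
  have c_le: "c \<le> 2 * hk (t - s) 0" if "0 < s" "s < t" "t \<le> S" for s t
  proof -
    have "2 * hk (t - s) 0 = 1 / sqrt (pi * (t - s))"
      unfolding hk_0 by (simp add: real_sqrt_mult)
    moreover have "sqrt (pi * (t - s)) \<le> sqrt (pi * S)" using that by simp
    ultimately show ?thesis unfolding c_def using that by (simp add: frac_le)
  qed
  have [measurable]: "X \<in> borel_measurable borel"
    unfolding X_def by measurable
  have FX: "(\<integral>\<^sup>+s\<in>{0<..<t}. ennreal c * X s \<partial>lborel) \<le> F t" if t: "0 < t" "t < S" for t
  proof -
    have "(\<integral>\<^sup>+s\<in>{0<..<t}. ennreal c * X s \<partial>lborel) \<le> (\<integral>\<^sup>+s\<in>{0<..<t}. ennreal (2 * hk (t - s) 0) * X s \<partial>lborel)"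
      using t c_le by (intro nn_integral_mono) (auto simp: indicator_def intro!: mult_right_mono ennreal_leI)
    also have "\<dots> \<le> F t"
      unfolding X_def F_def using t S eq[of "boundary_point k _" t] vu[of t]
      by (intro flux_functional_ge[where \<phi>=\<phi>] v) auto
    finally show ?thesis .
  qed
  \<comment> \<open>At time \<open>S\<close> the weight \<open>tg k (S - s)\<close> is exactly the
    kernel of the Duhamel term at the origin, so the integral of \<open>X\<close> is bounded by a
    multiple of \<open>u 0 S\<close>.\<close>
  have fin: "(\<integral>\<^sup>+s\<in>{0<..<S}. X s \<partial>lborel) < \<infinity>"
  proof -
    have "ennreal c * (\<integral>\<^sup>+s\<in>{0<..<S}. X s \<partial>lborel) = (\<integral>\<^sup>+s\<in>{0<..<S}. ennreal c * X s \<partial>lborel)"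
      by (subst nn_integral_cmult[symmetric]) (auto simp: mult.assoc)
    also have "\<dots> \<le> duhamel k p v 0 S"
      unfolding duhamel_def
    proof (intro nn_integral_mono)
      fix s :: real
      have e: "tg k a (\<lambda>i. (0::real^'n) $ i - y i) = tg k a y" for a y
        unfolding tg_def by (auto intro!: prod.cong)
      show "ennreal c * X s * indicator {0<..<S} s \<le> ennreal (2 * hk (S - s) ((0::real^'n) $ k)) *
         (\<integral>\<^sup>+ y'. ennreal (tg k (S - s) (\<lambda>i. (0::real^'n) $ i - y' i) * v y' s powr p) \<partial>?m) * indicator {0<..<S} s"
        unfolding e X_def using c_le[of s S] by (auto simp: indicator_def intro!: mult_right_mono ennreal_leI)
    qed
    also have "\<dots> \<le> ennreal (u 0 S)" using eq[of 0 S] S by simp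
    also have "\<dots> < \<infinity>" by simp
    finally show ?thesis using c by (auto simp: ennreal_mult_less_top)
  qed
  have "m powr (p - 1) * (S - S / 2) * c \<le> 4 / (1 - 2 powr (1 - p))"
  proof (rule volterra_blowup[of "S/2" S c m p F X])
    show "ennreal m \<le> F t" if "S / 2 \<le> t" "t < S" for t
      unfolding F_def using that by (rule lower)
    show "(\<integral>\<^sup>+s\<in>{S / 2<..<t}. ennreal c * X s \<partial>lborel) \<le> F t" if "S / 2 < t" "t < S" for t
    proof -
      have "(\<integral>\<^sup>+s\<in>{S / 2<..<t}. ennreal c * X s \<partial>lborel) \<le> (\<integral>\<^sup>+s\<in>{0<..<t}. ennreal c * X s \<partial>lborel)"
        using S by (intro nn_integral_mono) (auto simp: indicator_def)
      also have "\<dots> \<le> F t" using that S by (intro FX) auto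
      finally show ?thesis .
    qed
    show "ennreal (m' powr p) \<le> X s" if "S / 2 < s" "s < S" "0 < m'" "ennreal m' \<le> F s" for s m'
      unfolding X_def
    proof (rule jensen_powr)
      show "(\<integral>\<^sup>+ y. ennreal (tg k (S - s) y) \<partial>?m) = 1"
        using tg_integral[of "S - s" k "\<lambda>_. 0"] that unfolding tg_zero_diff by simp
      show "ennreal m' \<le> (\<integral>\<^sup>+ y. ennreal (tg k (S - s) y * v y s) \<partial>?m)"
        using that unfolding F_def by simp
    qed (use that p v tg_nonneg[of "S - s" k] in auto)
    show "(\<integral>\<^sup>+s\<in>{S / 2<..<S}. X s \<partial>lborel) < \<infinity>"
    proof (rule le_less_trans[OF _ fin])
      show "(\<integral>\<^sup>+s\<in>{S / 2<..<S}. X s \<partial>lborel) \<le> (\<integral>\<^sup>+s\<in>{0<..<S}. X s \<partial>lborel)"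
        using S by (intro nn_integral_mono) (auto simp: indicator_def)
    qed
  qed (use S c m p in auto)
  moreover have "m powr (p - 1) * (S - S / 2) * c = m powr (p - 1) * sqrt S / (2 * sqrt pi)"
  proof -
    have "S / sqrt (pi * S) = sqrt S / sqrt pi"
      using S by (simp add: real_sqrt_mult real_div_sqrt field_simps)
    moreover have "m powr (p - 1) * (S - S / 2) * c = m powr (p - 1) * (S / sqrt (pi * S)) / 2"
      unfolding c_def by simp
    ultimately show ?thesis by (simp only:) simp
  qed
  ultimately have "m powr (p - 1) * sqrt S / (2 * sqrt pi) \<le> 4 / (1 - 2 powr (1 - p))" by simp
  then have "m powr (p - 1) * sqrt S \<le> 4 / (1 - 2 powr (1 - p)) * (2 * sqrt pi)"
    by (subst (asm) pos_divide_le_eq) auto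
  then show ?thesis by (simp only: mult_ac)
qed

text \<open>Convolution along the boundary advances the tangential factor from time \<open>t\<close>
  to \<open>S\<close> but leaves the normal factor at time \<open>t\<close>. Both the lower bounds
  and the estimate of the supersolution start from this identity.\<close>

lemma heat_boundary_conv:
  fixes k :: "'n::finite"
  assumes [measurable]: "\<phi> \<in> borel_measurable borel" and nn: "\<And>z. 0 \<le> \<phi> z" and t: "0 < t" "t < S"
  shows "(\<integral>\<^sup>+y. ennreal (tg k (S - t) (\<lambda>i. x i - y i)) * heat k \<phi> (boundary_point k y) t \<partial>tangential_measure k)
    = (\<integral>\<^sup>+z\<in>closed_half_space k. ennreal (2 * hk t (z $ k) * tg k S (\<lambda>i. x i - z $ i) * \<phi> z) \<partial>lborel)"
proof -
  let ?m = "tangential_measure k"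
  have conv: "(\<integral>\<^sup>+y. ennreal (tg k (S - t) (\<lambda>i. x i - y i)) * ennreal (tg k t (\<lambda>i. y i - z i)) \<partial>?m) = ennreal (tg k S (\<lambda>i. x i - z i))" for z
    using tg_conv_mult[of "S - t" t k x z] t by simp
  have g: "ennreal (green k (boundary_point k y) z t * \<phi> z) = ennreal (2 * hk t (z $ k) * \<phi> z) * ennreal (tg k t (\<lambda>i. y i - z $ i))" for y z
    using t nn[of z] by (subst ennreal_mult[symmetric]) (auto simp: green_boundary_point hk_nonneg tg_nonneg mult_ac)
  have "(\<integral>\<^sup>+y. ennreal (tg k (S - t) (\<lambda>i. x i - y i)) * heat k \<phi> (boundary_point k y) t \<partial>?m)
    = (\<integral>\<^sup>+y. (\<integral>\<^sup>+z. ennreal (2 * hk t (z $ k) * \<phi> z) * indicator (closed_half_space k) z * (ennreal (tg k (S - t) (\<lambda>i. x i - y i)) * ennreal (tg k t (\<lambda>i. y i - z $ i))) \<partial>lborel) \<partial>?m)"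
    unfolding heat_def g by (intro nn_integral_cong) (subst nn_integral_cmult[symmetric], auto simp: mult_ac)
  also have "\<dots> = (\<integral>\<^sup>+z. (\<integral>\<^sup>+y. ennreal (2 * hk t (z $ k) * \<phi> z) * indicator (closed_half_space k) z * (ennreal (tg k (S - t) (\<lambda>i. x i - y i)) * ennreal (tg k t (\<lambda>i. y i - z $ i))) \<partial>?m) \<partial>lborel)"
    by (rule tangential_Fubini[OF sigma_finite_lborel]) measurable
  also have "\<dots> = (\<integral>\<^sup>+z. ennreal (2 * hk t (z $ k) * \<phi> z) * indicator (closed_half_space k) z * ennreal (tg k S (\<lambda>i. x i - z $ i)) \<partial>lborel)"
    by (intro nn_integral_cong, subst nn_integral_cmult, measurable, subst conv, simp)
  also have "\<dots> = (\<integral>\<^sup>+z\<in>closed_half_space k. ennreal (2 * hk t (z $ k) * tg k S (\<lambda>i. x i - z $ i) * \<phi> z) \<partial>lborel)"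
  proof (intro nn_integral_cong)
    fix z :: "real^'n"
    have "ennreal (2 * hk t (z $ k) * tg k S (\<lambda>i. x i - z $ i) * \<phi> z) = ennreal (2 * hk t (z $ k) * \<phi> z) * ennreal (tg k S (\<lambda>i. x i - z $ i))"
      using t nn[of z] by (subst ennreal_mult[symmetric]) (auto simp: hk_nonneg tg_nonneg mult_ac)
    then show "ennreal (2 * hk t (z $ k) * \<phi> z) * indicator (closed_half_space k) z * ennreal (tg k S (\<lambda>i. x i - z $ i))
      = ennreal (2 * hk t (z $ k) * tg k S (\<lambda>i. x i - z $ i) * \<phi> z) * indicator (closed_half_space k) z"
      by (simp add: mult_ac)
  qed
  finally show ?thesis .
qed

lemma heat_boundary_conv_origin:
  fixes k :: "'n::finite"
  assumes [measurable]: "\<phi> \<in> borel_measurable borel" and nn: "\<And>z. 0 \<le> \<phi> z" and t: "0 < t" "t < S"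
  shows "(\<integral>\<^sup>+y. ennreal (tg k (S - t) y) * heat k \<phi> (boundary_point k y) t \<partial>tangential_measure k)
    = (\<integral>\<^sup>+z\<in>closed_half_space k. ennreal (2 * hk t (z $ k) * tg k S (\<lambda>i. z $ i) * \<phi> z) \<partial>lborel)"
  using heat_boundary_conv[where x="\<lambda>_. 0" and k=k, OF assms] unfolding tg_zero_diff .

section \<open>Bounds on the mass of the datum near the boundary origin\<close>

lemma hk_ge:
  assumes "0 < t" "x\<^sup>2 \<le> S" "S \<le> 2 * t" "t \<le> S"
  shows "exp (- (1/2)) / sqrt (4 * pi * S) \<le> hk t x"
proof -
  have "x\<^sup>2 / (4 * t) \<le> S / (4 * t)" using assms by (intro divide_right_mono) auto
  also have "\<dots> \<le> 1 / 2" using assms by (simp add: field_simps)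
  finally have "exp (- (1/2)) \<le> exp (- x\<^sup>2 / (4 * t))" by simp
  moreover have "sqrt (4 * pi * t) \<le> sqrt (4 * pi * S)" "0 < sqrt (4 * pi * t)" using assms by auto
  ultimately show ?thesis unfolding hk_def by (intro frac_le) auto
qed

text \<open>For \<open>S / 2 \<le> t < S\<close> and sources within \<open>sqrt S\<close> of the
  origin, each one-dimensional factor is at least a multiple of \<open>S powr (-1/2)\<close>. The
  averaged heat term therefore dominates \<open>m = q * S powr (- N / 2) * \<mu>\<close>, and
  \<open>flux_functional_bound\<close> is solved for \<open>\<mu>\<close>.\<close>

lemma mass_bound:
  fixes k :: "'n::finite" and p :: real
  assumes p: "1 < p"
  obtains C where "0 < C" "\<And>\<phi> T u S \<mu>. is_solution k p \<phi> T u \<Longrightarrow> \<phi> \<in> borel_measurable borel \<Longrightarrow> (\<And>z. 0 \<le> \<phi> z) \<Longrightarrow>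
    0 < S \<Longrightarrow> S < T \<Longrightarrow> 0 < \<mu> \<Longrightarrow>
    ennreal \<mu> \<le> (\<integral>\<^sup>+z\<in>closed_half_space k. ennreal (\<phi> z) * indicator (ball 0 (sqrt S)) z \<partial>lborel) \<Longrightarrow>
    \<mu> * S powr (1 / (2 * (p - 1)) - real CARD('n) / 2) \<le> C"
proof -
  define N where "N = real CARD('n)"
  \<comment> \<open>The lower bound of \<open>hk_ge\<close> without its factor
    \<open>S powr (-1/2)\<close>, once for each coordinate, times the \<open>2\<close> from the
    boundary Green function.\<close>
  define q where "q = 2 * (exp (- (1/2)) / sqrt (4 * pi)) ^ CARD('n)"
  have q: "0 < q" unfolding q_def by simp
  define K where "K = 2 * sqrt pi * (4 / (1 - 2 powr (1 - p)))"
  have K: "0 < K" unfolding K_def using p by (auto simp: powr_less_one)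
  show ?thesis
  proof (rule that[of "K powr (1 / (p - 1)) / q"])
    show "0 < K powr (1 / (p - 1)) / q" using K q by simp
    fix \<phi> T u S \<mu>
    assume sol: "is_solution k p \<phi> T u" and [measurable]: "\<phi> \<in> borel_measurable borel" and nn: "\<And>z. 0 \<le> \<phi> z"
      and S: "0 < S" "S < T" and mu: "0 < \<mu>"
      and mass: "ennreal \<mu> \<le> (\<integral>\<^sup>+z\<in>closed_half_space k. ennreal (\<phi> z) * indicator (ball 0 (sqrt S)) z \<partial>lborel)"
    obtain v where v: "jointly_measurable k v" "\<And>y s. 0 \<le> v y s" "\<And>y s. 0 < s \<Longrightarrow> s < T \<Longrightarrow> v y s = u (boundary_point k y) s"
      "\<And>x t. x \<in> closed_half_space k \<Longrightarrow> 0 < t \<Longrightarrow> t < T \<Longrightarrow> ennreal (u x t) = heat k \<phi> x t + duhamel k p v x t"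
      using solution_boundary[OF sol] by metis
    note [measurable] = jointly_measurable_comp[OF v(1)]
    define m where "m = q * S powr (- N / 2) * \<mu>"
    have m: "0 < m" using q S mu by (simp add: m_def)
    have q2: "2 * (exp (- (1/2)) / sqrt (4 * pi * S)) ^ CARD('n) = q * S powr (- N / 2)"
    proof -
      have "sqrt S ^ CARD('n) = S powr (N / 2)"
        using S powr_powr[of S "1/2" N] powr_realpow[of "sqrt S" "CARD('n)"] by (simp add: powr_half_sqrt N_def)
      then have "(1 / sqrt S) ^ CARD('n) = S powr (- N / 2)"
        using S by (simp add: power_one_over powr_minus_divide)
      moreover have "exp (- (1/2)) / sqrt (4 * pi * S) = exp (- (1/2)) / sqrt (4 * pi) * (1 / sqrt S)"
        by (simp add: real_sqrt_mult)
      ultimately show ?thesis unfolding q_def by (simp only: power_mult_distrib mult.assoc)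
    qed
    have "m powr (p - 1) * sqrt S \<le> K"
      unfolding K_def
    proof (rule flux_functional_bound[OF p v(1,2) S m v(4,3)])
      fix t assume t: "S / 2 \<le> t" "t < S"
      have t0: "0 < t" using t S by simp
      have "ennreal m = ennreal (q * S powr (- N / 2)) * ennreal \<mu>"
        using q S mu by (simp add: m_def ennreal_mult)
      also have "\<dots> \<le> ennreal (q * S powr (- N / 2)) * (\<integral>\<^sup>+z\<in>closed_half_space k. ennreal (\<phi> z) * indicator (ball 0 (sqrt S)) z \<partial>lborel)"
        by (intro mult_left_mono mass) simp
      also have "\<dots> = (\<integral>\<^sup>+z. ennreal (q * S powr (- N / 2)) * (ennreal (\<phi> z) * indicator (ball 0 (sqrt S)) z * indicator (closed_half_space k) z) \<partial>lborel)"
        by (rule nn_integral_cmult[symmetric]) measurable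
      also have "\<dots> \<le> (\<integral>\<^sup>+z\<in>closed_half_space k. ennreal (2 * hk t (z $ k) * tg k S (\<lambda>i. z $ i) * \<phi> z) \<partial>lborel)"
      proof (intro nn_integral_mono)
        fix z :: "real^'n"
        have "q * S powr (- N / 2) * \<phi> z \<le> 2 * hk t (z $ k) * tg k S (\<lambda>i. z $ i) * \<phi> z" if z: "norm z < sqrt S"
        proof -
          have zi: "(z $ i)\<^sup>2 \<le> S" for i
          proof -
            have "\<bar>z $ i\<bar> \<le> norm z" by (rule component_le_norm_cart)
            then have "\<bar>z $ i\<bar> \<le> sqrt S" using z by simp
            then show ?thesis using S by (metis real_sqrt_abs real_sqrt_le_iff)
          qed
          define h where "h = exp (- (1/2)) / sqrt (4 * pi * S)"
          have h: "0 \<le> h" using S by (simp add: h_def)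
          have "h ^ CARD('n) = h * (\<Prod>i\<in>UNIV - {k}. h)"
            by (simp add: card_Diff_singleton flip: power_Suc)
          also have "\<dots> \<le> hk t (z $ k) * tg k S (\<lambda>i. z $ i)"
            unfolding tg_def using t t0 S zi h hk_nonneg[of t] hk_ge[of t _ S] hk_ge[of S _ S]
            by (intro mult_mono prod_mono) (auto simp: h_def intro!: prod_nonneg hk_ge)
          finally have "2 * h ^ CARD('n) \<le> 2 * (hk t (z $ k) * tg k S (\<lambda>i. z $ i))" by simp
          then have "q * S powr (- N / 2) \<le> 2 * hk t (z $ k) * tg k S (\<lambda>i. z $ i)"
            unfolding h_def q2 by simp
          then show ?thesis using nn by (intro mult_right_mono)
        qed
        then show "ennreal (q * S powr (- N / 2)) * (ennreal (\<phi> z) * indicator (ball 0 (sqrt S)) z * indicator (closed_half_space k) z)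
           \<le> ennreal (2 * hk t (z $ k) * tg k S (\<lambda>i. z $ i) * \<phi> z) * indicator (closed_half_space k) z"
          using q nn by (auto simp: indicator_def ennreal_mult[symmetric] intro!: ennreal_leI)
      qed
      also have "\<dots> = (\<integral>\<^sup>+y. ennreal (tg k (S - t) y) * heat k \<phi> (boundary_point k y) t \<partial>tangential_measure k)"
        by (rule heat_boundary_conv_origin[symmetric]) (use nn t t0 in auto)
      also have "\<dots> \<le> (\<integral>\<^sup>+y. ennreal (tg k (S - t) y * v y t) \<partial>tangential_measure k)"
      proof (intro nn_integral_mono)
        fix y
        have "heat k \<phi> (boundary_point k y) t \<le> ennreal (v y t)"
          using v(3)[of t y] v(4)[of "boundary_point k y" t] t t0 S by simp
        then show "ennreal (tg k (S - t) y) * heat k \<phi> (boundary_point k y) t \<le> ennreal (tg k (S - t) y * v y t)"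
          using t by (subst ennreal_mult') (auto intro!: mult_left_mono tg_nonneg)
      qed
      finally show "ennreal m \<le> (\<integral>\<^sup>+y. ennreal (tg k (S - t) y * v y t) \<partial>tangential_measure k)" .
    qed auto
    then have "(m powr (p - 1) * sqrt S) powr (1 / (p - 1)) \<le> K powr (1 / (p - 1))"
      using p S by (intro powr_mono2) auto
    moreover have "(m powr (p - 1) * sqrt S) powr (1 / (p - 1)) = m * S powr (1 / (2 * (p - 1)))"
      using p m S by (simp add: powr_mult powr_powr powr_half_sqrt[symmetric])
    moreover have "m * S powr (1 / (2 * (p - 1))) = q * (\<mu> * S powr (1 / (2 * (p - 1)) - N / 2))"
      unfolding m_def by (simp add: powr_diff powr_minus_divide)
    ultimately show "\<mu> * S powr (1 / (2 * (p - 1)) - real CARD('n) / 2) \<le> K powr (1 / (p - 1)) / q"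
      using q by (simp add: N_def field_simps)
  qed
qed

text \<open>
  In the critical case a bound by \<open>m t\<^sup>-\<^sup>1\<^sup>/\<^sup>2\<close> times a Gaussian of width \<open>t\<close> reproduces itself with
  \<open>m\<close> replaced by \<open>m\<^sup>p\<close> times a logarithm, because the powers of \<open>s\<close> under the time integral
  add up to exactly \<open>1 / s\<close>.
\<close>

lemma boundary_lower_step:
  fixes k :: "'n::finite"
  assumes p: "p = 1 + 1 / real CARD('n)" and v: "jointly_measurable k v" "\<And>y s. 0 \<le> v y s"
    and eq: "\<And>y. duhamel k p v (boundary_point k y) t \<le> ennreal (v y t)"
    and m: "0 < m" and t: "0 < t0" "2 * t0 < t"
    and low: "\<And>y s. t0 \<le> s \<Longrightarrow> s < t \<Longrightarrow> m * s powr (-1/2) * tg k (s / 2) y \<le> v y s"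
  shows "((2 * pi) powr (- (p - 1) / 2) * p powr (-1/2)) ^ (CARD('n) - 1) * sqrt (1/2) ^ (CARD('n) - 1) / sqrt pi
      * m powr p * ln (t / (2 * t0)) * t powr (-1/2) * tg k (t / 2) x \<le> v x t"
proof -
  let ?m = "tangential_measure k"
  note [measurable] = jointly_measurable_comp[OF v(1)]
  define n where "n = CARD('n) - 1"
  define N where "N = real CARD('n)"
  have N: "1 \<le> N" and n: "real n = N - 1" unfolding N_def n_def by (auto simp: Suc_leI of_nat_diff)
  have p1: "1 < p" using N by (simp add: p N_def[symmetric])
  \<comment> \<open>\<open>C0\<close> collects the constants of \<open>tg_powr\<close> at time
    \<open>s / 2\<close>; \<open>c1\<close> also includes the loss from replacing the tangential
    time by \<open>t / 2\<close> and the factor \<open>1 / sqrt pi\<close> of the normal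
    kernel.\<close>
  define C0 where "C0 = ((2 * pi) powr (- (p - 1) / 2) * p powr (-1/2)) ^ n"
  define c1 where "c1 = C0 * sqrt (1/2) ^ n / sqrt pi"
  have C0: "0 < C0" using p1 by (simp add: C0_def)
  have c1: "0 < c1" using C0 by (simp add: c1_def)
  define G where "G = c1 * m powr p * t powr (-1/2) * tg k (t / 2) x"
  have G: "0 \<le> G" using c1 t by (simp add: G_def tg_nonneg)
  have pow: "(m * s powr (-1/2) * tg k (s / 2) y) powr p = m powr p * C0 * (1 / s) * tg k (s / 2 / p) y" if s: "0 < s" for s y
  proof -
    have "(4 * pi * (s / 2)) powr (- (p - 1) / 2) = (2 * pi) powr (- (p - 1) / 2) * s powr (- (p - 1) / 2)"
      using s powr_mult[of "2 * pi" s "- (p - 1) / 2"] by (simp add: mult.assoc)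
    then have "((4 * pi * (s / 2)) powr (- (p - 1) / 2) * p powr (-1/2)) ^ n = C0 * (s powr (- (p - 1) / 2)) ^ n"
      unfolding C0_def by (simp add: power_mult_distrib)
    also have "(s powr (- (p - 1) / 2)) ^ n = s powr (- (p - 1) / 2 * (N - 1))"
      using s by (simp add: powr_realpow[symmetric] powr_powr n)
    finally have A: "((4 * pi * (s / 2)) powr (- (p - 1) / 2) * p powr (-1/2)) ^ n = C0 * s powr (- (p - 1) / 2 * (N - 1))" .
    have B: "(s powr (-1/2)) powr p * s powr (- (p - 1) / 2 * (N - 1)) = 1 / s"
    proof -
      have "-1/2 * p + - (p - 1) / 2 * (N - 1) = -1" using N by (simp add: p N_def[symmetric] field_simps)
      then have "s powr (-1/2 * p) * s powr (- (p - 1) / 2 * (N - 1)) = s powr (-1)" by (metis powr_add)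
      moreover have "(s powr (-1/2)) powr p = s powr (-1/2 * p)" by (rule powr_powr)
      ultimately show ?thesis using s by (simp add: powr_minus_divide[of s 1])
    qed
    have "(m * s powr (-1/2) * tg k (s / 2) y) powr p = m powr p * (s powr (-1/2)) powr p * tg k (s / 2) y powr p"
      using s m by (simp add: powr_mult tg_nonneg)
    also have "tg k (s / 2) y powr p = C0 * s powr (- (p - 1) / 2 * (N - 1)) * tg k (s / 2 / p) y"
      using tg_powr[of "s / 2" p k y] s p1 A by (simp add: n_def)
    finally show ?thesis using B by (simp add: mult_ac)
  qed
  have inner: "ennreal (G * (1 / s)) \<le> ennreal (2 * hk (t - s) 0) *
     (\<integral>\<^sup>+y. ennreal (tg k (t - s) (\<lambda>i. x i - y i) * v y s powr p) \<partial>?m)" if s: "t0 < s" "s < t / 2" for s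
  proof -
    have s0: "0 < s" using s t by simp
    \<comment> \<open>The time of the Gaussian obtained by convolving \<open>tg k (t - s)\<close>
      with the powered bound, which lives at time \<open>s / 2 / p\<close>. For
      \<open>s < t / 2\<close> it lies between \<open>t / 2\<close> and \<open>t\<close>, so it can
      be compared with the target width.\<close>
    define \<tau> where "\<tau> = t - s + s / 2 / p"
    have tau: "t / 2 \<le> \<tau>" "\<tau> \<le> t" "0 < \<tau>"
    proof -
      have "s / 2 / p \<le> s / 2" using s0 p1 by (simp add: field_simps)
      moreover have "0 < s / 2 / p" using s0 p1 by simp
      ultimately show "t / 2 \<le> \<tau>" "\<tau> \<le> t" "0 < \<tau>" unfolding \<tau>_def using s s0 by linarith+
    qed
    have "sqrt (1/2) ^ n * tg k (t / 2) x \<le> sqrt ((t / 2) / \<tau>) ^ n * tg k (t / 2) x"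
      using tau t s0 by (intro mult_right_mono power_mono tg_nonneg) (auto simp: field_simps)
    also have "\<dots> \<le> tg k \<tau> x"
      unfolding n_def using tau s s0 by (intro tg_time_mono) auto
    finally have T: "sqrt (1/2) ^ n * tg k (t / 2) x \<le> tg k \<tau> x" .
    have H: "t powr (-1/2) / sqrt pi \<le> 2 * hk (t - s) 0"
    proof -
      have "2 * hk (t - s) 0 = 1 / sqrt (pi * (t - s))"
        unfolding hk_0 by (simp add: real_sqrt_mult)
      moreover have "1 / sqrt (pi * t) \<le> 1 / sqrt (pi * (t - s))" using s s0 by (intro frac_le) auto
      moreover have "t powr (-1/2) = 1 / sqrt t" using t powr_minus_divide[of t "1/2"] by (simp add: powr_half_sqrt)
      ultimately show ?thesis by (simp add: real_sqrt_mult mult.commute)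
    qed
    have "G * (1 / s) = (t powr (-1/2) / sqrt pi) * (m powr p * C0 * (1 / s) * (sqrt (1/2) ^ n * tg k (t / 2) x))"
      unfolding G_def c1_def by simp
    also have "\<dots> \<le> 2 * hk (t - s) 0 * (m powr p * C0 * (1 / s) * tg k \<tau> x)"
    proof (rule mult_mono[OF H])
      show "m powr p * C0 * (1 / s) * (sqrt (1/2) ^ n * tg k (t / 2) x) \<le> m powr p * C0 * (1 / s) * tg k \<tau> x"
        using C0 s0 by (intro mult_left_mono T) auto
      show "0 \<le> 2 * hk (t - s) 0" using s s0 by (simp add: hk_nonneg)
      show "0 \<le> m powr p * C0 * (1 / s) * (sqrt (1/2) ^ n * tg k (t / 2) x)"
        using C0 s0 t tg_nonneg[of "t / 2" k x] by (intro mult_nonneg_nonneg) auto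
    qed
    finally have "ennreal (G * (1 / s)) \<le> ennreal (2 * hk (t - s) 0) * (ennreal (m powr p * C0 * (1 / s)) * ennreal (tg k \<tau> x))"
    proof -
      assume le: "G * (1 / s) \<le> 2 * hk (t - s) 0 * (m powr p * C0 * (1 / s) * tg k \<tau> x)"
      have "ennreal (2 * hk (t - s) 0 * (m powr p * C0 * (1 / s) * tg k \<tau> x)) = ennreal (2 * hk (t - s) 0) * (ennreal (m powr p * C0 * (1 / s)) * ennreal (tg k \<tau> x))"
        using s s0 C0 tau tg_nonneg[of \<tau> k x] hk_nonneg[of "t - s" 0]
        by (subst ennreal_mult, simp, simp, subst ennreal_mult, simp_all)
      then show ?thesis using ennreal_leI[OF le] by simp
    qed
    also have "ennreal (tg k \<tau> x) = (\<integral>\<^sup>+y. ennreal (tg k (t - s) (\<lambda>i. x i - y i) * tg k (s / 2 / p) y) \<partial>?m)"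
    proof -
      have "(\<integral>\<^sup>+w. ennreal (tg k (t - s) (\<lambda>i. x i - w i) * tg k (s / 2 / p) (\<lambda>i. w i - 0)) \<partial>?m)
        = ennreal (tg k (t - s + s / 2 / p) (\<lambda>i. x i - 0))"
        using s s0 p1 by (intro tg_conv) auto
      then show ?thesis by (simp add: \<tau>_def)
    qed
    also have "ennreal (m powr p * C0 * (1 / s)) * \<dots> = (\<integral>\<^sup>+y. ennreal (m powr p * C0 * (1 / s)) * ennreal (tg k (t - s) (\<lambda>i. x i - y i) * tg k (s / 2 / p) y) \<partial>?m)"
      by (rule nn_integral_cmult[symmetric]) measurable
    also have "\<dots> \<le> (\<integral>\<^sup>+y. ennreal (tg k (t - s) (\<lambda>i. x i - y i) * v y s powr p) \<partial>?m)"
    proof (intro nn_integral_mono)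
      fix y
      have "(m * s powr (-1/2) * tg k (s / 2) y) powr p \<le> v y s powr p"
        using s s0 p1 m low[of s y] by (intro powr_mono2) (auto intro!: mult_nonneg_nonneg tg_nonneg)
      then have "tg k (t - s) (\<lambda>i. x i - y i) * (m powr p * C0 * (1 / s) * tg k (s / 2 / p) y) \<le> tg k (t - s) (\<lambda>i. x i - y i) * v y s powr p"
        unfolding pow[OF s0] using s s0 by (intro mult_left_mono tg_nonneg) auto
      then show "ennreal (m powr p * C0 * (1 / s)) * ennreal (tg k (t - s) (\<lambda>i. x i - y i) * tg k (s / 2 / p) y)
         \<le> ennreal (tg k (t - s) (\<lambda>i. x i - y i) * v y s powr p)"
        using C0 s0 by (subst ennreal_mult'[symmetric]) (auto intro!: ennreal_leI simp: mult_ac)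
    qed
    finally show ?thesis by (simp add: mult_left_mono)
  qed
  have e: "tg k a (\<lambda>i. boundary_point k x $ i - y i) = tg k a (\<lambda>i. x i - y i)" for a y
    unfolding tg_def by (auto intro!: prod.cong simp: boundary_point_def)
  have "ennreal (G * ln (t / (2 * t0))) = (\<integral>\<^sup>+s\<in>{t0<..<t/2}. ennreal (G * (1 / s)) \<partial>lborel)"
  proof -
    have "(\<integral>\<^sup>+s\<in>{t0<..<t/2}. ennreal (G * (1 / s)) \<partial>lborel) = ennreal (G * ln (t / 2) - G * ln t0)"
      using t G by (intro nn_integral_FTC_interior) (auto intro!: derivative_eq_intros continuous_intros)
    also have "G * ln (t / 2) - G * ln t0 = G * ln (t / (2 * t0))"
      using t by (simp add: ln_div ln_mult algebra_simps)
    finally show ?thesis by simp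
  qed
  also have "\<dots> \<le> duhamel k p v (boundary_point k x) t"
    unfolding duhamel_def e
  proof (intro nn_integral_mono)
    fix s :: real
    show "ennreal (G * (1 / s)) * indicator {t0<..<t/2} s \<le> ennreal (2 * hk (t - s) (boundary_point k x $ k)) *
        (\<integral>\<^sup>+ y'. ennreal (tg k (t - s) (\<lambda>i. x i - y' i) * v y' s powr p) \<partial>?m) * indicator {0<..<t} s"
      using inner[of s] t by (auto simp: indicator_def boundary_point_def)
  qed
  also have "\<dots> \<le> ennreal (v x t)" by (rule eq)
  finally have "G * ln (t / (2 * t0)) \<le> v x t" using v(2) by simp
  then show ?thesis unfolding G_def c1_def C0_def n_def by (simp add: mult_ac)
qed

text \<open>By \<open>(x - z)\<^sup>2 \<le> 2 * x\<^sup>2 + 2 * z\<^sup>2\<close>, a shift within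
  the diffusion length costs a constant factor and half the time.\<close>

lemma hk_shift_ge:
  assumes "0 < t" "z\<^sup>2 \<le> t"
  shows "exp (- (1/2)) * sqrt (1/2) * hk (t / 2) x \<le> hk t (x - z)"
proof -
  have "(x - z)\<^sup>2 + (x + z)\<^sup>2 = 2 * x\<^sup>2 + 2 * z\<^sup>2" by (simp add: power2_eq_square algebra_simps)
  then have "(x - z)\<^sup>2 \<le> 2 * x\<^sup>2 + 2 * z\<^sup>2" using zero_le_power2[of "x + z"] by linarith
  also have "\<dots> \<le> 2 * x\<^sup>2 + 2 * t" using assms by simp
  finally have "(x - z)\<^sup>2 / (4 * t) \<le> (2 * x\<^sup>2 + 2 * t) / (4 * t)" using assms by (intro divide_right_mono) auto
  also have "\<dots> = 1 / 2 + x\<^sup>2 / (4 * (t / 2))" using assms by (simp add: field_simps)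
  finally have "exp (- (1/2)) * exp (- x\<^sup>2 / (4 * (t / 2))) \<le> exp (- (x - z)\<^sup>2 / (4 * t))"
    by (simp flip: exp_add)
  then have "exp (- (1/2)) * exp (- x\<^sup>2 / (4 * (t / 2))) / sqrt (4 * pi * t) \<le> hk t (x - z)"
    unfolding hk_def by (rule divide_right_mono) (use assms in simp)
  moreover have "sqrt (1/2) / sqrt (4 * pi * (t / 2)) = 1 / sqrt (4 * pi * t)"
    using assms by (simp add: real_sqrt_mult real_sqrt_divide)
  moreover have "exp (- (1/2)) * sqrt (1/2) * hk (t / 2) x
     = exp (- (1/2)) * exp (- x\<^sup>2 / (4 * (t / 2))) * (sqrt (1/2) / sqrt (4 * pi * (t / 2)))"
    unfolding hk_def by (simp only: times_divide_eq_right mult_ac)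
  ultimately show ?thesis by simp
qed

text \<open>Seen after time \<open>\<sigma>\<^sup>2\<close>, the mass within \<open>\<sigma>\<close>
  acts like a point mass at the origin. The resulting shape
  \<open>t powr (-1/2) * tg k (t / 2) x\<close> is the one that \<open>boundary_lower_step\<close>
  reproduces, so this starts the iteration.\<close>

lemma heat_boundary_lower:
  fixes k :: "'n::finite"
  assumes [measurable]: "\<phi> \<in> borel_measurable borel" and nn: "\<And>z. 0 \<le> \<phi> z" and s: "0 < \<sigma>" "\<sigma>\<^sup>2 \<le> t" and mu: "0 \<le> \<mu>"
    and mass: "ennreal \<mu> \<le> (\<integral>\<^sup>+z\<in>closed_half_space k. ennreal (\<phi> z) * indicator (ball 0 \<sigma>) z \<partial>lborel)"
  shows "ennreal (2 * (exp (- (1/2)) / sqrt (4 * pi)) * (exp (- (1/2)) * sqrt (1/2)) ^ (CARD('n) - 1) * \<mu> * t powr (-1/2) * tg k (t / 2) x)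
     \<le> heat k \<phi> (boundary_point k x) t"
proof -
  define d where "d = exp (- (1/2)) * sqrt (1/2 :: real)"
  have t: "0 < t" using s zero_less_power[of \<sigma> 2] by linarith
  define G where "G = 2 * (exp (- (1/2)) / sqrt (4 * pi)) * d ^ (CARD('n) - 1) * t powr (-1/2) * tg k (t / 2) x"
  have G: "0 \<le> G" unfolding G_def d_def using t by (intro mult_nonneg_nonneg divide_nonneg_nonneg tg_nonneg zero_le_power) auto
  have "ennreal (G * \<mu>) = ennreal G * ennreal \<mu>" using G mu by (simp add: ennreal_mult)
  also have "\<dots> \<le> ennreal G * (\<integral>\<^sup>+z\<in>closed_half_space k. ennreal (\<phi> z) * indicator (ball 0 \<sigma>) z \<partial>lborel)"
    by (intro mult_left_mono mass) simp
  also have "\<dots> = (\<integral>\<^sup>+z. ennreal G * (ennreal (\<phi> z) * indicator (ball 0 \<sigma>) z * indicator (closed_half_space k) z) \<partial>lborel)"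
    by (rule nn_integral_cmult[symmetric]) measurable
  also have "\<dots> \<le> heat k \<phi> (boundary_point k x) t"
    unfolding heat_def
  proof (intro nn_integral_mono)
    fix z :: "real^'n"
    have "G * \<phi> z \<le> green k (boundary_point k x) z t * \<phi> z" if z: "norm z < \<sigma>"
    proof -
      have zi: "(z $ i)\<^sup>2 \<le> t" for i
      proof -
        have "\<bar>z $ i\<bar> \<le> norm z" by (rule component_le_norm_cart)
        then have "\<bar>z $ i\<bar>\<^sup>2 \<le> \<sigma>\<^sup>2" using z by (intro power_mono) auto
        then show ?thesis using s by simp
      qed
      have 1: "exp (- (1/2)) / sqrt (4 * pi) * t powr (-1/2) \<le> hk t (z $ k)"
      proof -
        have "t powr (-1/2) = 1 / sqrt t" using t powr_minus_divide[of t "1/2"] by (simp add: powr_half_sqrt)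
        then show ?thesis using hk_ge[OF t zi[of k]] t by (simp add: real_sqrt_mult mult.commute)
      qed
      have "d ^ (CARD('n) - 1) * tg k (t / 2) x = (\<Prod>i\<in>UNIV - {k}. d * hk (t / 2) (x i))"
        unfolding tg_def by (simp add: prod.distrib card_Diff_singleton)
      also have "\<dots> \<le> tg k t (\<lambda>i. x i - z $ i)"
        unfolding tg_def d_def using t zi by (intro prod_mono conjI hk_shift_ge) (auto intro!: mult_nonneg_nonneg hk_nonneg)
      finally have 2: "d ^ (CARD('n) - 1) * tg k (t / 2) x \<le> tg k t (\<lambda>i. x i - z $ i)" .
      have "G = 2 * ((exp (- (1/2)) / sqrt (4 * pi) * t powr (-1/2)) * (d ^ (CARD('n) - 1) * tg k (t / 2) x))"
        unfolding G_def by (simp only: mult_ac)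
      also have "\<dots> \<le> 2 * (hk t (z $ k) * tg k t (\<lambda>i. x i - z $ i))"
        using t by (intro mult_left_mono mult_mono 1 2) (auto intro!: mult_nonneg_nonneg hk_nonneg tg_nonneg simp: d_def)
      also have "\<dots> = green k (boundary_point k x) z t" using t by (simp add: green_boundary_point)
      finally show ?thesis using nn by (intro mult_right_mono)
    qed
    then show "ennreal G * (ennreal (\<phi> z) * indicator (ball 0 \<sigma>) z * indicator (closed_half_space k) z)
      \<le> ennreal (green k (boundary_point k x) z t * \<phi> z) * indicator (closed_half_space k) z"
      using G nn by (auto simp: indicator_def ennreal_mult[symmetric] intro!: ennreal_leI)
  qed
  finally show ?thesis unfolding G_def d_def by (simp add: mult_ac)
qed

text \<open>For this exponent \<open>p - 1 = 1 / N\<close>, and the powers of \<open>S\<close> in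
  \<open>flux_functional_bound\<close> cancel. The cap on the coefficient is therefore independent
  of \<open>T\<close>.\<close>

lemma critical_cap:
  fixes k :: "'n::finite"
  assumes p: "p = 1 + 1 / real CARD('n)"
  obtains K where "0 < K" "\<And>v u \<phi> T t0 m. jointly_measurable k v \<Longrightarrow> (\<And>y s. 0 \<le> v y s) \<Longrightarrow>
    (\<And>x t. x \<in> closed_half_space k \<Longrightarrow> 0 < t \<Longrightarrow> t < T \<Longrightarrow> ennreal (u x t) = heat k \<phi> x t + duhamel k p v x t) \<Longrightarrow>
    (\<And>y s. 0 < s \<Longrightarrow> s < T \<Longrightarrow> v y s = u (boundary_point k y) s) \<Longrightarrow>
    0 < t0 \<Longrightarrow> t0 \<le> T / 4 \<Longrightarrow> 0 < m \<Longrightarrow>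
    (\<And>y s. t0 \<le> s \<Longrightarrow> s < T \<Longrightarrow> m * s powr (-1/2) * tg k (s / 2) y \<le> v y s) \<Longrightarrow> m \<le> K"
proof -
  define n where "n = CARD('n) - 1"
  define N where "N = real CARD('n)"
  have N: "1 \<le> N" and n: "real n = N - 1" unfolding N_def n_def by (auto simp: Suc_leI of_nat_diff)
  have p1: "1 < p" using N by (simp add: p N_def[symmetric])
  define c3 where "c3 = (1 / sqrt (4 * pi)) ^ n"
  have c3: "0 < c3" by (simp add: c3_def)
  define K where "K = 2 * sqrt pi * (4 / (1 - 2 powr (1 - p)))"
  have K: "0 < K" unfolding K_def using p1 by (auto simp: powr_less_one)
  show ?thesis
  proof (rule that[of "K powr N / c3"])
    show "0 < K powr N / c3" using K c3 by simp
    fix v u \<phi> T t0 m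
    assume v: "jointly_measurable k v" "\<And>y s. 0 \<le> v y s"
      and eq: "\<And>x t. x \<in> closed_half_space k \<Longrightarrow> 0 < t \<Longrightarrow> t < T \<Longrightarrow> ennreal (u x t) = heat k \<phi> x t + duhamel k p v x t"
      and vu: "\<And>y s. 0 < s \<Longrightarrow> s < T \<Longrightarrow> v y s = u (boundary_point k y) s"
      and t0: "0 < t0" "t0 \<le> T / 4" and m: "0 < m"
      and low: "\<And>y s. t0 \<le> s \<Longrightarrow> s < T \<Longrightarrow> m * s powr (-1/2) * tg k (s / 2) y \<le> v y s"
    let ?m = "tangential_measure k"
    note [measurable] = jointly_measurable_comp[OF v(1)]
    \<comment> \<open>Then \<open>t0 \<le> S / 2\<close>, so the assumed lower bound is available on
      the whole interval from \<open>S / 2\<close> to \<open>S\<close>.\<close>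
    define S where "S = T / 2"
    have S: "0 < S" "S < T" using t0 by (auto simp: S_def)
    define m' where "m' = m * c3 * S powr (- N / 2)"
    have m': "0 < m'" using m c3 S by (simp add: m'_def)
    have "m' powr (p - 1) * sqrt S \<le> K"
      unfolding K_def
    proof (rule flux_functional_bound[OF p1 v S m' eq vu])
      fix t assume t: "S / 2 \<le> t" "t < S"
      have tt: "t0 \<le> t" "t < T" "0 < t" using t t0 S by (auto simp: S_def)
      have "m' \<le> m * t powr (-1/2) * tg k (S - t / 2) (\<lambda>i. 0)"
      proof -
        have 1: "S powr (-1/2) \<le> t powr (-1/2)" using tt t by (intro powr_mono2') auto
        have 2: "(1 / sqrt (4 * pi * S)) ^ n \<le> (1 / sqrt (4 * pi * (S - t / 2))) ^ n"
          using tt t by (intro power_mono frac_le) auto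
        have 3: "(1 / sqrt (4 * pi * S)) ^ n = c3 * S powr (- (N - 1) / 2)"
        proof -
          have "sqrt S ^ n = S powr ((N - 1) / 2)"
            using S powr_powr[of S "1/2" "real n"] powr_realpow[of "sqrt S" n] by (simp add: powr_half_sqrt n)
          moreover have "S powr (- (N - 1) / 2) = 1 / S powr ((N - 1) / 2)" using powr_minus_divide[of S "(N - 1) / 2"] by (simp only: minus_divide_left)
          ultimately show ?thesis unfolding c3_def by (simp add: real_sqrt_mult power_mult_distrib power_divide)
        qed
        have 4: "S powr (- N / 2) = S powr (- (N - 1) / 2) * S powr (-1/2)"
          by (simp flip: powr_add add: field_simps)
        have "m' = m * S powr (-1/2) * (1 / sqrt (4 * pi * S)) ^ n"
          unfolding m'_def 3 4 by (simp only: mult_ac)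
        also have "\<dots> \<le> m * t powr (-1/2) * (1 / sqrt (4 * pi * (S - t / 2))) ^ n"
          using m 1 2 S by (intro mult_mono mult_left_mono) auto
        finally show ?thesis by (simp add: tg_0 n_def)
      qed
      then have "ennreal m' \<le> ennreal (m * t powr (-1/2)) * ennreal (tg k (S - t / 2) (\<lambda>i. 0))"
        using m tt t by (subst ennreal_mult[symmetric]) (auto intro!: ennreal_leI tg_nonneg)
      also have "ennreal (tg k (S - t / 2) (\<lambda>i. 0)) = (\<integral>\<^sup>+y. ennreal (tg k (S - t) y * tg k (t / 2) y) \<partial>?m)"
      proof -
        have "(\<integral>\<^sup>+w. ennreal (tg k (S - t) (\<lambda>i. 0 - w i) * tg k (t / 2) (\<lambda>i. w i - 0)) \<partial>?m)
          = ennreal (tg k (S - t + t / 2) (\<lambda>i. 0 - 0))"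
          using t tt by (intro tg_conv) auto
        then show ?thesis unfolding tg_zero_diff by (simp add: algebra_simps)
      qed
      also have "ennreal (m * t powr (-1/2)) * \<dots> = (\<integral>\<^sup>+y. ennreal (m * t powr (-1/2)) * ennreal (tg k (S - t) y * tg k (t / 2) y) \<partial>?m)"
        by (rule nn_integral_cmult[symmetric]) measurable
      also have "\<dots> \<le> (\<integral>\<^sup>+y. ennreal (tg k (S - t) y * v y t) \<partial>?m)"
      proof (intro nn_integral_mono)
        fix y
        have "tg k (S - t) y * (m * t powr (-1/2) * tg k (t / 2) y) \<le> tg k (S - t) y * v y t"
          using t tt by (intro mult_left_mono low tg_nonneg) auto
        then show "ennreal (m * t powr (-1/2)) * ennreal (tg k (S - t) y * tg k (t / 2) y) \<le> ennreal (tg k (S - t) y * v y t)"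
          using m by (subst ennreal_mult'[symmetric]) (auto intro!: ennreal_leI simp: mult_ac)
      qed
      finally show "ennreal m' \<le> (\<integral>\<^sup>+y. ennreal (tg k (S - t) y * v y t) \<partial>?m)" .
    qed
    then have "(m' powr (p - 1) * sqrt S) powr N \<le> K powr N"
      using N S by (intro powr_mono2) auto
    moreover have "(m' powr (p - 1) * sqrt S) powr N = m' * S powr (N / 2)"
      using N m' S by (simp add: powr_mult powr_powr powr_half_sqrt[symmetric] p N_def[symmetric])
    moreover have "m' * S powr (N / 2) = m * c3"
      unfolding m'_def using S by (simp flip: powr_add)
    ultimately show "m \<le> K powr N / c3" using c3 by (simp add: field_simps)
  qed
qed

text \<open>Each use of \<open>boundary_lower_step\<close> doubles the coefficient at the cost of a
  longer wait, and \<open>critical_cap\<close> forbids exceeding \<open>K\<close> before time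
  \<open>T / 4\<close>. Comparing the total wait with \<open>T\<close> bounds
  \<open>ln (T / \<sigma>\<^sup>2)\<close> by a multiple of \<open>m0 powr (1 - p)\<close>, that is,
  of \<open>m0\<close> to the power \<open>- 1 / N\<close>.\<close>

lemma mass_bound_critical:
  fixes k :: "'n::finite" and p :: real
  assumes p: "p = 1 + 1 / real CARD('n)"
  obtains C where "0 < C" "\<And>\<phi> T u \<sigma> \<mu>. is_solution k p \<phi> T u \<Longrightarrow> \<phi> \<in> borel_measurable borel \<Longrightarrow> (\<And>z. 0 \<le> \<phi> z) \<Longrightarrow>
    0 < \<sigma> \<Longrightarrow> \<sigma>\<^sup>2 \<le> T / 8 \<Longrightarrow> 0 < \<mu> \<Longrightarrow>
    ennreal \<mu> \<le> (\<integral>\<^sup>+z\<in>closed_half_space k. ennreal (\<phi> z) * indicator (ball 0 \<sigma>) z \<partial>lborel) \<Longrightarrow>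
    \<mu> * ln (T / \<sigma>\<^sup>2) powr real CARD('n) \<le> C"
proof -
  define n where "n = CARD('n) - 1"
  define N where "N = real CARD('n)"
  have N: "1 \<le> N" unfolding N_def by (auto simp: Suc_leI)
  have p1: "1 < p" using N by (simp add: p N_def[symmetric])
  have pN: "1 - p = - (1 / N)" by (simp add: p N_def)
  show ?thesis
  proof (rule critical_cap[OF p, of k])
    fix K :: real
    assume K: "0 < K" "\<And>v u \<phi> T t0 m. jointly_measurable k v \<Longrightarrow> (\<And>y s. 0 \<le> v y s) \<Longrightarrow>
      (\<And>x t. x \<in> closed_half_space k \<Longrightarrow> 0 < t \<Longrightarrow> t < T \<Longrightarrow> ennreal (u x t) = heat k \<phi> x t + duhamel k p v x t) \<Longrightarrow>
      (\<And>y s. 0 < s \<Longrightarrow> s < T \<Longrightarrow> v y s = u (boundary_point k y) s) \<Longrightarrow>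
      0 < t0 \<Longrightarrow> t0 \<le> T / 4 \<Longrightarrow> 0 < m \<Longrightarrow>
      (\<And>y s. t0 \<le> s \<Longrightarrow> s < T \<Longrightarrow> m * s powr (-1/2) * tg k (s / 2) y \<le> v y s) \<Longrightarrow> m \<le> K"
    define c1 where "c1 = ((2 * pi) powr (- (p - 1) / 2) * p powr (-1/2)) ^ (CARD('n) - 1) * sqrt (1/2) ^ (CARD('n) - 1) / sqrt pi"
    have c1: "0 < c1" using p1 by (simp add: c1_def)
    define c2 where "c2 = 2 * (exp (- (1/2)) / sqrt (4 * pi)) * (exp (- (1/2)) * sqrt (1/2)) ^ (CARD('n) - 1)"
    have c2: "0 < c2" by (simp add: c2_def)
    define q where "q = 2 powr (1 - p)"
    have q: "0 < q" "q < 1" unfolding q_def using p1 by (auto simp: powr_less_one)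
    \<comment> \<open>The sum of the geometric series of waiting exponents, without the factor
      \<open>m0 powr (1 - p)\<close>.\<close>
    define e where "e = 2 / (c1 * (1 - q))"
    have e: "0 < e" using c1 q by (simp add: e_def)
    define C5 where "C5 = N * (8 * K) powr (1 / N) + e"
    have C5: "0 < C5" using N K e by (simp add: C5_def add_pos_pos)
    show ?thesis
    proof (rule that[of "C5 powr N / c2"])
      show "0 < C5 powr N / c2" using C5 c2 by simp
      fix \<phi> T u \<sigma> \<mu>
      assume sol: "is_solution k p \<phi> T u" and phi: "\<phi> \<in> borel_measurable borel" and nn: "\<And>z. 0 \<le> \<phi> z"
        and s: "0 < \<sigma>" "\<sigma>\<^sup>2 \<le> T / 8" and mu: "0 < \<mu>"
        and mass: "ennreal \<mu> \<le> (\<integral>\<^sup>+z\<in>closed_half_space k. ennreal (\<phi> z) * indicator (ball 0 \<sigma>) z \<partial>lborel)"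
      have s2: "0 < \<sigma>\<^sup>2" using s by simp
      then have T: "0 < T" using s by linarith
      obtain v where v: "jointly_measurable k v" "\<And>y s. 0 \<le> v y s" "\<And>y s. 0 < s \<Longrightarrow> s < T \<Longrightarrow> v y s = u (boundary_point k y) s"
        "\<And>x t. x \<in> closed_half_space k \<Longrightarrow> 0 < t \<Longrightarrow> t < T \<Longrightarrow> ennreal (u x t) = heat k \<phi> x t + duhamel k p v x t"
        using solution_boundary[OF sol] by metis
      have heat_v: "heat k \<phi> (boundary_point k y) t \<le> ennreal (v y t)" and duh_v: "duhamel k p v (boundary_point k y) t \<le> ennreal (v y t)"
        if "0 < t" "t < T" for y t
        using v(3)[OF that, of y] v(4)[OF boundary_point_mem that, of y] by (simp_all add: add_increasing add_increasing2)
      define m0 where "m0 = c2 * \<mu>"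
      have m0: "0 < m0" using c2 mu by (simp add: m0_def)
      \<comment> \<open>From time \<open>t j\<close> on the coefficient is at least
        \<open>2 ^ j * m0\<close>. In each step the factor \<open>2\<close> is needed because
        \<open>boundary_lower_step\<close> integrates only up to half of the time, and the
        exponential supplies the logarithm \<open>2 / c1 * (2 ^ i * m0) powr (1 - p)\<close> that
        yields the next doubling.\<close>
      define t where "t j = \<sigma>\<^sup>2 * 2 ^ j * exp (2 / c1 * (\<Sum>i<j. m0 powr (1 - p) * q ^ i))" for j :: nat
      have tpos: "0 < t j" for j using s2 by (simp add: t_def)
      have low: "2 ^ j * m0 * r powr (-1/2) * tg k (r / 2) y \<le> v y r" if "t j \<le> r" "r < T" for j r y
        using that
      proof (induction j arbitrary: r y)
        case 0
        have "\<sigma>\<^sup>2 \<le> r" using 0 by (simp add: t_def)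
        then have r: "0 < r" "\<sigma>\<^sup>2 \<le> r" using s2 by linarith+
        have "ennreal (c2 * \<mu> * r powr (-1/2) * tg k (r / 2) y) \<le> heat k \<phi> (boundary_point k y) r"
          unfolding c2_def using phi nn s(1) r mu mass by (intro heat_boundary_lower) auto
        also have "\<dots> \<le> ennreal (v y r)" using 0 r by (intro heat_v) auto
        finally show ?case using v(2) by (simp add: m0_def)
      next
        case (Suc j)
        define m where "m = 2 ^ j * m0"
        have m: "0 < m" using m0 by (simp add: m_def)
        have mq: "m powr (1 - p) = m0 powr (1 - p) * q ^ j"
          using m0 by (simp add: m_def powr_mult q_def powr_realpow[symmetric] powr_powr mult.commute)
        have tS: "t (Suc j) = 2 * t j * exp (2 / c1 * m powr (1 - p))"
          unfolding t_def mq by (simp add: exp_add distrib_left)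
        have gt1: "1 < exp (2 / c1 * m powr (1 - p))" using c1 m by simp
        have "2 * t j * 1 < 2 * t j * exp (2 / c1 * m powr (1 - p))"
          using tpos[of j] gt1 by (intro mult_strict_left_mono) auto
        then have r: "2 * t j < r" using Suc.prems tS by simp
        have r0: "0 < r" using r tpos[of j] by simp
        have "c1 * m powr p * ln (r / (2 * t j)) * r powr (-1/2) * tg k (r / 2) y \<le> v y r"
          unfolding c1_def
        proof (rule boundary_lower_step[OF p v(1,2) _ m tpos r])
          show "duhamel k p v (boundary_point k y) r \<le> ennreal (v y r)" for y
            using Suc.prems r0 by (intro duh_v)
          show "m * s powr (-1/2) * tg k (s / 2) y \<le> v y s" if "t j \<le> s" "s < r" for y s
            unfolding m_def using Suc.IH[of s y] that Suc.prems by simp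
        qed
        moreover have "2 * m \<le> c1 * m powr p * ln (r / (2 * t j))"
        proof -
          have "exp (2 / c1 * m powr (1 - p)) \<le> r / (2 * t j)"
            using Suc.prems tS tpos[of j] by (simp add: field_simps)
          then have "2 / c1 * m powr (1 - p) \<le> ln (r / (2 * t j))"
            using r0 tpos[of j] by (subst ln_ge_iff) auto
          then have "c1 * m powr p * (2 / c1 * m powr (1 - p)) \<le> c1 * m powr p * ln (r / (2 * t j))"
            using c1 by (intro mult_left_mono) auto
          moreover have "c1 * m powr p * (2 / c1 * m powr (1 - p)) = 2 * m"
          proof -
            have "m powr p * m powr (1 - p) = m" using m by (simp flip: powr_add)
            then show ?thesis using c1 by (simp add: mult.commute mult.left_commute)
          qed
          ultimately show ?thesis by simp
        qed
        then have "2 * m * (r powr (-1/2) * tg k (r / 2) y) \<le> c1 * m powr p * ln (r / (2 * t j)) * (r powr (-1/2) * tg k (r / 2) y)"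
          using r0 by (intro mult_right_mono mult_nonneg_nonneg tg_nonneg) auto
        ultimately show ?case by (simp add: m_def mult_ac)
      qed
      have capj: "2 ^ j * m0 \<le> K" if "t j \<le> T / 4" for j
      proof (rule K(2)[OF v(1,2) v(4) v(3) tpos[of j] that])
        show "2 ^ j * m0 * s powr (-1/2) * tg k (s / 2) y \<le> v y s" if "t j \<le> s" "s < T" for y s
          using low that by blast
      qed (use m0 in auto)
      have m0K: "m0 \<le> K"
      proof -
        have "\<sigma>\<^sup>2 \<le> T / 4" using s T by linarith
        then show ?thesis using capj[of 0] by (simp add: t_def)
      qed
      have ex: "\<exists>j. K < 2 ^ j * m0"
        using real_arch_pow[of 2 "K / m0"] m0 by (auto simp: field_simps)
      \<comment> \<open>The first stage at which the coefficient passes the cap. The time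
        \<open>t J\<close> then lies beyond \<open>T / 4\<close>, while minimality of
        \<open>J\<close> bounds \<open>2 ^ J\<close>.\<close>
      define J where "J = (LEAST j. K < 2 ^ j * m0)"
      have J: "K < 2 ^ J * m0" unfolding J_def by (rule LeastI_ex[OF ex])
      have "J \<noteq> 0" using J m0K by (intro notI) simp
      then obtain i where i: "J = Suc i" by (cases J) auto
      have "\<not> K < 2 ^ i * m0" using not_less_Least[of i "\<lambda>j. K < 2 ^ j * m0"] i unfolding J_def by simp
      then have J2: "2 ^ J \<le> 2 * K / m0" using m0 i by (simp add: field_simps)
      have "\<not> t J \<le> T / 4" using capj[of J] J by auto
      then have "T / 4 < t J" by simp
      also have "\<dots> \<le> \<sigma>\<^sup>2 * (2 * K / m0) * exp (e * m0 powr (1 - p))"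
        unfolding t_def
      proof (intro mult_mono mult_left_mono J2)
        have "(\<Sum>i<J. m0 powr (1 - p) * q ^ i) = m0 powr (1 - p) * (\<Sum>i<J. q ^ i)" by (simp add: sum_distrib_left)
        also have "(\<Sum>i<J. q ^ i) \<le> 1 / (1 - q)" using q by (simp add: sum_gp_strict divide_right_mono)
        then have "m0 powr (1 - p) * (\<Sum>i<J. q ^ i) \<le> m0 powr (1 - p) * (1 / (1 - q))" by (intro mult_left_mono) auto
        finally have "2 / c1 * (\<Sum>i<J. m0 powr (1 - p) * q ^ i) \<le> 2 / c1 * (m0 powr (1 - p) * (1 / (1 - q)))"
          using c1 by (intro mult_left_mono) auto
        then show "exp (2 / c1 * (\<Sum>i<J. m0 powr (1 - p) * q ^ i)) \<le> exp (e * m0 powr (1 - p))"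
          unfolding e_def by (simp add: mult_ac)
      qed (use m0 K in auto)
      finally have "T / \<sigma>\<^sup>2 < 8 * K / m0 * exp (e * m0 powr (1 - p))"
        using s2 by (simp add: field_simps)
      then have "ln (T / \<sigma>\<^sup>2) < ln (8 * K / m0 * exp (e * m0 powr (1 - p)))"
        using T s2 m0 K by (subst ln_less_cancel_iff) auto
      also have "\<dots> = ln (8 * K / m0) + e * m0 powr (1 - p)"
        using m0 K by (subst ln_mult_pos) auto
      \<comment> \<open>The exponent \<open>1 / N\<close> makes this term of the same order in
        \<open>m0\<close> as the main term \<open>e * m0 powr (1 - p)\<close>.\<close>
      also have "ln (8 * K / m0) \<le> (8 * K / m0) powr (1 / N) / (1 / N)"
        using m0 m0K N by (intro ln_powr_bound) (auto simp: field_simps)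
      also have "(8 * K / m0) powr (1 / N) / (1 / N) = N * (8 * K) powr (1 / N) * m0 powr (1 - p)"
        unfolding pN using m0 K by (simp add: powr_divide powr_minus_divide)
      finally have "ln (T / \<sigma>\<^sup>2) \<le> C5 * m0 powr (1 - p)"
        unfolding C5_def by (simp add: algebra_simps)
      moreover have "0 < ln (T / \<sigma>\<^sup>2)" using s s2 T by (intro ln_gt_zero) (simp add: field_simps)
      ultimately have "ln (T / \<sigma>\<^sup>2) powr N \<le> (C5 * m0 powr (1 - p)) powr N"
        using N by (intro powr_mono2) auto
      also have "\<dots> = C5 powr N * (1 / m0)"
        unfolding pN using C5 N m0 by (simp add: powr_mult powr_divide powr_powr powr_minus_divide)
      finally show "\<mu> * ln (T / \<sigma>\<^sup>2) powr real CARD('n) \<le> C5 powr N / c2"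
        using m0 c2 mu unfolding N_def[symmetric] m0_def by (simp add: field_simps)
    qed
  qed
qed

subsection \<open>Convergence and power mean inequalities\<close>

text \<open>If the sum converges to \<open>A + B\<close> and \<open>b\<close> cannot asymptotically
  fall below \<open>B\<close>, then \<open>a\<close> cannot asymptotically exceed \<open>A\<close>.
  Finiteness permits the cancellation.\<close>

lemma ennreal_sum_limit:
  fixes a b :: "nat \<Rightarrow> ennreal"
  assumes sum: "(\<lambda>i. a i + b i) \<longlonglongrightarrow> A + B" and fin: "A + B < \<infinity>"
    and a: "A \<le> liminf a" and b: "B \<le> liminf b"
  shows "a \<longlonglongrightarrow> A"
proof (rule order_tendstoI)
  fix y assume "y < A"
  then have "y < liminf a" using a by (rule less_le_trans)
  then show "\<forall>\<^sub>F i in sequentially. y < a i" by (rule less_LiminfD)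
next
  fix y assume y: "A < y"
  obtain z where z: "A < z" "z < y" using dense[OF y] by auto
  have Afin: "A < top" "B < top" using fin by (auto simp: less_top)
  obtain A' where A': "A = ennreal A'" "0 \<le> A'" using Afin by (cases A) auto
  obtain B' where B': "B = ennreal B'" "0 \<le> B'" using Afin by (cases B) auto
  have "z < top" using z by (metis top.extremum_strict top.not_eq_extremum)
  then obtain z' where z': "z = ennreal z'" "0 \<le> z'" by (cases z) auto
  have lt: "A' < z'" using z A' z' by (simp add: ennreal_less_iff)
  define d where "d = (z' - A') / 2"
  have d: "0 < d" using lt by (simp add: d_def)
  have 1: "\<forall>\<^sub>F i in sequentially. B \<le> b i + ennreal d"
  proof (cases "B' \<le> d")
    case True
    then have "B \<le> ennreal d" using B' by (simp add: ennreal_leI)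
    then show ?thesis by (auto intro!: always_eventually add_increasing)
  next
    case False
    have "ennreal (B' - d) < B" using False B' d by (simp add: ennreal_less_iff)
    then have "ennreal (B' - d) < liminf b" using b by (rule less_le_trans)
    then have "\<forall>\<^sub>F i in sequentially. ennreal (B' - d) < b i" by (rule less_LiminfD)
    then show ?thesis
    proof eventually_elim
      case (elim i)
      have "B = ennreal (B' - d) + ennreal d" using False d B' by (simp add: ennreal_plus[symmetric] del: ennreal_plus)
      also have "\<dots> \<le> b i + ennreal d" using elim by (intro add_right_mono) auto
      finally show ?case .
    qed
  qed
  have "A + B < ennreal (A' + B' + d)"
    using A' B' d by (simp add: ennreal_plus[symmetric] ennreal_less_iff del: ennreal_plus)
  then have 2: "\<forall>\<^sub>F i in sequentially. a i + b i < ennreal (A' + B' + d)"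
    using order_tendstoD(2)[OF sum] by blast
  from 1 2 show "\<forall>\<^sub>F i in sequentially. a i < y"
  proof eventually_elim
    case (elim i)
    have "B + a i \<le> (a i + b i) + ennreal d" using elim(1) by (simp add: add.commute add_left_mono add.assoc)
    also have "\<dots> \<le> ennreal (A' + B' + d) + ennreal d" using elim(2) by (intro add_right_mono) auto
    also have "\<dots> = B + z" using A' B' d z' lt by (simp add: ennreal_plus[symmetric] d_def del: ennreal_plus)
    finally have "a i \<le> z" using Afin by (simp add: ennreal_add_left_cancel_le less_top[symmetric])
    then show ?case using z by simp
  qed
qed

text \<open>Dominated convergence with moving majorants (Pratt): Fatou is applied to
  \<open>f\<close> and to \<open>g - f\<close>, whose integrals add up to the convergent integrals
  of \<open>g\<close>.\<close>

lemma nn_integral_generalized_dominated_convergence: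
  fixes f g :: "nat \<Rightarrow> 'a \<Rightarrow> ennreal"
  assumes f[measurable]: "\<And>i. f i \<in> borel_measurable M" and F[measurable]: "F \<in> borel_measurable M"
    and g[measurable]: "\<And>i. g i \<in> borel_measurable M" and G[measurable]: "G \<in> borel_measurable M"
    and fF: "AE x in M. (\<lambda>i. f i x) \<longlonglongrightarrow> F x"
    and gG: "AE x in M. (\<lambda>i. g i x) \<longlonglongrightarrow> G x"
    and fg: "\<forall>\<^sub>F i in sequentially. \<forall>x\<in>space M. f i x \<le> g i x"
    and lim: "(\<lambda>i. \<integral>\<^sup>+x. g i x \<partial>M) \<longlonglongrightarrow> (\<integral>\<^sup>+x. G x \<partial>M)" and fin: "(\<integral>\<^sup>+x. G x \<partial>M) < \<infinity>"
    and gfin: "\<And>i x. x \<in> space M \<Longrightarrow> g i x < \<infinity>" and Gfin: "\<And>x. x \<in> space M \<Longrightarrow> G x < \<infinity>"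
  shows "(\<lambda>i. \<integral>\<^sup>+x. f i x \<partial>M) \<longlonglongrightarrow> (\<integral>\<^sup>+x. F x \<partial>M)"
proof -
  obtain n where n: "\<And>i x. n \<le> i \<Longrightarrow> x \<in> space M \<Longrightarrow> f i x \<le> g i x"
    using fg unfolding eventually_sequentially by blast
  define f' where "f' i = f (i + n)" for i
  define g' where "g' i = g (i + n)" for i
  have [measurable]: "f' i \<in> borel_measurable M" "g' i \<in> borel_measurable M" for i
    unfolding f'_def g'_def by auto
  have le: "f' i x \<le> g' i x" if "x \<in> space M" for i x
    unfolding f'_def g'_def using that by (intro n) auto
  have f': "AE x in M. (\<lambda>i. f' i x) \<longlonglongrightarrow> F x" unfolding f'_def using fF by eventually_elim (rule LIMSEQ_ignore_initial_segment)
  have g': "AE x in M. (\<lambda>i. g' i x) \<longlonglongrightarrow> G x" unfolding g'_def using gG by eventually_elim (rule LIMSEQ_ignore_initial_segment)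
  have FG: "AE x in M. F x \<le> G x"
    using f' g' AE_space by eventually_elim (rule LIMSEQ_le, auto intro: le)
  have eq: "(\<integral>\<^sup>+x. f' i x \<partial>M) + (\<integral>\<^sup>+x. g' i x - f' i x \<partial>M) = (\<integral>\<^sup>+x. g' i x \<partial>M)" for i
    by (subst nn_integral_add[symmetric]) (auto intro!: nn_integral_cong simp: le add_diff_inverse_ennreal)
  have EQ: "(\<integral>\<^sup>+x. F x \<partial>M) + (\<integral>\<^sup>+x. G x - F x \<partial>M) = (\<integral>\<^sup>+x. G x \<partial>M)"
  proof (subst nn_integral_add[symmetric])
    show "(\<integral>\<^sup>+x. F x + (G x - F x) \<partial>M) = (\<integral>\<^sup>+x. G x \<partial>M)"
      using FG by (intro nn_integral_cong_AE) (auto simp: add_diff_inverse_ennreal)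
  qed auto
  have "(\<lambda>i. \<integral>\<^sup>+x. f' i x \<partial>M) \<longlonglongrightarrow> (\<integral>\<^sup>+x. F x \<partial>M)"
  proof (rule ennreal_sum_limit)
    show "(\<lambda>i. (\<integral>\<^sup>+x. f' i x \<partial>M) + (\<integral>\<^sup>+x. g' i x - f' i x \<partial>M)) \<longlonglongrightarrow> (\<integral>\<^sup>+x. F x \<partial>M) + (\<integral>\<^sup>+x. G x - F x \<partial>M)"
      unfolding eq EQ unfolding g'_def using lim by (rule LIMSEQ_ignore_initial_segment)
    show "(\<integral>\<^sup>+x. F x \<partial>M) + (\<integral>\<^sup>+x. G x - F x \<partial>M) < \<infinity>" unfolding EQ by (rule fin)
    have "(\<integral>\<^sup>+x. F x \<partial>M) = (\<integral>\<^sup>+x. liminf (\<lambda>i. f' i x) \<partial>M)"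
    proof (rule nn_integral_cong_AE)
      show "AE x in M. F x = liminf (\<lambda>i. f' i x)"
        using f' by eventually_elim (rule lim_imp_Liminf[symmetric, OF sequentially_bot])
    qed
    also have "\<dots> \<le> liminf (\<lambda>i. \<integral>\<^sup>+x. f' i x \<partial>M)" by (rule nn_integral_liminf) measurable
    finally show "(\<integral>\<^sup>+x. F x \<partial>M) \<le> liminf (\<lambda>i. \<integral>\<^sup>+x. f' i x \<partial>M)" .
    have "AE x in M. (\<lambda>i. g' i x - f' i x) \<longlonglongrightarrow> G x - F x"
      using f' g' FG AE_space
    proof eventually_elim
      case (elim x)
      then have "F x < \<infinity>" using Gfin[of x] by auto
      then show ?case using elim Gfin[of x] by (intro tendsto_diff_ennreal) auto
    qed
    then have "AE x in M. G x - F x = liminf (\<lambda>i. g' i x - f' i x)"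
      by eventually_elim (rule lim_imp_Liminf[symmetric, OF sequentially_bot])
    then have "(\<integral>\<^sup>+x. G x - F x \<partial>M) = (\<integral>\<^sup>+x. liminf (\<lambda>i. g' i x - f' i x) \<partial>M)"
      by (rule nn_integral_cong_AE)
    also have "\<dots> \<le> liminf (\<lambda>i. \<integral>\<^sup>+x. g' i x - f' i x \<partial>M)" by (rule nn_integral_liminf) measurable
    finally show "(\<integral>\<^sup>+x. G x - F x \<partial>M) \<le> liminf (\<lambda>i. \<integral>\<^sup>+x. g' i x - f' i x \<partial>M)" .
  qed
  then show ?thesis unfolding f'_def by (rule LIMSEQ_offset)
qed

text \<open>Hoelder for a weight of total mass at most \<open>W\<close>, obtained by integrating the
  tangent inequality \<open>young_tangent\<close> at an optimal point.\<close>

lemma holder_weighted: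
  fixes w g :: "'a \<Rightarrow> real"
  assumes [measurable]: "w \<in> borel_measurable M" "g \<in> borel_measurable M"
    and nn: "\<And>x. 0 \<le> w x" "\<And>x. 0 \<le> g x" and r: "1 \<le> r"
    and W: "0 < W" "(\<integral>\<^sup>+x. ennreal (w x) \<partial>M) \<le> ennreal W"
    and X: "0 \<le> X" "(\<integral>\<^sup>+x. ennreal (w x * g x powr r) \<partial>M) \<le> ennreal X"
  shows "(\<integral>\<^sup>+x. ennreal (w x * g x) \<partial>M) \<le> ennreal (W powr (1 - 1 / r) * X powr (1 / r))"
proof -
  consider "r = 1" | "1 < r" "X = 0" | "1 < r" "0 < X" using r X by linarith
  then show ?thesis
  proof cases
    case 1 then show ?thesis using X W nn by simp
  next
    case 2
    then have "AE x in M. ennreal (w x * g x powr r) = 0"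
      using X by (subst nn_integral_0_iff_AE[symmetric]) auto
    then have "AE x in M. ennreal (w x * g x) = 0"
      by eventually_elim (use nn 2 in \<open>auto simp: ennreal_eq_0_iff mult_le_0_iff order.antisym\<close>)
    then have "(\<integral>\<^sup>+x. ennreal (w x * g x) \<partial>M) = 0" by (subst nn_integral_0_iff_AE) auto
    then show ?thesis by simp
  next
    case 3
    \<comment> \<open>The point of tangency that minimises the resulting bound: it balances the
      terms \<open>X\<close> and \<open>a powr r * W\<close>.\<close>
    define a where "a = (X / W) powr (1 / r)"
    have a: "0 < a" using 3 W by (simp add: a_def)
    have ar: "a powr r = X / W" using 3 W by (simp add: a_def powr_powr)
    have "ennreal (r * a powr (r - 1)) * (\<integral>\<^sup>+x. ennreal (w x * g x) \<partial>M) = (\<integral>\<^sup>+x. ennreal (r * a powr (r - 1) * (w x * g x)) \<partial>M)"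
      using 3 nn by (subst nn_integral_cmult[symmetric]) (auto simp: ennreal_mult)
    also have "\<dots> \<le> (\<integral>\<^sup>+x. ennreal (w x * g x powr r) + ennreal ((r - 1) * a powr r) * ennreal (w x) \<partial>M)"
    proof (intro nn_integral_mono)
      fix x
      have "w x * (r * a powr (r - 1) * g x) \<le> w x * (g x powr r + (r - 1) * a powr r)"
        using nn 3 a by (intro mult_left_mono young_tangent) auto
      then have "r * a powr (r - 1) * (w x * g x) \<le> w x * g x powr r + (r - 1) * a powr r * w x"
        by (simp add: algebra_simps)
      then show "ennreal (r * a powr (r - 1) * (w x * g x)) \<le> ennreal (w x * g x powr r) + ennreal ((r - 1) * a powr r) * ennreal (w x)"
        using nn 3 by (simp add: ennreal_plus[symmetric] ennreal_mult[symmetric] ennreal_leI del: ennreal_plus)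
    qed
    also have "\<dots> = (\<integral>\<^sup>+x. ennreal (w x * g x powr r) \<partial>M) + ennreal ((r - 1) * a powr r) * (\<integral>\<^sup>+x. ennreal (w x) \<partial>M)"
      by (subst nn_integral_add) (auto simp: nn_integral_cmult)
    also have "\<dots> \<le> ennreal X + ennreal ((r - 1) * a powr r) * ennreal W"
      using W X by (intro add_mono mult_left_mono) auto
    also have "\<dots> = ennreal (r * X)"
      using 3 W unfolding ar by (simp add: ennreal_plus[symmetric] ennreal_mult[symmetric] del: ennreal_plus) (simp add: algebra_simps)
    also have "r * X = r * a powr (r - 1) * (W powr (1 - 1 / r) * X powr (1 / r))"
    proof -
      have "a powr (r - 1) = (X / W) powr (1 - 1 / r)"
        using 3 by (simp add: a_def powr_powr diff_divide_distrib)
      then have "a powr (r - 1) * (W powr (1 - 1 / r) * X powr (1 / r)) = X powr (1 - 1 / r) * X powr (1 / r)"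
        using 3 W by (simp add: powr_divide)
      also have "\<dots> = X" using 3 by (simp flip: powr_add)
      finally show ?thesis by simp
    qed
    also have "ennreal \<dots> = ennreal (r * a powr (r - 1)) * ennreal (W powr (1 - 1 / r) * X powr (1 / r))"
      using 3 by (intro ennreal_mult) auto
    finally show ?thesis using 3 a by (simp add: ennreal_mult_le_mult_iff)
  qed
qed

section \<open>Measurability, monotonicity and monotone limits of the Duhamel term\<close>

lemma duhamel_measurable [measurable]:
  fixes k :: "'n::finite"
  assumes v: "jointly_measurable k v" and [measurable]: "f \<in> borel_measurable M" "g \<in> borel_measurable M"
  shows "(\<lambda>x. duhamel k p v (f x) (g x)) \<in> borel_measurable M"
proof -
  note [measurable] = jointly_measurable_comp[OF v]
  have [measurable]: "(\<lambda>z. \<integral>\<^sup>+y'. ennreal (tg k (g (fst z) - snd z) (\<lambda>i. f (fst z) $ i - y' i) * v y' (snd z) powr p) \<partial>tangential_measure k) \<in> borel_measurable (M \<Otimes>\<^sub>M borel)"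
    by measurable
  have "(\<lambda>x. \<integral>\<^sup>+s. ennreal (2 * hk (g x - s) (f x $ k)) *
     (\<integral>\<^sup>+y'. ennreal (tg k (g x - s) (\<lambda>i. f x $ i - y' i) * v y' s powr p) \<partial>tangential_measure k) * (if 0 < s \<and> s < g x then 1 else 0) \<partial>lborel) \<in> borel_measurable M"
    by measurable
  moreover have "(if 0 < s \<and> s < g x then 1 else 0) = (indicator {0<..<g x} s :: ennreal)" for s x
    by (simp add: indicator_def)
  ultimately show ?thesis unfolding duhamel_def by (simp only:)
qed

lemma duhamel_mono:
  assumes "\<And>y s. 0 < s \<Longrightarrow> s < t \<Longrightarrow> 0 \<le> v y s" "\<And>y s. 0 < s \<Longrightarrow> s < t \<Longrightarrow> v y s \<le> w y s" "0 \<le> p"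
  shows "duhamel k p v x t \<le> duhamel k p w x t"
  unfolding duhamel_def
proof (intro nn_integral_mono)
  fix s :: real
  show "ennreal (2 * hk (t - s) (x $ k)) * (\<integral>\<^sup>+ y'. ennreal (tg k (t - s) (\<lambda>i. x $ i - y' i) * v y' s powr p) \<partial>tangential_measure k) * indicator {0<..<t} s
    \<le> ennreal (2 * hk (t - s) (x $ k)) * (\<integral>\<^sup>+ y'. ennreal (tg k (t - s) (\<lambda>i. x $ i - y' i) * w y' s powr p) \<partial>tangential_measure k) * indicator {0<..<t} s"
    using assms by (cases "s \<in> {0<..<t}")
      (auto intro!: mult_left_mono nn_integral_mono ennreal_leI powr_mono2 tg_nonneg)
qed

text \<open>Monotone convergence is applied twice, first in the tangential variable at fixed time
  and then in time.\<close>

lemma duhamel_convergence: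
  fixes k :: "'n::finite"
  assumes v: "\<And>n. jointly_measurable k (v n)" and u: "jointly_measurable k u" and p: "0 < p"
    and nn: "\<And>n y s. 0 < s \<Longrightarrow> s < t \<Longrightarrow> 0 \<le> v n y s"
    and mono: "\<And>n y s. 0 < s \<Longrightarrow> s < t \<Longrightarrow> v n y s \<le> v (Suc n) y s"
    and lim: "\<And>y s. 0 < s \<Longrightarrow> s < t \<Longrightarrow> (\<lambda>n. v n y s) \<longlonglongrightarrow> u y s"
  shows "(\<lambda>n. duhamel k p (v n) x t) \<longlonglongrightarrow> duhamel k p u x t"
proof -
  let ?m = "tangential_measure k"
  note [measurable] = jointly_measurable_comp[OF v] jointly_measurable_comp[OF u]
  define I where "I n s = (\<integral>\<^sup>+ y'. ennreal (tg k (t - s) (\<lambda>i. x $ i - y' i) * v n y' s powr p) \<partial>?m)" for n s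
  define J where "J s = (\<integral>\<^sup>+ y'. ennreal (tg k (t - s) (\<lambda>i. x $ i - y' i) * u y' s powr p) \<partial>?m)" for s
  have [measurable]: "I n \<in> borel_measurable borel" "J \<in> borel_measurable borel" for n
    unfolding I_def J_def by measurable
  have mono': "v n y s powr p \<le> v (Suc n) y s powr p" if "0 < s" "s < t" for n y s
    using nn mono that p by (intro powr_mono2) auto
  have I_mono: "I n s \<le> I (Suc n) s" if "0 < s" "s < t" for n s
    unfolding I_def using that mono' by (intro nn_integral_mono ennreal_leI mult_left_mono tg_nonneg) auto
  have IJ: "(\<lambda>n. I n s) \<longlonglongrightarrow> J s" if s: "0 < s" "s < t" for s
    unfolding I_def J_def
  proof (rule nn_integral_LIMSEQ)
    show "incseq (\<lambda>n y'. ennreal (tg k (t - s) (\<lambda>i. x $ i - y' i) * v n y' s powr p))"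
      using s mono' by (intro incseq_SucI le_funI ennreal_leI mult_left_mono tg_nonneg) auto
    show "(\<lambda>n. ennreal (tg k (t - s) (\<lambda>i. x $ i - y' i) * v n y' s powr p)) \<longlonglongrightarrow> ennreal (tg k (t - s) (\<lambda>i. x $ i - y' i) * u y' s powr p)" for y'
      using s lim[of s y'] p nn by (intro tendsto_ennrealI tendsto_mult tendsto_const tendsto_powr') auto
  qed measurable
  show ?thesis
    unfolding duhamel_def I_def[symmetric] J_def[symmetric]
  proof (rule nn_integral_LIMSEQ)
    show "incseq (\<lambda>n s. ennreal (2 * hk (t - s) (x $ k)) * I n s * indicator {0<..<t} s)"
      using I_mono by (intro incseq_SucI le_funI) (auto simp: indicator_def intro!: mult_left_mono)
    show "(\<lambda>n. ennreal (2 * hk (t - s) (x $ k)) * I n s * indicator {0<..<t} s) \<longlonglongrightarrow> ennreal (2 * hk (t - s) (x $ k)) * J s * indicator {0<..<t} s" for s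
      using IJ[of s] by (cases "s \<in> {0<..<t}") (auto intro!: ennreal_tendsto_cmult)
  qed measurable
qed

subsection \<open>Existence of minimal solutions\<close>

text \<open>\<open>hk_mult_le\<close> fuses the normal factors \<open>hk (t - s) (x $ k)\<close> and
  \<open>hk s (z $ k)\<close> into \<open>hk t (x $ k + z $ k)\<close>, which is the image part of
  the Green function at time \<open>t\<close>.\<close>

lemma boundary_kernel_heat_le:
  fixes k :: "'n::finite"
  assumes [measurable]: "f \<in> borel_measurable borel" and nn: "\<And>z. 0 \<le> f z" and t: "0 < s" "s < t"
  shows "ennreal (2 * hk (t - s) (x $ k)) * (\<integral>\<^sup>+z\<in>closed_half_space k. ennreal (2 * hk s (z $ k) * tg k t (\<lambda>i. x $ i - z $ i) * f z) \<partial>lborel)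
    \<le> ennreal (2 * sqrt (t / s) / sqrt (t - s)) * heat k f x t"
proof -
  define c where "c = 4 * sqrt (t / (4 * pi * (t - s) * s))"
  have c: "0 \<le> c" "c \<le> 2 * sqrt (t / s) / sqrt (t - s)"
  proof -
    show "0 \<le> c" using t by (simp add: c_def)
    have "t / (4 * pi * (t - s) * s) = (t / s) / (t - s) / (4 * pi)" by simp
    then have "c = 4 * (sqrt (t / s) / sqrt (t - s)) / sqrt (4 * pi)"
      unfolding c_def by (simp only: real_sqrt_divide times_divide_eq_right)
    also have "\<dots> = 2 * (sqrt (t / s) / sqrt (t - s)) / sqrt pi" by (simp add: real_sqrt_mult)
    also have "\<dots> \<le> 2 * (sqrt (t / s) / sqrt (t - s)) / 1"
      using t pi_ge_two by (intro divide_left_mono) (auto intro!: real_le_rsqrt)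
    finally show "c \<le> 2 * sqrt (t / s) / sqrt (t - s)" by simp
  qed
  have "ennreal (2 * hk (t - s) (x $ k)) * (\<integral>\<^sup>+z\<in>closed_half_space k. ennreal (2 * hk s (z $ k) * tg k t (\<lambda>i. x $ i - z $ i) * f z) \<partial>lborel)
    = (\<integral>\<^sup>+z. ennreal (2 * hk (t - s) (x $ k)) * (ennreal (2 * hk s (z $ k) * tg k t (\<lambda>i. x $ i - z $ i) * f z) * indicator (closed_half_space k) z) \<partial>lborel)"
  proof (rule nn_integral_cmult[symmetric])
    have [measurable]: "(\<lambda>z. tg k t (\<lambda>i. x $ i - z $ i)) \<in> borel_measurable borel"
      by (rule tg_measurable) auto
    show "(\<lambda>z. ennreal (2 * hk s (z $ k) * tg k t (\<lambda>i. x $ i - z $ i) * f z) * indicator (closed_half_space k) z) \<in> borel_measurable lborel"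
      by measurable
  qed
  also have "\<dots> \<le> (\<integral>\<^sup>+z. ennreal c * (ennreal (green k x z t * f z) * indicator (closed_half_space k) z) \<partial>lborel)"
  proof (intro nn_integral_mono)
    fix z :: "real^'n"
    have "hk (t - s) (x $ k) * hk s (z $ k) \<le> sqrt ((t - s + s) / (4 * pi * (t - s) * s)) * hk (t - s + s) (x $ k + z $ k)"
      using t by (intro hk_mult_le) auto
    then have "4 * (hk (t - s) (x $ k) * hk s (z $ k)) \<le> c * hk t (x $ k + z $ k)" by (simp add: c_def)
    also have "\<dots> \<le> c * (hk t (x $ k - z $ k) + hk t (x $ k + z $ k))"
      using t c by (intro mult_left_mono) (auto intro: hk_nonneg)
    finally have "4 * (hk (t - s) (x $ k) * hk s (z $ k)) * (tg k t (\<lambda>i. x $ i - z $ i) * f z)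
       \<le> c * (hk t (x $ k - z $ k) + hk t (x $ k + z $ k)) * (tg k t (\<lambda>i. x $ i - z $ i) * f z)"
      using t nn by (intro mult_right_mono mult_nonneg_nonneg tg_nonneg) auto
    then have "2 * hk (t - s) (x $ k) * (2 * hk s (z $ k) * tg k t (\<lambda>i. x $ i - z $ i) * f z) \<le> c * (green k x z t * f z)"
      using t by (simp add: green_eq mult_ac)
    then show "ennreal (2 * hk (t - s) (x $ k)) * (ennreal (2 * hk s (z $ k) * tg k t (\<lambda>i. x $ i - z $ i) * f z) * indicator (closed_half_space k) z)
      \<le> ennreal c * (ennreal (green k x z t * f z) * indicator (closed_half_space k) z)"
      using t c by (auto simp: indicator_def ennreal_mult'[symmetric] hk_nonneg intro!: ennreal_leI)
  qed
  also have "\<dots> = ennreal c * heat k f x t"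
    unfolding heat_def by (rule nn_integral_cmult) measurable
  also have "\<dots> \<le> ennreal (2 * sqrt (t / s) / sqrt (t - s)) * heat k f x t"
    using c by (intro mult_right_mono ennreal_leI) auto
  finally show ?thesis .
qed

text \<open>The power \<open>p / r\<close> of the flow at time \<open>s\<close> splits into
  \<open>\<Lambda> powr ((p - 1) / r)\<close>, uniform in space, and the exponent
  \<open>1 / r\<close>. Hoelder against the unit mass of \<open>tg\<close> takes this root out of
  the average, and \<open>boundary_kernel_heat_le\<close> turns the averaged flow at time
  \<open>s\<close> into the flow at time \<open>t\<close>.\<close>

lemma boundary_term_le:
  fixes k :: "'n::finite"
  assumes [measurable]: "f \<in> borel_measurable borel" and nn: "\<And>z. 0 \<le> f z" and t: "0 < s" "s < t"
    and pr: "1 < p" "1 \<le> r"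
    and Ls: "\<And>x. x \<in> closed_half_space k \<Longrightarrow> heat k f x s \<le> ennreal \<Lambda>" "0 \<le> \<Lambda>"
    and fin: "heat k f x t < \<infinity>"
  shows "ennreal (2 * hk (t - s) (x $ k)) *
      (\<integral>\<^sup>+y. ennreal (tg k (t - s) (\<lambda>i. x $ i - y i) * (4 * enn2real (heat k f (boundary_point k y) s) powr (1 / r)) powr p) \<partial>tangential_measure k)
    \<le> ennreal (2 * 4 powr p * enn2real (heat k f x t) powr (1 / r)) *
      ennreal (\<Lambda> powr ((p - 1) / r) * ((t - s) powr (-1/2) * (t / s) powr (1 / (2 * r))))"
proof -
  let ?m = "tangential_measure k"
  define Vb where "Vb y = enn2real (heat k f (boundary_point k y) s)" for y
  define V where "V = enn2real (heat k f x t)"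
  have V: "ennreal V = heat k f x t" "0 \<le> V" using fin by (auto simp: V_def)
  have Vb_fin: "heat k f (boundary_point k y) s < \<infinity>" for y
    using Ls(1)[of "boundary_point k y"] by (simp add: le_less_trans[OF _ ennreal_less_top])
  have Vb: "ennreal (Vb y) = heat k f (boundary_point k y) s" "0 \<le> Vb y" for y using Vb_fin by (auto simp: Vb_def)
  have Vb_le: "Vb y \<le> \<Lambda>" for y
    using Ls(1)[of "boundary_point k y"] Vb[of y] Ls(2) by (metis boundary_point_mem ennreal_le_iff)
  have [measurable]: "Vb \<in> borel_measurable ?m"
    unfolding Vb_def by measurable
  define H where "H = 2 * hk (t - s) (x $ k)"
  have H: "0 < H" using t by (simp add: H_def hk_pos)
  define Y where "Y = (\<integral>\<^sup>+z\<in>closed_half_space k. ennreal (2 * hk s (z $ k) * tg k t (\<lambda>i. x $ i - z $ i) * f z) \<partial>lborel)"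
  define c where "c = 2 * sqrt (t / s) / sqrt (t - s)"
  have c: "0 \<le> c" using t by (simp add: c_def)
  have "ennreal H * Y \<le> ennreal c * heat k f x t"
    unfolding H_def Y_def c_def using t nn by (intro boundary_kernel_heat_le) auto
  also have "ennreal c * heat k f x t = ennreal (c * V)"
    unfolding V(1)[symmetric] using V c by (intro ennreal_mult[symmetric])
  finally have HY: "ennreal H * Y \<le> ennreal (c * V)" .
  have "ennreal H * Y < \<infinity>" using HY by (simp add: le_less_trans[OF _ ennreal_less_top])
  then have Yfin: "Y < \<infinity>" using H by (auto simp: ennreal_mult_less_top)
  define X where "X = enn2real Y"
  have X: "Y = ennreal X" "0 \<le> X" using Yfin by (auto simp: X_def)
  have HX: "H * X \<le> c * V" using HY H X c V by (simp add: ennreal_mult[symmetric])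
  have hold: "(\<integral>\<^sup>+y. ennreal (tg k (t - s) (\<lambda>i. x $ i - y i) * Vb y powr (1 / r)) \<partial>?m) \<le> ennreal (1 powr (1 - 1 / r) * X powr (1 / r))"
  proof (rule holder_weighted)
    show "(\<integral>\<^sup>+y. ennreal (tg k (t - s) (\<lambda>i. x $ i - y i)) \<partial>?m) \<le> ennreal 1"
      using t tg_integral[of "t - s" k "\<lambda>i. x $ i"] by simp
    have "(\<integral>\<^sup>+y. ennreal (tg k (t - s) (\<lambda>i. x $ i - y i) * (Vb y powr (1 / r)) powr r) \<partial>?m)
      = (\<integral>\<^sup>+y. ennreal (tg k (t - s) (\<lambda>i. x $ i - y i)) * heat k f (boundary_point k y) s \<partial>?m)"
      using t pr Vb by (intro nn_integral_cong) (simp add: powr_powr ennreal_mult tg_nonneg)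
    also have "\<dots> = Y" unfolding Y_def using t nn by (intro heat_boundary_conv) auto
    finally show "(\<integral>\<^sup>+y. ennreal (tg k (t - s) (\<lambda>i. x $ i - y i) * (Vb y powr (1 / r)) powr r) \<partial>?m) \<le> ennreal X"
      using X by simp
  qed (use t pr X in \<open>auto intro: tg_nonneg\<close>)
  have pt: "(4 * Vb y powr (1 / r)) powr p \<le> 4 powr p * \<Lambda> powr ((p - 1) / r) * Vb y powr (1 / r)" for y
  proof -
    have "(4 * Vb y powr (1 / r)) powr p = 4 powr p * (Vb y powr ((p - 1) / r) * Vb y powr (1 / r))"
      using pr Vb(2)[of y] by (simp add: powr_mult powr_powr flip: powr_add) (simp add: diff_divide_distrib)
    also have "\<dots> \<le> 4 powr p * (\<Lambda> powr ((p - 1) / r) * Vb y powr (1 / r))"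
      using pr Vb Vb_le by (intro mult_left_mono mult_right_mono powr_mono2) auto
    finally show ?thesis by simp
  qed
  have HXr: "H * X powr (1 / r) \<le> 2 * ((t - s) powr (-1/2) * (t / s) powr (1 / (2 * r))) * V powr (1 / r)"
  proof -
    have ir: "0 < 1 / r" "1 / r \<le> 1" using pr by auto
    have ts: "(t - s) powr (-1/2) = 1 / sqrt (t - s)" using t powr_minus_divide[of "t - s" "1/2"] by (simp add: powr_half_sqrt)
    have H_le: "H \<le> (t - s) powr (-1/2)"
    proof -
      have "H \<le> 2 * (1 / sqrt (4 * pi * (t - s)))" unfolding H_def using t hk_le[of "t - s" "x $ k"] by simp
      also have "\<dots> = 1 / (sqrt pi * sqrt (t - s))" by (simp add: real_sqrt_mult)
      also have "\<dots> \<le> 1 / (1 * sqrt (t - s))"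
        using t pi_ge_two by (intro divide_left_mono mult_right_mono) (auto intro!: real_le_rsqrt)
      finally show ?thesis using ts by simp
    qed
    \<comment> \<open>Only the part \<open>H powr (1 / r)\<close> is passed to
      \<open>boundary_kernel_heat_le\<close>, so its factor of \<open>t / s\<close> enters with
      exponent \<open>1 / (2 * r)\<close> instead of \<open>1 / 2\<close>. This is the gain from
      taking \<open>r > 1\<close>.\<close>
    have "H * X powr (1 / r) = H powr (1 - 1 / r) * (H * X) powr (1 / r)"
      using H X by (simp add: powr_mult powr_diff)
    also have "\<dots> \<le> ((t - s) powr (-1/2)) powr (1 - 1 / r) * (c * V) powr (1 / r)"
      by (rule mult_mono[OF powr_mono2 powr_mono2]) (use H H_le HX X ir in auto)
    also have "c * V = 2 * ((t - s) powr (-1/2) * ((t / s) powr (1/2) * V))"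
      unfolding c_def ts using t by (simp add: powr_half_sqrt)
    also have "(2 * ((t - s) powr (-1/2) * ((t / s) powr (1/2) * V))) powr (1 / r)
      = 2 powr (1 / r) * (((t - s) powr (-1/2)) powr (1 / r) * (((t / s) powr (1/2)) powr (1 / r) * V powr (1 / r)))"
      using t V by (simp add: powr_mult)
    also have "((t - s) powr (-1/2)) powr (1 - 1 / r) * (2 powr (1 / r) * (((t - s) powr (-1/2)) powr (1 / r) * (((t / s) powr (1/2)) powr (1 / r) * V powr (1 / r))))
       = 2 powr (1 / r) * ((((t - s) powr (-1/2)) powr (1 - 1 / r) * ((t - s) powr (-1/2)) powr (1 / r)) * (((t / s) powr (1/2)) powr (1 / r) * V powr (1 / r)))"
      by (simp only: mult_ac)
    also have "((t - s) powr (-1/2)) powr (1 - 1 / r) * ((t - s) powr (-1/2)) powr (1 / r) = (t - s) powr (-1/2)"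
      using t by (simp flip: powr_add)
    also have "((t / s) powr (1/2)) powr (1 / r) = (t / s) powr (1 / (2 * r))"
      by (simp add: powr_powr)
    also have "2 powr (1 / r) * ((t - s) powr (-1/2) * ((t / s) powr (1 / (2 * r)) * V powr (1 / r)))
      \<le> 2 powr 1 * ((t - s) powr (-1/2) * ((t / s) powr (1 / (2 * r)) * V powr (1 / r)))"
      using ir by (intro mult_right_mono powr_mono) auto
    finally show ?thesis by simp
  qed
  have "ennreal H * (\<integral>\<^sup>+y. ennreal (tg k (t - s) (\<lambda>i. x $ i - y i) * (4 * Vb y powr (1 / r)) powr p) \<partial>?m)
    \<le> ennreal H * (\<integral>\<^sup>+y. ennreal (4 powr p * \<Lambda> powr ((p - 1) / r)) * ennreal (tg k (t - s) (\<lambda>i. x $ i - y i) * Vb y powr (1 / r)) \<partial>?m)"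
  proof (intro mult_left_mono nn_integral_mono)
    fix y
    have "tg k (t - s) (\<lambda>i. x $ i - y i) * (4 * Vb y powr (1 / r)) powr p \<le> tg k (t - s) (\<lambda>i. x $ i - y i) * (4 powr p * \<Lambda> powr ((p - 1) / r) * Vb y powr (1 / r))"
      using t pt by (intro mult_left_mono tg_nonneg) auto
    then show "ennreal (tg k (t - s) (\<lambda>i. x $ i - y i) * (4 * Vb y powr (1 / r)) powr p) \<le> ennreal (4 powr p * \<Lambda> powr ((p - 1) / r)) * ennreal (tg k (t - s) (\<lambda>i. x $ i - y i) * Vb y powr (1 / r))"
      by (subst ennreal_mult'[symmetric]) (auto intro!: ennreal_leI simp: mult_ac)
  qed simp
  also have "\<dots> = ennreal H * (ennreal (4 powr p * \<Lambda> powr ((p - 1) / r)) * (\<integral>\<^sup>+y. ennreal (tg k (t - s) (\<lambda>i. x $ i - y i) * Vb y powr (1 / r)) \<partial>?m))"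
    by (subst nn_integral_cmult) auto
  also have "\<dots> \<le> ennreal H * (ennreal (4 powr p * \<Lambda> powr ((p - 1) / r)) * ennreal (1 powr (1 - 1 / r) * X powr (1 / r)))"
    by (intro mult_left_mono hold) auto
  also have "\<dots> = ennreal (4 powr p * \<Lambda> powr ((p - 1) / r) * (H * X powr (1 / r)))"
    using H by (simp add: ennreal_mult[symmetric] mult_ac)
  also have "\<dots> \<le> ennreal (4 powr p * \<Lambda> powr ((p - 1) / r) * (2 * ((t - s) powr (-1/2) * (t / s) powr (1 / (2 * r))) * V powr (1 / r)))"
    using HXr by (intro ennreal_leI mult_left_mono) auto
  also have "\<dots> = ennreal (2 * 4 powr p * V powr (1 / r)) * ennreal (\<Lambda> powr ((p - 1) / r) * ((t - s) powr (-1/2) * (t / s) powr (1 / (2 * r))))"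
    by (subst ennreal_mult'[symmetric]) (auto simp: mult_ac)
  finally show ?thesis unfolding H_def Vb_def V_def .
qed

text \<open>By \<open>green_le_gauss\<close> the kernel has mass at most \<open>2\<close>, so
  Hoelder gives the constant \<open>2 powr (1 - 1 / r)\<close>, which is at most
  \<open>2\<close>.\<close>

lemma heat_le_power_mean:
  fixes k :: "'n::finite"
  assumes [measurable]: "\<phi> \<in> borel_measurable borel" and nn: "\<And>z. 0 \<le> \<phi> z" and t: "0 < t" and r: "1 \<le> r"
    and x: "x \<in> closed_half_space k" and fin: "heat k (\<lambda>z. \<phi> z powr r) x t < \<infinity>"
  shows "heat k \<phi> x t \<le> ennreal (2 * enn2real (heat k (\<lambda>z. \<phi> z powr r) x t) powr (1 / r))"
proof -
  define V where "V = enn2real (heat k (\<lambda>z. \<phi> z powr r) x t)"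
  have V: "ennreal V = heat k (\<lambda>z. \<phi> z powr r) x t" "0 \<le> V" using fin by (auto simp: V_def)
  define w where "w z = green k x z t * indicator (closed_half_space k) z" for z
  have e: "ennreal (w z * h) = ennreal (green k x z t * h) * indicator (closed_half_space k) z" for z h
    by (auto simp: w_def indicator_def)
  have [measurable]: "w \<in> borel_measurable lborel" unfolding w_def by measurable
  have "(\<integral>\<^sup>+z. ennreal (w z * \<phi> z) \<partial>lborel) \<le> ennreal (2 powr (1 - 1 / r) * V powr (1 / r))"
  proof (rule holder_weighted[OF _ _ _ nn r])
    have "(\<integral>\<^sup>+z. ennreal (w z) \<partial>lborel) \<le> (\<integral>\<^sup>+z. ennreal 2 * ennreal (gauss t (x - z)) \<partial>lborel)"
    proof (intro nn_integral_mono)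
      fix z :: "real^'n"
      have "w z \<le> 2 * gauss t (x - z)"
        using green_le_gauss[OF x _ t, of z] gauss_nonneg[of t "x - z"] by (auto simp: w_def indicator_def)
      then show "ennreal (w z) \<le> ennreal 2 * ennreal (gauss t (x - z))"
        by (subst ennreal_mult'[symmetric]) (auto intro: ennreal_leI)
    qed
    also have "\<dots> = 2" using t by (simp add: nn_integral_cmult gauss_integral)
    finally show "(\<integral>\<^sup>+z. ennreal (w z) \<partial>lborel) \<le> ennreal 2" by simp
    show "(\<integral>\<^sup>+z. ennreal (w z * \<phi> z powr r) \<partial>lborel) \<le> ennreal V"
      unfolding e V heat_def by simp
  qed (use V in \<open>auto simp: w_def intro!: mult_nonneg_nonneg green_nonneg\<close>)
  also have "\<dots> \<le> ennreal (2 powr 1 * V powr (1 / r))"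
    using r by (intro ennreal_leI mult_right_mono powr_mono) auto
  finally show ?thesis unfolding e V_def heat_def[symmetric] by simp
qed

section \<open>Continuity of the heat flow and of the Duhamel term\<close>

lemma hk_tendsto:
  assumes "(a \<longlongrightarrow> b) F" "(x \<longlongrightarrow> y) F" "0 < b"
  shows "((\<lambda>i. hk (a i) (x i)) \<longlongrightarrow> hk b y) F"
  unfolding hk_def using assms by (intro tendsto_intros) auto

lemma tg_tendsto:
  fixes k :: "'n::finite"
  assumes "(a \<longlongrightarrow> b) F" "0 < b" "\<And>j. ((\<lambda>i. w i j) \<longlongrightarrow> z j) F"
  shows "((\<lambda>i. tg k (a i) (w i)) \<longlongrightarrow> tg k b z) F"
  unfolding tg_def using assms by (intro tendsto_prod hk_tendsto) auto

lemma green_tendsto: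
  assumes "(t \<longlongrightarrow> t0) F" "0 < t0" "(x \<longlongrightarrow> x0) F"
  shows "((\<lambda>i. green k (x i) y (t i)) \<longlongrightarrow> green k x0 y t0) F"
  unfolding green_def using assms by (intro tendsto_intros) auto

text \<open>Eventually \<open>t i\<close> exceeds \<open>t0 / 2\<close>, where the kernel has a
  uniform bound; a multiple of the integrable datum is then a fixed majorant.\<close>

lemma heat_tendsto:
  fixes k :: "'n::finite"
  assumes [measurable]: "\<phi> \<in> borel_measurable borel" and nn: "\<And>z. 0 \<le> \<phi> z"
    and fin: "(\<integral>\<^sup>+z\<in>closed_half_space k. ennreal (\<phi> z) \<partial>lborel) < \<infinity>"
    and t: "t \<longlonglongrightarrow> t0" "0 < t0" and x: "x \<longlonglongrightarrow> x0" "\<And>i. x i \<in> closed_half_space k"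
  shows "(\<lambda>i. heat k \<phi> (x i) (t i)) \<longlonglongrightarrow> heat k \<phi> x0 t0"
proof -
  define C where "C = 2 * (4 * pi * (t0 / 2)) powr (- (real CARD('n) / 2))"
  have C: "0 \<le> C" by (simp add: C_def)
  show ?thesis
    unfolding heat_def
  proof (rule nn_integral_generalized_dominated_convergence)
    show "AE z in lborel. (\<lambda>i. ennreal (green k (x i) z (t i) * \<phi> z) * indicator (closed_half_space k) z)
        \<longlonglongrightarrow> ennreal (green k x0 z t0 * \<phi> z) * indicator (closed_half_space k) z"
    proof (rule AE_I2)
      fix z :: "real^'n"
      show "(\<lambda>i. ennreal (green k (x i) z (t i) * \<phi> z) * indicator (closed_half_space k) z)
        \<longlonglongrightarrow> ennreal (green k x0 z t0 * \<phi> z) * indicator (closed_half_space k) z"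
        using t x by (cases "z \<in> closed_half_space k") (auto intro!: tendsto_ennrealI tendsto_mult green_tendsto)
    qed
    have "\<forall>\<^sub>F i in sequentially. t0 / 2 < t i" using t by (intro order_tendstoD(1)[OF t(1)]) auto
    then show "\<forall>\<^sub>F i in sequentially. \<forall>z\<in>space lborel. ennreal (green k (x i) z (t i) * \<phi> z) * indicator (closed_half_space k) z
       \<le> ennreal C * (ennreal (\<phi> z) * indicator (closed_half_space k) z)"
    proof (eventually_elim, intro ballI, goal_cases)
      case prems: (1 i z)
      show ?case
      proof (cases "z \<in> closed_half_space k")
        case True
        have ti: "0 < t i" using prems t by simp
        have "green k (x i) z (t i) \<le> 2 * gauss (t i) (x i - z)" by (rule green_le_gauss[OF x(2) True ti])
        also have "\<dots> \<le> 2 * (4 * pi * t i) powr (- (real CARD('n) / 2))" using gauss_le[OF ti, of "x i - z"] by simp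
        also have "\<dots> \<le> C" unfolding C_def using prems t by (intro mult_left_mono powr_mono2') auto
        finally have "green k (x i) z (t i) * \<phi> z \<le> C * \<phi> z" using nn by (intro mult_right_mono)
        then show ?thesis using True C by (simp add: ennreal_mult'[symmetric] ennreal_leI)
      qed simp
    qed
    show "(\<lambda>i. \<integral>\<^sup>+z. ennreal C * (ennreal (\<phi> z) * indicator (closed_half_space k) z) \<partial>lborel)
       \<longlonglongrightarrow> (\<integral>\<^sup>+z. ennreal C * (ennreal (\<phi> z) * indicator (closed_half_space k) z) \<partial>lborel)" by simp
    show "(\<integral>\<^sup>+z. ennreal C * (ennreal (\<phi> z) * indicator (closed_half_space k) z) \<partial>lborel) < \<infinity>"
      using fin by (subst nn_integral_cmult) (auto simp: ennreal_mult_less_top)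
  qed (auto simp: indicator_def ennreal_mult_less_top)
qed

text \<open>
  Only bounds on \<open>h\<close> are available, not continuity. The limit is taken through the kernel instead,
  whose tangential mass does not depend on time, so that its multiples serve as convergent majorants.
\<close>

lemma duhamel_tendsto:
  fixes k :: "'n::finite" and h :: "('n \<Rightarrow> real) \<Rightarrow> real \<Rightarrow> real"
  assumes h: "jointly_measurable k h" "\<And>y s. 0 \<le> h y s" and p: "0 < p"
    and hb: "\<And>s. 0 < s \<Longrightarrow> s < T \<Longrightarrow> \<exists>H. \<forall>y. h y s \<le> H"
    and dom: "\<And>x t s. x \<in> closed_half_space k \<Longrightarrow> 0 < s \<Longrightarrow> s < t \<Longrightarrow> t < T \<Longrightarrow>
      ennreal (2 * hk (t - s) (x $ k)) * (\<integral>\<^sup>+y. ennreal (tg k (t - s) (\<lambda>i. x $ i - y i) * h y s powr p) \<partial>tangential_measure k)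
      \<le> ennreal (K t * (l s * (t - s) powr (-1/2)))"
    and K: "\<And>t. 0 \<le> K t" "\<And>\<epsilon>. 0 < \<epsilon> \<Longrightarrow> \<exists>M. \<forall>t. \<epsilon> \<le> t \<and> t < T \<longrightarrow> K t \<le> M"
    and l: "\<And>s. 0 \<le> l s" "\<And>\<epsilon>. 0 < \<epsilon> \<Longrightarrow> \<exists>M. \<forall>s. \<epsilon> \<le> s \<and> s < T \<longrightarrow> l s \<le> M"
    and lm[measurable]: "l \<in> borel_measurable borel"
    and li: "\<And>t. 0 < t \<Longrightarrow> t < T \<Longrightarrow> (\<integral>\<^sup>+s\<in>{0<..<t}. ennreal (l s) \<partial>lborel) < \<infinity>"
    and t: "t \<longlonglongrightarrow> t0" "0 < t0" "t0 < T" and x: "x \<longlonglongrightarrow> x0" "\<And>i. x i \<in> closed_half_space k" "x0 \<in> closed_half_space k"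
  shows "(\<lambda>i. duhamel k p h (x i) (t i)) \<longlonglongrightarrow> duhamel k p h x0 t0"
proof -
  let ?m = "tangential_measure k"
  note [measurable] = jointly_measurable_comp[OF h(1)]
  have xj: "(\<lambda>i. x i $ j) \<longlonglongrightarrow> x0 $ j" for j using x(1) by (rule tendsto_vec_nth)
  \<comment> \<open>Once \<open>t i > t0 / 2\<close>, times \<open>s \<le> a\<close> satisfy
    \<open>t i - s \<ge> a\<close>. The two singularities, of \<open>l\<close> at \<open>0\<close>
    and of the kernel at \<open>t i\<close>, are thus separated.\<close>
  define a where "a = t0 / 4"
  have a: "0 < a" "a < t0" using t by (auto simp: a_def)
  obtain M where M: "\<And>t. t0 / 2 \<le> t \<Longrightarrow> t < T \<Longrightarrow> K t \<le> M" using K(2)[of "t0 / 2"] t by auto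
  have M0: "0 \<le> M" using M[of t0] K(1)[of t0] t by simp
  obtain B where B: "\<And>s. a \<le> s \<Longrightarrow> s < T \<Longrightarrow> l s \<le> B" using l(2)[OF a(1)] by auto
  have B0: "0 \<le> B" using B[of a] l(1)[of a] a t by simp
  define C where "C = M * a powr (-1/2)"
  have C0: "0 \<le> C" using M0 by (simp add: C_def)
  \<comment> \<open>Before \<open>a\<close> the kernel is bounded and \<open>l\<close> integrable;
    after \<open>a\<close> the function \<open>l\<close> is bounded and the kernel integral is
    explicit and continuous in \<open>\<tau>\<close>.\<close>
  define g where "g \<tau> s = ennreal C * (ennreal (l s) * indicator {0<..a} s) + ennreal (M * B) * (ennreal ((\<tau> - s) powr (-1/2)) * indicator {a<..<\<tau>} s)" for \<tau> s
  define I where "I \<xi> \<tau> s = (\<integral>\<^sup>+y. ennreal (tg k (\<tau> - s) (\<lambda>i. \<xi> $ i - y i) * h y s powr p) \<partial>?m)" for \<xi> \<tau> s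
  have I_lim: "(\<lambda>i. I (x i) (t i) s) \<longlonglongrightarrow> I x0 t0 s" and I_fin: "I x0 t0 s < \<infinity>" if s: "0 < s" "s < t0" for s
  proof -
    obtain H where H: "\<And>y. h y s \<le> H" using hb[of s] s t by auto
    have Hp: "h y s powr p \<le> H powr p" for y using H h(2) p by (intro powr_mono2) auto
    have ev: "\<forall>\<^sub>F i in sequentially. s < t i" using order_tendstoD(1)[OF t(1) s(2)] .
    have le: "ennreal (tg k (\<tau> - s) (\<lambda>i. \<xi> $ i - y i) * h y s powr p) \<le> ennreal (H powr p) * ennreal (tg k (\<tau> - s) (\<lambda>i. \<xi> $ i - y i))"
      if "s < \<tau>" for \<tau> \<xi> y
    proof -
      have "tg k (\<tau> - s) (\<lambda>i. \<xi> $ i - y i) * h y s powr p \<le> tg k (\<tau> - s) (\<lambda>i. \<xi> $ i - y i) * H powr p"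
        using that Hp by (intro mult_left_mono tg_nonneg) auto
      then show ?thesis by (subst ennreal_mult'[symmetric]) (auto intro!: ennreal_leI simp: mult.commute)
    qed
    have G: "(\<integral>\<^sup>+y. ennreal (H powr p) * ennreal (tg k (\<tau> - s) (\<lambda>i. \<xi> $ i - y i)) \<partial>?m) = ennreal (H powr p)"
      if "s < \<tau>" for \<tau> and \<xi> :: "real^'n"
      using that tg_integral[of "\<tau> - s" k "\<lambda>i. \<xi> $ i"] by (subst nn_integral_cmult) auto
    have tgl: "(\<lambda>i. tg k (t i - s) (\<lambda>j. x i $ j - y j)) \<longlonglongrightarrow> tg k (t0 - s) (\<lambda>j. x0 $ j - y j)" for y
      using s t xj by (intro tg_tendsto tendsto_diff tendsto_const) auto
    show "(\<lambda>i. I (x i) (t i) s) \<longlonglongrightarrow> I x0 t0 s"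
      unfolding I_def
    proof (rule nn_integral_generalized_dominated_convergence)
      show "AE y in ?m. (\<lambda>i. ennreal (tg k (t i - s) (\<lambda>j. x i $ j - y j) * h y s powr p)) \<longlonglongrightarrow> ennreal (tg k (t0 - s) (\<lambda>j. x0 $ j - y j) * h y s powr p)"
        using tgl by (intro AE_I2 tendsto_ennrealI tendsto_mult tendsto_const)
      show "AE y in ?m. (\<lambda>i. ennreal (H powr p) * ennreal (tg k (t i - s) (\<lambda>j. x i $ j - y j))) \<longlonglongrightarrow> ennreal (H powr p) * ennreal (tg k (t0 - s) (\<lambda>j. x0 $ j - y j))"
        using tgl by (intro AE_I2 ennreal_tendsto_cmult tendsto_ennrealI) auto
      show "\<forall>\<^sub>F i in sequentially. \<forall>y\<in>space ?m. ennreal (tg k (t i - s) (\<lambda>j. x i $ j - y j) * h y s powr p) \<le> ennreal (H powr p) * ennreal (tg k (t i - s) (\<lambda>j. x i $ j - y j))"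
        using ev by eventually_elim (auto intro: le)
      show "(\<lambda>i. \<integral>\<^sup>+y. ennreal (H powr p) * ennreal (tg k (t i - s) (\<lambda>j. x i $ j - y j)) \<partial>?m) \<longlonglongrightarrow> (\<integral>\<^sup>+y. ennreal (H powr p) * ennreal (tg k (t0 - s) (\<lambda>j. x0 $ j - y j)) \<partial>?m)"
        using ev s by (intro tendsto_eventually) (auto elim!: eventually_mono simp: G)
      show "(\<integral>\<^sup>+y. ennreal (H powr p) * ennreal (tg k (t0 - s) (\<lambda>j. x0 $ j - y j)) \<partial>?m) < \<infinity>"
        using s by (simp add: G)
    qed (auto simp: ennreal_mult_less_top)
    have "I x0 t0 s \<le> (\<integral>\<^sup>+y. ennreal (H powr p) * ennreal (tg k (t0 - s) (\<lambda>j. x0 $ j - y j)) \<partial>?m)"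
      unfolding I_def using s by (intro nn_integral_mono le)
    also have "\<dots> < \<infinity>" using s by (simp add: G)
    finally show "I x0 t0 s < \<infinity>" .
  qed
  have [measurable]: "(\<lambda>s. I \<xi> \<tau> s) \<in> borel_measurable borel" for \<xi> \<tau> unfolding I_def by measurable
  have ne: "AE s in lborel. s \<noteq> t0" by (rule AE_lborel_singleton)
  have int_g: "(\<integral>\<^sup>+s. g \<tau> s \<partial>lborel) = ennreal C * (\<integral>\<^sup>+s. ennreal (l s) * indicator {0<..a} s \<partial>lborel) + ennreal (M * B * (2 * sqrt (\<tau> - a)))" if "a < \<tau>" for \<tau>
  proof -
    note nn_integral_inverse_sqrt[OF that]
    then show ?thesis
      unfolding g_def using M0 B0 that
      by (subst nn_integral_add) (auto simp: nn_integral_cmult ennreal_mult[symmetric])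
  qed
  show ?thesis
    unfolding duhamel_def I_def[symmetric]
  proof (rule nn_integral_generalized_dominated_convergence)
    show "(\<lambda>s. ennreal (2 * hk (t i - s) (x i $ k)) * I (x i) (t i) s * indicator {0<..<t i} s) \<in> borel_measurable lborel" for i by measurable
    show "(\<lambda>s. ennreal (2 * hk (t0 - s) (x0 $ k)) * I x0 t0 s * indicator {0<..<t0} s) \<in> borel_measurable lborel" by measurable
    show "g (t i) \<in> borel_measurable lborel" for i unfolding g_def by measurable
    show "g t0 \<in> borel_measurable lborel" unfolding g_def by measurable
    show "AE s in lborel. (\<lambda>i. ennreal (2 * hk (t i - s) (x i $ k)) * I (x i) (t i) s * indicator {0<..<t i} s)
       \<longlonglongrightarrow> ennreal (2 * hk (t0 - s) (x0 $ k)) * I x0 t0 s * indicator {0<..<t0} s"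
      using ne
    proof eventually_elim
      case (elim s)
      consider "s \<le> 0" | "0 < s" "s < t0" | "t0 < s" using elim by linarith
      then show ?case
      proof cases
        case 1 then show ?thesis by simp
      next
        case 2
        have "(\<lambda>i. ennreal (2 * hk (t i - s) (x i $ k)) * I (x i) (t i) s) \<longlonglongrightarrow> ennreal (2 * hk (t0 - s) (x0 $ k)) * I x0 t0 s"
          using 2 I_fin[OF 2] t xj[of k]
          by (intro tendsto_mult_ennreal I_lim tendsto_ennrealI tendsto_mult tendsto_const hk_tendsto tendsto_diff) auto
        moreover have "\<forall>\<^sub>F i in sequentially. ennreal (2 * hk (t i - s) (x i $ k)) * I (x i) (t i) s = ennreal (2 * hk (t i - s) (x i $ k)) * I (x i) (t i) s * indicator {0<..<t i} s"
          using order_tendstoD(1)[OF t(1) 2(2)] by eventually_elim (use 2 in auto)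
        ultimately show ?thesis using 2 by (auto intro: Lim_transform_eventually)
      next
        case 3
        have "\<forall>\<^sub>F i in sequentially. ennreal (2 * hk (t i - s) (x i $ k)) * I (x i) (t i) s * indicator {0<..<t i} s = 0"
          using order_tendstoD(2)[OF t(1) 3] by eventually_elim auto
        then show ?thesis using 3 by (simp add: tendsto_eventually)
      qed
    qed
    show "AE s in lborel. (\<lambda>i. g (t i) s) \<longlonglongrightarrow> g t0 s"
      using ne
    proof eventually_elim
      case (elim s)
      have "(\<lambda>i. ennreal ((t i - s) powr (-1/2)) * indicator {a<..<t i} s) \<longlonglongrightarrow> ennreal ((t0 - s) powr (-1/2)) * indicator {a<..<t0} s"
      proof -
        consider "s \<le> a" | "a < s" "s < t0" | "t0 < s" using elim by linarith
        then show ?thesis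
        proof cases
          case 1 then show ?thesis by simp
        next
          case 2
          have "(\<lambda>i. ennreal ((t i - s) powr (-1/2))) \<longlonglongrightarrow> ennreal ((t0 - s) powr (-1/2))"
            using 2 t by (intro tendsto_ennrealI tendsto_powr tendsto_diff tendsto_const) auto
          moreover have "\<forall>\<^sub>F i in sequentially. ennreal ((t i - s) powr (-1/2)) = ennreal ((t i - s) powr (-1/2)) * indicator {a<..<t i} s"
            using order_tendstoD(1)[OF t(1) 2(2)] by eventually_elim (use 2 in auto)
          ultimately show ?thesis using 2 by (auto intro: Lim_transform_eventually)
        next
          case 3
          have "\<forall>\<^sub>F i in sequentially. ennreal ((t i - s) powr (-1/2)) * indicator {a<..<t i} s = 0"
            using order_tendstoD(2)[OF t(1) 3] by eventually_elim auto
          then show ?thesis using 3 by (simp add: tendsto_eventually)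
        qed
      qed
      then show ?case unfolding g_def by (intro tendsto_add ennreal_tendsto_cmult tendsto_const) auto
    qed
    have "\<forall>\<^sub>F i in sequentially. t0 / 2 < t i" using t by (intro order_tendstoD(1)[OF t(1)]) auto
    moreover have "\<forall>\<^sub>F i in sequentially. t i < T" using t by (intro order_tendstoD(2)[OF t(1)]) auto
    ultimately show "\<forall>\<^sub>F i in sequentially. \<forall>s\<in>space lborel. ennreal (2 * hk (t i - s) (x i $ k)) * I (x i) (t i) s * indicator {0<..<t i} s \<le> g (t i) s"
    proof (eventually_elim, intro ballI, goal_cases)
      case prems: (1 i s)
      show ?case
      proof (cases "0 < s \<and> s < t i")
        case True
        have "ennreal (2 * hk (t i - s) (x i $ k)) * I (x i) (t i) s \<le> ennreal (K (t i) * (l s * (t i - s) powr (-1/2)))"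
          unfolding I_def using True prems x by (intro dom) auto
        also have "\<dots> \<le> ennreal (M * (l s * (t i - s) powr (-1/2)))"
          using prems l(1)[of s] by (intro ennreal_leI mult_right_mono M) auto
        also have "\<dots> \<le> g (t i) s"
        proof (cases "s \<le> a")
          case sa: True
          have "(t i - s) powr (-1/2) \<le> a powr (-1/2)" using sa prems a by (intro powr_mono2') (auto simp: a_def)
          then have "M * (l s * (t i - s) powr (-1/2)) \<le> M * (l s * a powr (-1/2))"
            using M0 l(1)[of s] by (intro mult_left_mono) auto
          also have "\<dots> = C * l s" by (simp add: C_def)
          finally show ?thesis using sa True C0 l(1)[of s] unfolding g_def by (simp add: ennreal_mult[symmetric] ennreal_leI)
        next
          case sa: False
          have "M * (l s * (t i - s) powr (-1/2)) \<le> M * (B * (t i - s) powr (-1/2))"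
            using M0 sa True prems by (intro mult_left_mono mult_right_mono B) auto
          then show ?thesis using sa True M0 B0 unfolding g_def by (simp add: ennreal_mult[symmetric] ennreal_leI mult.assoc)
        qed
        finally show ?thesis using True by simp
      qed auto
    qed
    have l_fin: "(\<integral>\<^sup>+s. ennreal (l s) * indicator {0<..a} s \<partial>lborel) < \<infinity>"
    proof (rule le_less_trans[OF _ li[OF t(2,3)]])
      show "(\<integral>\<^sup>+s. ennreal (l s) * indicator {0<..a} s \<partial>lborel) \<le> (\<integral>\<^sup>+s\<in>{0<..<t0}. ennreal (l s) \<partial>lborel)"
        using a by (intro nn_integral_mono) (auto simp: indicator_def)
    qed
    show "(\<lambda>i. \<integral>\<^sup>+s. g (t i) s \<partial>lborel) \<longlonglongrightarrow> (\<integral>\<^sup>+s. g t0 s \<partial>lborel)"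
    proof (rule Lim_transform_eventually)
      show "(\<lambda>i. ennreal C * (\<integral>\<^sup>+s. ennreal (l s) * indicator {0<..a} s \<partial>lborel) + ennreal (M * B * (2 * sqrt (t i - a)))) \<longlonglongrightarrow> (\<integral>\<^sup>+s. g t0 s \<partial>lborel)"
        unfolding int_g[OF a(2)] using t by (intro tendsto_add tendsto_const tendsto_ennrealI tendsto_mult tendsto_real_sqrt tendsto_diff)
      show "\<forall>\<^sub>F i in sequentially. ennreal C * (\<integral>\<^sup>+s. ennreal (l s) * indicator {0<..a} s \<partial>lborel) + ennreal (M * B * (2 * sqrt (t i - a))) = (\<integral>\<^sup>+s. g (t i) s \<partial>lborel)"
        using order_tendstoD(1)[OF t(1) a(2)] by eventually_elim (simp add: int_g)
    qed
    show "(\<integral>\<^sup>+s. g t0 s \<partial>lborel) < \<infinity>"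
      unfolding int_g[OF a(2)] using l_fin by (simp add: ennreal_mult_less_top)
    show "g (t i) s < \<infinity>" for i s unfolding g_def by (auto simp: indicator_def ennreal_mult_less_top)
    show "g t0 s < \<infinity>" for s unfolding g_def by (auto simp: indicator_def ennreal_mult_less_top)
  qed
qed

text \<open>The bound \<open>\<Lambda>\<close> on the flow of the \<open>r\<close>-th power is
  uniform in space, which reduces the supersolution property to the scalar condition
  \<open>int\<close>. Continuity does not follow from monotone convergence; it is read off the
  integral equation satisfied by the limit.\<close>

lemma minimal_solution_exists:
  fixes k :: "'n::finite" and p r T :: real and \<Lambda> :: "real \<Rightarrow> real"
  assumes p: "1 < p" and r: "1 \<le> r"
    and phi[measurable]: "\<phi> \<in> borel_measurable borel" and nn: "\<And>z. 0 \<le> \<phi> z"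
    and fin: "(\<integral>\<^sup>+z\<in>closed_half_space k. ennreal (\<phi> z) \<partial>lborel) < \<infinity>"
    and L: "\<And>x t. x \<in> closed_half_space k \<Longrightarrow> 0 < t \<Longrightarrow> t < T \<Longrightarrow> heat k (\<lambda>z. \<phi> z powr r) x t \<le> ennreal (\<Lambda> t)"
    and L0: "\<And>t. 0 \<le> \<Lambda> t" and Lm[measurable]: "\<Lambda> \<in> borel_measurable borel"
    and Lb: "\<And>\<epsilon>. 0 < \<epsilon> \<Longrightarrow> \<exists>M. \<forall>t. \<epsilon> \<le> t \<and> t < T \<longrightarrow> \<Lambda> t \<le> M"
    and int: "\<And>t. 0 < t \<Longrightarrow> t < T \<Longrightarrow> (\<integral>\<^sup>+s\<in>{0<..<t}. ennreal (\<Lambda> s powr ((p - 1) / r) * ((t - s) powr (-1/2) * (t / s) powr (1 / (2 * r)))) \<partial>lborel)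
        \<le> ennreal (4 powr (- p))"
  shows "\<exists>u. is_minimal_solution k p \<phi> T u"
proof -
  let ?m = "tangential_measure k" and ?D = "closed_half_space k"
  define f where "f = (\<lambda>z. \<phi> z powr r)"
  have [measurable]: "f \<in> borel_measurable borel" unfolding f_def by measurable
  have f0: "0 \<le> f z" for z by (simp add: f_def)
  define V where "V x t = enn2real (heat k f x t)" for x t
  have Lf: "heat k f x t \<le> ennreal (\<Lambda> t)" if "x \<in> ?D" "0 < t" "t < T" for x t
    using L[OF that] by (simp add: f_def)
  have V_fin: "heat k f x t < \<infinity>" if "x \<in> ?D" "0 < t" "t < T" for x t
    using Lf[OF that] by (simp add: le_less_trans[OF _ ennreal_less_top])
  have V_le: "V x t \<le> \<Lambda> t" if "x \<in> ?D" "0 < t" "t < T" for x t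
    unfolding V_def using enn2real_mono[OF Lf[OF that]] L0 by simp
  have V0: "0 \<le> V x t" for x t by (simp add: V_def)
  \<comment> \<open>The factor \<open>4\<close> is \<open>2 + 2\<close>: one half dominates the heat
    term by \<open>heat_le_power_mean\<close>, the other the Duhamel term. The constant
    \<open>4 powr (- p)\<close> in \<open>int\<close> cancels the \<open>p\<close>-th power of the
    same \<open>4\<close>.\<close>
  define U where "U x t = 4 * V x t powr (1 / r)" for x t
  have U0: "0 \<le> U x t" for x t by (simp add: U_def)
  define Ub where "Ub y s = U (boundary_point k y) s" for y s
  have Ub_joint: "jointly_measurable k Ub"
    unfolding jointly_measurable_def Ub_def U_def V_def by measurable
  have term_le: "ennreal (2 * hk (t - s) (x $ k)) * (\<integral>\<^sup>+y. ennreal (tg k (t - s) (\<lambda>i. x $ i - y i) * Ub y s powr p) \<partial>?m)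
    \<le> ennreal (2 * 4 powr p * V x t powr (1 / r)) * ennreal (\<Lambda> s powr ((p - 1) / r) * ((t - s) powr (-1/2) * (t / s) powr (1 / (2 * r))))"
    if "x \<in> ?D" "0 < s" "s < t" "t < T" for x s t
    unfolding Ub_def U_def V_def
    using that f0 p r Lf[of _ s] L0 V_fin[of x t] by (intro boundary_term_le) auto
  have super: "heat k \<phi> x t + duhamel k p Ub x t \<le> ennreal (U x t)" if x: "x \<in> ?D" "0 < t" "t < T" for x t
  proof -
    have 1: "heat k \<phi> x t \<le> ennreal (2 * V x t powr (1 / r))"
      unfolding V_def f_def using x nn r V_fin[OF x] by (intro heat_le_power_mean) (auto simp: f_def)
    have "duhamel k p Ub x t \<le> (\<integral>\<^sup>+s. ennreal (2 * 4 powr p * V x t powr (1 / r)) * (ennreal (\<Lambda> s powr ((p - 1) / r) * ((t - s) powr (-1/2) * (t / s) powr (1 / (2 * r)))) * indicator {0<..<t} s) \<partial>lborel)"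
      unfolding duhamel_def
    proof (intro nn_integral_mono)
      fix s :: real
      show "ennreal (2 * hk (t - s) (x $ k)) * (\<integral>\<^sup>+y. ennreal (tg k (t - s) (\<lambda>i. x $ i - y i) * Ub y s powr p) \<partial>?m) * indicator {0<..<t} s
        \<le> ennreal (2 * 4 powr p * V x t powr (1 / r)) * (ennreal (\<Lambda> s powr ((p - 1) / r) * ((t - s) powr (-1/2) * (t / s) powr (1 / (2 * r)))) * indicator {0<..<t} s)"
      proof (cases "0 < s \<and> s < t")
        case True then show ?thesis using term_le[of x s t] x by simp
      qed auto
    qed
    also have "\<dots> = ennreal (2 * 4 powr p * V x t powr (1 / r)) * (\<integral>\<^sup>+s\<in>{0<..<t}. ennreal (\<Lambda> s powr ((p - 1) / r) * ((t - s) powr (-1/2) * (t / s) powr (1 / (2 * r)))) \<partial>lborel)"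
      by (rule nn_integral_cmult) measurable
    also have "\<dots> \<le> ennreal (2 * 4 powr p * V x t powr (1 / r)) * ennreal (4 powr (- p))"
      using x by (intro mult_left_mono int) auto
    also have "\<dots> = ennreal (2 * V x t powr (1 / r))"
      by (subst ennreal_mult[symmetric]) (auto simp: powr_minus field_simps)
    finally have "heat k \<phi> x t + duhamel k p Ub x t \<le> ennreal (2 * V x t powr (1 / r)) + ennreal (2 * V x t powr (1 / r))"
      using 1 by (intro add_mono)
    also have "\<dots> = ennreal (U x t)" unfolding U_def by (subst ennreal_plus[symmetric]) auto
    finally show ?thesis .
  qed

  have e2r: "ennreal (enn2real X) = X" if "X \<le> ennreal c" for X c
    using le_less_trans[OF that ennreal_less_top] by (rule ennreal_enn2real)
  \<comment> \<open>Picard iteration from \<open>0\<close>. Outside the domain, or where the sum is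
    infinite, \<open>enn2real\<close> only supplies a default; \<open>w_le\<close> shows that inside
    the domain no information is lost.\<close>
  define w where "w = rec_nat (\<lambda>x t. 0) (\<lambda>n v x t. enn2real (heat k \<phi> x t + duhamel k p (\<lambda>y s. v (boundary_point k y) s) x t))"
  define wb where "wb n y s = w n (boundary_point k y) s" for n y s
  have w_0: "w 0 = (\<lambda>x t. 0)" by (simp add: w_def)
  have w_Suc: "w (Suc n) x t = enn2real (heat k \<phi> x t + duhamel k p (wb n) x t)" for n x t
    unfolding wb_def by (simp add: w_def)
  have w_meas: "(\<lambda>z. w n (fst z) (snd z)) \<in> borel_measurable (borel \<Otimes>\<^sub>M borel) \<and> jointly_measurable k (wb n)" for n
  proof (induction n)
    case 0
    show ?case by (simp add: w_0 jointly_measurable_def wb_def case_prod_beta)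
  next
    case (Suc n)
    then have j: "jointly_measurable k (wb n)" by simp
    have 1: "(\<lambda>z. w (Suc n) (fst z) (snd z)) \<in> borel_measurable (borel \<Otimes>\<^sub>M borel)"
      unfolding w_Suc by (intro borel_measurable_enn2real borel_measurable_add heat_measurable duhamel_measurable[OF j]) auto
    have "(\<lambda>q. (boundary_point k (fst q), snd q)) \<in> ?m \<Otimes>\<^sub>M borel \<rightarrow>\<^sub>M borel \<Otimes>\<^sub>M borel"
      by measurable
    from measurable_compose[OF this 1] show ?case
      using 1 by (simp add: jointly_measurable_def wb_def case_prod_beta)
  qed
  have wb_joint: "jointly_measurable k (wb n)" for n using w_meas by blast
  have w0: "0 \<le> w n x t" for n x t by (cases n) (simp_all add: w_0 w_Suc)
  have w_le: "w n x t \<le> U x t \<and> ennreal (w (Suc n) x t) = heat k \<phi> x t + duhamel k p (wb n) x t"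
    if "x \<in> ?D" "0 < t" "t < T" for n x t
    using that
  proof (induction n arbitrary: x t)
    case 0
    have "heat k \<phi> x t + duhamel k p (wb 0) x t \<le> heat k \<phi> x t + duhamel k p Ub x t"
      using p by (intro add_left_mono duhamel_mono) (auto simp: wb_def w_0 Ub_def U0)
    also have "\<dots> \<le> ennreal (U x t)" using 0 by (intro super)
    finally show ?case unfolding w_Suc by (simp only: e2r) (simp add: w_0 U0)
  next
    case (Suc n)
    have bound: "heat k \<phi> x t + duhamel k p (wb m) x t \<le> ennreal (U x t)" if "\<And>y s. 0 < s \<Longrightarrow> s < t \<Longrightarrow> wb m y s \<le> Ub y s" for m
    proof -
      have "heat k \<phi> x t + duhamel k p (wb m) x t \<le> heat k \<phi> x t + duhamel k p Ub x t"
        using p that by (intro add_left_mono duhamel_mono) (auto simp: wb_def w0)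
      also have "\<dots> \<le> ennreal (U x t)" using Suc.prems by (intro super)
      finally show ?thesis .
    qed
    have le: "w (Suc n) x' s \<le> U x' s" if "x' \<in> ?D" "0 < s" "s < T" for x' s
    proof -
      have "heat k \<phi> x' s + duhamel k p (wb n) x' s \<le> heat k \<phi> x' s + duhamel k p Ub x' s"
        using p that Suc.IH by (intro add_left_mono duhamel_mono) (auto simp: wb_def Ub_def w0)
      also have "\<dots> \<le> ennreal (U x' s)" using that by (intro super)
      finally have "ennreal (w (Suc n) x' s) \<le> ennreal (U x' s)" using Suc.IH[OF that] by simp
      then show ?thesis using U0 by simp
    qed
    have "heat k \<phi> x t + duhamel k p (wb (Suc n)) x t \<le> ennreal (U x t)"
      using le Suc.prems by (intro bound) (auto simp: wb_def Ub_def)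
    then show ?case unfolding w_Suc[of "Suc n"] using le[OF Suc.prems] by (simp only: e2r)
  qed
  have w_mono: "w n x t \<le> w (Suc n) x t" if "x \<in> ?D" "0 < t" "t < T" for n x t
    using that
  proof (induction n arbitrary: x t)
    case 0 then show ?case by (simp add: w_0 w0)
  next
    case (Suc n)
    have "ennreal (w (Suc n) x t) \<le> ennreal (w (Suc (Suc n)) x t)"
      using w_le[OF Suc.prems] Suc p w0 by (auto simp: wb_def intro!: add_left_mono duhamel_mono)
    then show ?case using w0 by simp
  qed
  define u where "u x t = lim (\<lambda>n. w n x t)" for x t
  have u_lim: "(\<lambda>n. w n x t) \<longlonglongrightarrow> u x t" if "x \<in> ?D" "0 < t" "t < T" for x t
  proof -
    have "convergent (\<lambda>n. w n x t)"
    proof (rule Bseq_monoseq_convergent)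
      show "monoseq (\<lambda>n. w n x t)" using w_mono[OF that] by (auto simp: monoseq_Suc)
      show "Bseq (\<lambda>n. w n x t)" using w_le[OF that] w0 by (intro BseqI'[of _ "U x t"]) auto
    qed
    then show ?thesis by (simp add: convergent_LIMSEQ_iff u_def)
  qed
  have u_nn: "0 \<le> u x t" if "x \<in> ?D" "0 < t" "t < T" for x t
    using u_lim[OF that] w0 by (intro LIMSEQ_le_const) auto
  have u_le: "u x t \<le> U x t" if "x \<in> ?D" "0 < t" "t < T" for x t
    using u_lim[OF that] w_le[OF that] by (intro LIMSEQ_le_const2) auto
  \<comment> \<open>For times outside \<open>(0, T)\<close> the limit \<open>u\<close> has no
    guaranteed meaning, so the trace is cut off there to be nonnegative and measurable
    everywhere.\<close>
  define h where "h y s = (if 0 < s \<and> s < T then u (boundary_point k y) s else 0)" for y s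
  have h_joint: "jointly_measurable k h"
  proof -
    note [measurable] = jointly_measurable_comp[OF wb_joint]
    show ?thesis unfolding jointly_measurable_def h_def u_def wb_def[symmetric] case_prod_beta by measurable
  qed
  have h0: "0 \<le> h y s" for y s using u_nn[of "boundary_point k y" s] by (simp add: h_def)
  have h_le: "h y s \<le> Ub y s" for y s
    using u_le[of "boundary_point k y" s] U0 by (simp add: h_def Ub_def)
  have u_eq: "ennreal (u x t) = heat k \<phi> x t + duhamel k p h x t" if x: "x \<in> ?D" "0 < t" "t < T" for x t
  proof (rule LIMSEQ_unique)
    show "(\<lambda>n. ennreal (w (Suc n) x t)) \<longlonglongrightarrow> ennreal (u x t)"
      using u_lim[OF x] by (intro tendsto_ennrealI LIMSEQ_Suc)
    have "(\<lambda>n. duhamel k p (wb n) x t) \<longlonglongrightarrow> duhamel k p h x t"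
      using x w0 p w_mono u_lim by (intro duhamel_convergence wb_joint h_joint) (auto simp: wb_def h_def)
    then show "(\<lambda>n. ennreal (w (Suc n) x t)) \<longlonglongrightarrow> heat k \<phi> x t + duhamel k p h x t"
      using w_le[OF x] by (auto intro!: tendsto_add)
  qed
  \<comment> \<open>The weight \<open>(t / s) powr (1 / (2 * r))\<close> in \<open>term_le\<close>
    is split into its factor in \<open>t\<close>, put into \<open>K\<close>, and its factor in
    \<open>s\<close>, put into \<open>l\<close>, as \<open>duhamel_tendsto\<close> requires.\<close>
  define K where "K t = 2 * 4 powr p * \<Lambda> t powr (1 / r) * t powr (1 / (2 * r))" for t
  define l where "l s = \<Lambda> s powr ((p - 1) / r) * s powr (- (1 / (2 * r)))" for s
  have e0: "0 < 1 / (2 * r)" "0 \<le> 1 / r" "0 \<le> (p - 1) / r" using r p by auto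
  have cont: "continuous_on (?D \<times> {0<..<T}) (\<lambda>(x, t). u x t)"
    unfolding continuous_on_sequentially
  proof (intro allI ballI impI, elim conjE)
    fix z :: "nat \<Rightarrow> (real^'n) \<times> real" and z0
    assume z0: "z0 \<in> ?D \<times> {0<..<T}" and z: "\<forall>n. z n \<in> ?D \<times> {0<..<T}" and lim: "z \<longlonglongrightarrow> z0"
    define x t where "x n = fst (z n)" and "t n = snd (z n)" for n
    obtain x0 t0 where z0e: "z0 = (x0, t0)" by (cases z0)
    have xD: "x n \<in> ?D" "0 < t n" "t n < T" for n using z by (auto simp: x_def t_def mem_Times_iff)
    have x0D: "x0 \<in> ?D" "0 < t0" "t0 < T" using z0 z0e by auto
    have xl: "x \<longlonglongrightarrow> x0" "t \<longlonglongrightarrow> t0"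
      using tendsto_fst[OF lim] tendsto_snd[OF lim] unfolding x_def t_def z0e by auto
    have "(\<lambda>n. duhamel k p h (x n) (t n)) \<longlonglongrightarrow> duhamel k p h x0 t0"
    proof (rule duhamel_tendsto[where K=K and l=l])
      show "\<exists>H. \<forall>y. h y s \<le> H" if "0 < s" "s < T" for s
      proof (intro exI allI)
        fix y
        show "h y s \<le> 4 * \<Lambda> s powr (1 / r)"
          using h_le[of y s] V_le[of "boundary_point k y" s] V0 that e0 powr_mono2[of "1 / r" "V (boundary_point k y) s" "\<Lambda> s"]
          unfolding Ub_def U_def by (smt (verit) boundary_point_mem)
      qed
      show "ennreal (2 * hk (t - s) (x $ k)) * (\<integral>\<^sup>+y. ennreal (tg k (t - s) (\<lambda>i. x $ i - y i) * h y s powr p) \<partial>?m)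
        \<le> ennreal (K t * (l s * (t - s) powr (-1/2)))" if x: "x \<in> ?D" "0 < s" "s < t" "t < T" for x t s
      proof -
        have "ennreal (2 * hk (t - s) (x $ k)) * (\<integral>\<^sup>+y. ennreal (tg k (t - s) (\<lambda>i. x $ i - y i) * h y s powr p) \<partial>?m)
          \<le> ennreal (2 * hk (t - s) (x $ k)) * (\<integral>\<^sup>+y. ennreal (tg k (t - s) (\<lambda>i. x $ i - y i) * Ub y s powr p) \<partial>?m)"
          using x h0 h_le p by (intro mult_left_mono nn_integral_mono ennreal_leI powr_mono2 tg_nonneg) auto
        also have "\<dots> \<le> ennreal (2 * 4 powr p * V x t powr (1 / r)) * ennreal (\<Lambda> s powr ((p - 1) / r) * ((t - s) powr (-1/2) * (t / s) powr (1 / (2 * r))))"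
          using x by (intro term_le)
        also have "\<dots> = ennreal (2 * 4 powr p * V x t powr (1 / r) * (\<Lambda> s powr ((p - 1) / r) * ((t - s) powr (-1/2) * (t / s) powr (1 / (2 * r)))))"
          by (rule ennreal_mult[symmetric]) auto
        also have "\<dots> \<le> ennreal (2 * 4 powr p * \<Lambda> t powr (1 / r) * (\<Lambda> s powr ((p - 1) / r) * ((t - s) powr (-1/2) * (t / s) powr (1 / (2 * r)))))"
          using x V0 V_le[of x t] e0 by (intro ennreal_leI mult_right_mono mult_left_mono powr_mono2) auto
        also have "2 * 4 powr p * \<Lambda> t powr (1 / r) * (\<Lambda> s powr ((p - 1) / r) * ((t - s) powr (-1/2) * (t / s) powr (1 / (2 * r)))) = K t * (l s * (t - s) powr (-1/2))"
          unfolding K_def l_def using x by (simp add: powr_divide powr_minus_divide mult_ac)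
        finally show ?thesis .
      qed
      show "\<exists>M. \<forall>t. \<epsilon> \<le> t \<and> t < T \<longrightarrow> K t \<le> M" if eps: "0 < \<epsilon>" for \<epsilon>
      proof -
        obtain M where M: "\<And>t. \<epsilon> \<le> t \<Longrightarrow> t < T \<Longrightarrow> \<Lambda> t \<le> M" using Lb[OF eps] by auto
        show ?thesis
        proof (intro exI allI impI)
          fix t assume t: "\<epsilon> \<le> t \<and> t < T"
          show "K t \<le> 2 * 4 powr p * M powr (1 / r) * T powr (1 / (2 * r))"
            unfolding K_def using t eps M[of t] L0[of t] e0 by (intro mult_mono mult_left_mono powr_mono2) auto
        qed
      qed
      show "\<exists>M. \<forall>s. \<epsilon> \<le> s \<and> s < T \<longrightarrow> l s \<le> M" if eps: "0 < \<epsilon>" for \<epsilon>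
      proof -
        obtain M where M: "\<And>t. \<epsilon> \<le> t \<Longrightarrow> t < T \<Longrightarrow> \<Lambda> t \<le> M" using Lb[OF eps] by auto
        show ?thesis
        proof (intro exI allI impI)
          fix t assume t: "\<epsilon> \<le> t \<and> t < T"
          show "l t \<le> M powr ((p - 1) / r) * \<epsilon> powr (- (1 / (2 * r)))"
            unfolding l_def using t eps M[of t] L0[of t] e0 by (intro mult_mono powr_mono2 powr_mono2') auto
        qed
      qed
      show "l \<in> borel_measurable borel" unfolding l_def by measurable
      show "(\<integral>\<^sup>+s\<in>{0<..<t}. ennreal (l s) \<partial>lborel) < \<infinity>" if t: "0 < t" "t < T" for t
      proof -
        \<comment> \<open>Since \<open>(t - s) powr (-1/2)\<close> is at least
          \<open>t powr (-1/2)\<close>, the integrability of \<open>l\<close> near \<open>0\<close>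
          already follows from \<open>int\<close>; \<open>c\<close> collects the powers of
          \<open>t\<close>.\<close>
        define c where "c = t powr (1/2) * t powr (- (1 / (2 * r)))"
        have "(\<integral>\<^sup>+s\<in>{0<..<t}. ennreal (l s) \<partial>lborel) \<le> (\<integral>\<^sup>+s. ennreal c * (ennreal (\<Lambda> s powr ((p - 1) / r) * ((t - s) powr (-1/2) * (t / s) powr (1 / (2 * r)))) * indicator {0<..<t} s) \<partial>lborel)"
        proof (intro nn_integral_mono)
          fix s :: real
          have "l s \<le> c * (\<Lambda> s powr ((p - 1) / r) * ((t - s) powr (-1/2) * (t / s) powr (1 / (2 * r))))" if s: "0 < s" "s < t"
          proof -
            have "1 = t powr (1/2) * t powr (-1/2)" using t by (simp flip: powr_add)
            also have "\<dots> \<le> t powr (1/2) * (t - s) powr (-1/2)" using s by (intro mult_left_mono powr_mono2') auto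
            finally have "l s * 1 \<le> l s * (t powr (1/2) * (t - s) powr (-1/2))" by (intro mult_left_mono) (auto simp: l_def)
            also have "\<dots> = c * (\<Lambda> s powr ((p - 1) / r) * ((t - s) powr (-1/2) * (t / s) powr (1 / (2 * r))))"
              unfolding l_def c_def using s t by (simp add: powr_divide powr_minus_divide mult_ac)
            finally show ?thesis by simp
          qed
          then show "ennreal (l s) * indicator {0<..<t} s \<le> ennreal c * (ennreal (\<Lambda> s powr ((p - 1) / r) * ((t - s) powr (-1/2) * (t / s) powr (1 / (2 * r)))) * indicator {0<..<t} s)"
            by (auto simp: indicator_def c_def ennreal_mult'[symmetric] intro!: ennreal_leI)
        qed
        also have "\<dots> = ennreal c * (\<integral>\<^sup>+s\<in>{0<..<t}. ennreal (\<Lambda> s powr ((p - 1) / r) * ((t - s) powr (-1/2) * (t / s) powr (1 / (2 * r)))) \<partial>lborel)"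
          by (rule nn_integral_cmult) measurable
        also have "\<dots> \<le> ennreal c * ennreal (4 powr (- p))" by (intro mult_left_mono int t) auto
        also have "\<dots> < \<infinity>" by (simp add: ennreal_mult_less_top)
        finally show ?thesis .
      qed
    qed (use h_joint h0 p L0 xl xD x0D in \<open>auto simp: K_def l_def\<close>)
    then have "(\<lambda>n. heat k \<phi> (x n) (t n) + duhamel k p h (x n) (t n)) \<longlonglongrightarrow> heat k \<phi> x0 t0 + duhamel k p h x0 t0"
      using fin nn xl xD x0D by (intro tendsto_add heat_tendsto) auto
    then have "(\<lambda>n. ennreal (u (x n) (t n))) \<longlonglongrightarrow> ennreal (u x0 t0)"
      using u_eq xD x0D by simp
    then have "(\<lambda>n. u (x n) (t n)) \<longlonglongrightarrow> u x0 t0"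
      using u_nn xD x0D by (subst (asm) tendsto_ennreal_iff) auto
    then show "((\<lambda>(x, t). u x t) \<circ> z) \<longlonglongrightarrow> (case z0 of (x, t) \<Rightarrow> u x t)"
      unfolding x_def t_def z0e by (simp add: case_prod_beta comp_def)
  qed
  have "is_solution k p \<phi> T u"
    unfolding is_solution_def
  proof (intro conjI ballI cont)
    fix x t assume x: "x \<in> ?D" and t: "t \<in> {0<..<T}"
    then show "0 \<le> u x t" by (intro u_nn) auto
    have "(\<integral>\<^sup>+ s\<in>{0<..<t}. (\<integral>\<^sup>+ y'. ennreal (green k x (boundary_point k y') (t - s) *
              u (boundary_point k y') s powr p) \<partial>?m) \<partial>lborel) = duhamel k p h x t"
      using t by (intro duhamel_eq h_joint) (auto simp: h_def)
    then show "ennreal (u x t) =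
          (\<integral>\<^sup>+ y\<in>?D. ennreal (green k x y t * \<phi> y) \<partial>lebesgue) +
          (\<integral>\<^sup>+ s\<in>{0<..<t}. (\<integral>\<^sup>+ y'. ennreal (green k x (boundary_point k y') (t - s) *
              u (boundary_point k y') s powr p) \<partial>?m) \<partial>lborel)"
      using u_eq[of x t] x t by (simp add: heat_lebesgue)
  qed
  \<comment> \<open>Minimality: by induction every iterate lies below every solution, because the
    iteration starts at \<open>0\<close> and the Duhamel term is monotone.\<close>
  moreover have "u x t \<le> u' x t" if sol: "is_solution k p \<phi> T u'" and x: "x \<in> ?D" "0 < t" "t < T" for u' x t
  proof -
    obtain v where v: "jointly_measurable k v" "\<And>y s. 0 \<le> v y s" "\<And>y s. 0 < s \<Longrightarrow> s < T \<Longrightarrow> v y s = u' (boundary_point k y) s"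
      "\<And>x t. x \<in> ?D \<Longrightarrow> 0 < t \<Longrightarrow> t < T \<Longrightarrow> ennreal (u' x t) = heat k \<phi> x t + duhamel k p v x t"
      using solution_boundary[OF sol] by metis
    have u'0: "0 \<le> u' x t" if "x \<in> ?D" "0 < t" "t < T" for x t using sol that unfolding is_solution_def by auto
    have "w n x t \<le> u' x t" if "x \<in> ?D" "0 < t" "t < T" for n x t
      using that
    proof (induction n arbitrary: x t)
      case 0 then show ?case by (simp add: w_0 u'0)
    next
      case (Suc n)
      have "duhamel k p (wb n) x t \<le> duhamel k p v x t"
        using Suc p by (intro duhamel_mono) (auto simp: wb_def w0 v(3))
      then have "ennreal (w (Suc n) x t) \<le> ennreal (u' x t)"
        using w_le[OF Suc.prems, of n] v(4)[OF Suc.prems] by (simp add: add_left_mono)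
      then show ?case using u'0[OF Suc.prems] by simp
    qed
    then show ?thesis using u_lim[OF x] x by (intro LIMSEQ_le_const2) auto
  qed
  ultimately show ?thesis unfolding is_minimal_solution_def by auto
qed

subsection \<open>Existence and nonexistence scales of the singular datum\<close>

text \<open>On the first half of the interval the Abel kernel is bounded, on the second half
  \<open>g\<close> is; each singularity is integrated where the other factor is harmless.\<close>

lemma nn_integral_abel_split:
  fixes g :: "real \<Rightarrow> real"
  assumes [measurable]: "g \<in> borel_measurable borel" and g0: "\<And>s. 0 < s \<Longrightarrow> s < t \<Longrightarrow> 0 \<le> g s" and t: "0 < t"
    and G: "0 \<le> G" "(\<integral>\<^sup>+s\<in>{0<..<t}. ennreal (g s) \<partial>lborel) \<le> ennreal G"
    and M: "0 \<le> M" "\<And>s. t / 2 \<le> s \<Longrightarrow> s < t \<Longrightarrow> g s \<le> M"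
  shows "(\<integral>\<^sup>+s\<in>{0<..<t}. ennreal (g s * (t - s) powr (-1/2)) \<partial>lborel) \<le> ennreal ((t / 2) powr (-1/2) * G + M * (2 * sqrt t))"
proof -
  have I: "(\<integral>\<^sup>+s\<in>{0<..<t}. ennreal ((t - s) powr (-1/2)) \<partial>lborel) = ennreal (2 * sqrt t)"
    using nn_integral_inverse_sqrt[OF t] by simp
  have "(\<integral>\<^sup>+s\<in>{0<..<t}. ennreal (g s * (t - s) powr (-1/2)) \<partial>lborel) \<le>
    (\<integral>\<^sup>+s. ennreal ((t / 2) powr (-1/2)) * (ennreal (g s) * indicator {0<..<t} s) + ennreal M * (ennreal ((t - s) powr (-1/2)) * indicator {0<..<t} s) \<partial>lborel)"
  proof (intro nn_integral_mono)
    fix s :: real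
    show "ennreal (g s * (t - s) powr (-1/2)) * indicator {0<..<t} s \<le>
      ennreal ((t / 2) powr (-1/2)) * (ennreal (g s) * indicator {0<..<t} s) + ennreal M * (ennreal ((t - s) powr (-1/2)) * indicator {0<..<t} s)"
    proof (cases "0 < s \<and> s < t")
      case True
      have "g s * (t - s) powr (-1/2) \<le> (t / 2) powr (-1/2) * g s + M * (t - s) powr (-1/2)"
      proof (cases "s < t / 2")
        case s: True
        have "(t - s) powr (-1/2) \<le> (t / 2) powr (-1/2)" using s t by (intro powr_mono2') auto
        then have "g s * (t - s) powr (-1/2) \<le> g s * (t / 2) powr (-1/2)" using g0[of s] True by (intro mult_left_mono) auto
        moreover have "0 \<le> M * (t - s) powr (-1/2)" using M(1) by simp
        ultimately show ?thesis by (simp add: mult.commute)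
      next
        case False
        have "g s * (t - s) powr (-1/2) \<le> M * (t - s) powr (-1/2)" using False True M(2)[of s] by (intro mult_right_mono) auto
        moreover have "0 \<le> (t / 2) powr (-1/2) * g s" using g0[of s] True by simp
        ultimately show ?thesis by simp
      qed
      then have "ennreal (g s * (t - s) powr (-1/2)) \<le> ennreal ((t / 2) powr (-1/2) * g s + M * (t - s) powr (-1/2))"
        by (rule ennreal_leI)
      also have "\<dots> = ennreal ((t / 2) powr (-1/2)) * ennreal (g s) + ennreal M * ennreal ((t - s) powr (-1/2))"
        using g0[of s] True M(1) by (subst ennreal_plus) (auto simp: ennreal_mult)
      finally show ?thesis using True by simp
    qed auto
  qed
  also have "\<dots> = ennreal ((t / 2) powr (-1/2)) * (\<integral>\<^sup>+s\<in>{0<..<t}. ennreal (g s) \<partial>lborel) + ennreal M * (\<integral>\<^sup>+s\<in>{0<..<t}. ennreal ((t - s) powr (-1/2)) \<partial>lborel)"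
    by (subst nn_integral_add) (auto simp: nn_integral_cmult)
  also have "\<dots> \<le> ennreal ((t / 2) powr (-1/2)) * ennreal G + ennreal M * ennreal (2 * sqrt t)"
    unfolding I using G by (intro add_mono mult_left_mono) auto
  also have "\<dots> = ennreal ((t / 2) powr (-1/2) * G + M * (2 * sqrt t))"
    using G M t by (subst ennreal_plus) (auto simp: ennreal_mult)
  finally show ?thesis .
qed

lemma prof_powr: "prof a b s powr e = prof (a * e) (b * e) s"
  unfolding prof_def by (simp add: powr_mult powr_powr)

text \<open>The profile is increasing up to a constant. Bounds at all times \<open>t \<le> T\<close>
  can therefore be replaced by the one at \<open>T\<close>.\<close>

lemma prof_le_later:
  assumes "a < 0 \<or> a = 0 \<and> 0 \<le> b"
  obtains C where "0 < C" "\<And>t T. 0 < t \<Longrightarrow> t \<le> T \<Longrightarrow> prof a b t \<le> C * prof a b T"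
proof (cases "a < 0")
  case True
  then have "0 < - a" by simp
  from LL_slow[OF this, of "-b"] obtain C where C: "1 \<le> C" "\<And>r s m. 0 < r \<Longrightarrow> 0 < s \<Longrightarrow> 1 \<le> m \<Longrightarrow> s / r \<le> m \<Longrightarrow> r / s \<le> m \<Longrightarrow>
      LL r powr (-b) \<le> C * m powr (-a) * LL s powr (-b)" by metis
  show ?thesis
  proof (rule that[of C])
    show "0 < C" using C by simp
    fix t T :: real assume t: "0 < t" "t \<le> T"
    have "t / T \<le> T / t" using t by (simp add: field_simps mult_mono)
    then have "LL t powr (-b) \<le> C * (T / t) powr (-a) * LL T powr (-b)" using t by (intro C) auto
    then have "t powr (-a) * LL t powr (-b) \<le> t powr (-a) * (C * (T / t) powr (-a) * LL T powr (-b))"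
      by (rule mult_left_mono) simp
    also have "\<dots> = C * prof a b T" unfolding prof_def using t by (simp add: powr_divide powr_minus_divide)
    finally show "prof a b t \<le> C * prof a b T" by (simp add: prof_def)
  qed
next
  case False
  show ?thesis
  proof (rule that[of 1])
    fix t T :: real assume t: "0 < t" "t \<le> T"
    have "LL t powr (-b) \<le> LL T powr (-b)"
      using t False assms LL_pos[of T] LL_antimono[of t T] by (intro powr_mono2') auto
    then show "prof a b t \<le> 1 * prof a b T" using False assms t by (simp add: prof_def)
  qed simp
qed

text \<open>Near \<open>0\<close> the integrand behaves like \<open>s\<close> to the power
  \<open>- \<alpha> - 1 / (2 * r)\<close>, and the room below \<open>1\<close> is
  \<open>2 * \<delta>\<close>: one \<open>\<delta>\<close> freezes the logarithm at
  \<open>t\<close>, the other keeps the integral convergent. Condition \<open>ag\<close> then allows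
  passing from \<open>t\<close> to \<open>T\<close>.\<close>

lemma abel_integral_prof_le:
  fixes \<alpha> \<gamma> r :: real
  assumes r: "1 \<le> r" and al: "0 \<le> \<alpha>" "\<alpha> + 1 / (2 * r) < 1" and ag: "\<alpha> < 1 / 2 \<or> \<alpha> = 1 / 2 \<and> 0 \<le> \<gamma>"
  obtains C where "0 < C" "\<And>t T. 0 < t \<Longrightarrow> t \<le> T \<Longrightarrow>
    (\<integral>\<^sup>+s\<in>{0<..<t}. ennreal (prof \<alpha> \<gamma> s * ((t - s) powr (-1/2) * (t / s) powr (1 / (2 * r)))) \<partial>lborel)
    \<le> ennreal (C * prof (\<alpha> - 1/2) \<gamma> T)"
proof -
  define e where "e = 1 / (2 * r)"
  have e: "0 < e" using r by (simp add: e_def)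
  define \<delta> where "\<delta> = (1 - \<alpha> - e) / 2"
  have d: "0 < \<delta>" "\<delta> < 1" using al[folded e_def] e by (auto simp: \<delta>_def)
  obtain C where C: "1 \<le> C" "\<And>r s m. 0 < r \<Longrightarrow> 0 < s \<Longrightarrow> 1 \<le> m \<Longrightarrow> s / r \<le> m \<Longrightarrow> r / s \<le> m \<Longrightarrow>
      LL r powr (-\<gamma>) \<le> C * m powr \<delta> * LL s powr (-\<gamma>)" using LL_slow[OF d(1), of "-\<gamma>"] by metis
  obtain C' where C': "0 < C'" "\<And>t T. 0 < t \<Longrightarrow> t \<le> T \<Longrightarrow> prof (\<alpha> - 1/2) \<gamma> t \<le> C' * prof (\<alpha> - 1/2) \<gamma> T"
    using prof_le_later[of "\<alpha> - 1/2" \<gamma>] ag by (metis diff_less_0_iff_less eq_iff_diff_eq_0)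
  define c1 where "c1 = (1/2) powr (-1/2) / \<delta> + 2 * (1/2) powr (\<delta> - 1)"
  have c1: "0 < c1" using d by (simp add: c1_def add_pos_pos)
  show ?thesis
  proof (rule that[of "C * c1 * C'"])
    show "0 < C * c1 * C'" using C c1 C' by simp
    fix t T :: real assume t: "0 < t" "t \<le> T"
    define K where "K = C * LL t powr (-\<gamma>) * t powr (\<delta> + e)"
    have K: "0 \<le> K" using C by (simp add: K_def)
    have pt: "prof \<alpha> \<gamma> s * (t / s) powr e \<le> K * s powr (\<delta> - 1)" if s: "0 < s" "s < t" for s
    proof -
      have "s / t \<le> t / s" using s by (simp add: field_simps mult_mono)
      then have "LL s powr (-\<gamma>) \<le> C * (t / s) powr \<delta> * LL t powr (-\<gamma>)" using s t by (intro C) auto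
      then have "s powr (-\<alpha>) * (t / s) powr e * LL s powr (-\<gamma>) \<le> s powr (-\<alpha>) * (t / s) powr e * (C * (t / s) powr \<delta> * LL t powr (-\<gamma>))"
        by (rule mult_left_mono) simp
      also have "\<dots> = C * LL t powr (-\<gamma>) * (t powr \<delta> * t powr e) * (s powr (-\<alpha>) * s powr (-e) * s powr (-\<delta>))"
        using s t by (simp add: powr_divide powr_minus_divide[of s e] powr_minus_divide[of s \<delta>])
      also have "t powr \<delta> * t powr e = t powr (\<delta> + e)" by (rule powr_add[symmetric])
      also have "s powr (-\<alpha>) * s powr (-e) * s powr (-\<delta>) = s powr (\<delta> - 1)"
        unfolding powr_add[symmetric] by (rule arg_cong2[where f="(powr)"]) (auto simp: \<delta>_def field_simps)
      finally show ?thesis unfolding prof_def K_def by (simp add: mult_ac)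
    qed
    have "(\<integral>\<^sup>+s\<in>{0<..<t}. ennreal (prof \<alpha> \<gamma> s * ((t - s) powr (-1/2) * (t / s) powr e)) \<partial>lborel)
      \<le> (\<integral>\<^sup>+s\<in>{0<..<t}. ennreal (K * s powr (\<delta> - 1) * (t - s) powr (-1/2)) \<partial>lborel)"
    proof (intro nn_integral_mono)
      fix s :: real
      have "prof \<alpha> \<gamma> s * ((t - s) powr (-1/2) * (t / s) powr e) \<le> K * s powr (\<delta> - 1) * (t - s) powr (-1/2)" if s: "0 < s" "s < t"
        using mult_right_mono[OF pt[OF s], of "(t - s) powr (-1/2)"] by (simp add: mult_ac)
      then show "ennreal (prof \<alpha> \<gamma> s * ((t - s) powr (-1/2) * (t / s) powr e)) * indicator {0<..<t} s
         \<le> ennreal (K * s powr (\<delta> - 1) * (t - s) powr (-1/2)) * indicator {0<..<t} s"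
        by (auto simp: indicator_def intro!: ennreal_leI)
    qed
    also have "\<dots> \<le> ennreal ((t / 2) powr (-1/2) * (K * (t powr \<delta> / \<delta>)) + K * (t / 2) powr (\<delta> - 1) * (2 * sqrt t))"
    proof (rule nn_integral_abel_split)
      have "(\<integral>\<^sup>+s\<in>{0<..<t}. ennreal (K * s powr (\<delta> - 1)) \<partial>lborel) = (\<integral>\<^sup>+s. ennreal K * (ennreal (s powr (\<delta> - 1)) * indicator {0<..<t} s) \<partial>lborel)"
        using K by (intro nn_integral_cong) (auto simp: ennreal_mult mult.assoc)
      also have "\<dots> = ennreal (K * (t powr \<delta> / \<delta>))"
        using K t d by (subst nn_integral_cmult, measurable, subst nn_integral_powr_0) (auto simp: ennreal_mult'[symmetric])
      finally show "(\<integral>\<^sup>+s\<in>{0<..<t}. ennreal (K * s powr (\<delta> - 1)) \<partial>lborel) \<le> ennreal (K * (t powr \<delta> / \<delta>))" by simp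
      show "K * s powr (\<delta> - 1) \<le> K * (t / 2) powr (\<delta> - 1)" if "t / 2 \<le> s" "s < t" for s
        using that t d K by (intro mult_left_mono powr_mono2') auto
    qed (use K t d in auto)
    also have "(t / 2) powr (-1/2) * (K * (t powr \<delta> / \<delta>)) + K * (t / 2) powr (\<delta> - 1) * (2 * sqrt t) = C * c1 * prof (\<alpha> - 1/2) \<gamma> t"
    proof -
      have h: "(t / 2) powr x = (1/2) powr x * t powr x" for x using t powr_mult[of "1/2" t x] by simp
      have e1: "t powr (-1/2) * t powr (\<delta> + e) * t powr \<delta> = t powr (- (\<alpha> - 1/2))"
        unfolding powr_add[symmetric] by (rule arg_cong2[where f="(powr)"]) (auto simp: \<delta>_def field_simps)
      have e2: "t powr (\<delta> - 1) * t powr (\<delta> + e) * t powr (1/2) = t powr (- (\<alpha> - 1/2))"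
        unfolding powr_add[symmetric] by (rule arg_cong2[where f="(powr)"]) (auto simp: \<delta>_def field_simps)
      have "(t / 2) powr (-1/2) * (K * (t powr \<delta> / \<delta>)) + K * (t / 2) powr (\<delta> - 1) * (2 * sqrt t)
        = C * LL t powr (-\<gamma>) * ((1/2) powr (-1/2) / \<delta> * (t powr (-1/2) * t powr (\<delta> + e) * t powr \<delta>)
           + 2 * (1/2) powr (\<delta> - 1) * (t powr (\<delta> - 1) * t powr (\<delta> + e) * t powr (1/2)))"
        unfolding K_def h using t by (simp add: powr_half_sqrt algebra_simps)
      also have "\<dots> = C * c1 * prof (\<alpha> - 1/2) \<gamma> t" unfolding e1 e2 c1_def prof_def by (simp add: algebra_simps)
      finally show ?thesis .
    qed
    also have "ennreal (C * c1 * prof (\<alpha> - 1/2) \<gamma> t) \<le> ennreal (C * c1 * (C' * prof (\<alpha> - 1/2) \<gamma> T))"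
      using C c1 C'(2)[OF t] by (intro ennreal_leI mult_left_mono) auto
    finally show "(\<integral>\<^sup>+s\<in>{0<..<t}. ennreal (prof \<alpha> \<gamma> s * ((t - s) powr (-1/2) * (t / s) powr (1 / (2 * r)))) \<partial>lborel)
      \<le> ennreal (C * c1 * C' * prof (\<alpha> - 1/2) \<gamma> T)" by (simp add: e_def mult_ac)
  qed
qed

text \<open>The borderline \<open>\<alpha> = 1 / 2\<close>, \<open>r = 1\<close>: the powers
  multiply to \<open>1 / s\<close>, so only \<open>1 < \<gamma>\<close> gives convergence and one
  logarithm is lost.\<close>

lemma abel_integral_critical_le:
  fixes \<gamma> :: real
  assumes ga: "1 < \<gamma>"
  obtains C where "0 < C" "\<And>t T. 0 < t \<Longrightarrow> t \<le> T \<Longrightarrow> T \<le> 1 \<Longrightarrow>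
    (\<integral>\<^sup>+s\<in>{0<..<t}. ennreal (prof (1/2) \<gamma> s * ((t - s) powr (-1/2) * (t / s) powr (1/2))) \<partial>lborel)
    \<le> ennreal (C * prof 0 (\<gamma> - 1) T)"
proof -
  define c where "c = (exp 1 + 1) / (\<gamma> - 1)"
  have c: "0 < c" using ga by (auto simp: c_def intro!: divide_pos_pos add_pos_pos)
  define C where "C = (1/2) powr (-1/2) * c + 4"
  have C: "0 < C" using c by (simp add: C_def add_pos_pos)
  show ?thesis
  proof (rule that[OF C])
    fix t T :: real assume t: "0 < t" "t \<le> T" "T \<le> 1"
    have Lt: "1 \<le> LL t" "LL T \<le> LL t" "0 < LL T" using t LL_ge_1[of t] LL_antimono[of t T] LL_pos[of T] by auto
    have "(\<integral>\<^sup>+s\<in>{0<..<t}. ennreal (prof (1/2) \<gamma> s * ((t - s) powr (-1/2) * (t / s) powr (1/2))) \<partial>lborel)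
      = (\<integral>\<^sup>+s\<in>{0<..<t}. ennreal (t powr (1/2) * (s powr (-1) * LL s powr (-\<gamma>)) * (t - s) powr (-1/2)) \<partial>lborel)"
    proof (intro nn_integral_cong)
      fix s :: real
      have "prof (1/2) \<gamma> s * ((t - s) powr (-1/2) * (t / s) powr (1/2)) = t powr (1/2) * (s powr (-1) * LL s powr (-\<gamma>)) * (t - s) powr (-1/2)"
        if s: "0 < s" "s < t"
      proof -
        have "(t / s) powr (1/2) = t powr (1/2) * s powr (-1/2)" using s t powr_minus_divide[of s "1/2"] by (simp add: powr_divide)
        moreover have "s powr (-1) = s powr (-1/2) * s powr (-1/2)" by (simp flip: powr_add)
        ultimately show ?thesis unfolding prof_def by (simp add: mult_ac)
      qed
      then show "ennreal (prof (1/2) \<gamma> s * ((t - s) powr (-1/2) * (t / s) powr (1/2))) * indicator {0<..<t} s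
        = ennreal (t powr (1/2) * (s powr (-1) * LL s powr (-\<gamma>)) * (t - s) powr (-1/2)) * indicator {0<..<t} s"
        by (auto simp: indicator_def)
    qed
    also have "\<dots> \<le> ennreal ((t / 2) powr (-1/2) * (t powr (1/2) * (c * LL t powr (1 - \<gamma>))) + t powr (1/2) * (2 / t * LL t powr (1 - \<gamma>)) * (2 * sqrt t))"
    proof (rule nn_integral_abel_split)
      have "(\<integral>\<^sup>+s\<in>{0<..<t}. ennreal (t powr (1/2) * (s powr (-1) * LL s powr (-\<gamma>))) \<partial>lborel) = (\<integral>\<^sup>+s. ennreal (t powr (1/2)) * (ennreal (s powr (-1) * LL s powr (-\<gamma>)) * indicator {0<..<t} s) \<partial>lborel)"
        by (intro nn_integral_cong) (simp only: ennreal_mult'[OF powr_ge_zero] mult.assoc)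
      also have "\<dots> = ennreal (t powr (1/2)) * (\<integral>\<^sup>+s\<in>{0<..<t}. ennreal (s powr (-1) * LL s powr (-\<gamma>)) \<partial>lborel)"
        by (rule nn_integral_cmult) measurable
      also have "\<dots> \<le> ennreal (t powr (1/2)) * ennreal (c * LL t powr (1 - \<gamma>))"
        unfolding c_def using ga t by (intro mult_left_mono LL_int) auto
      finally show "(\<integral>\<^sup>+s\<in>{0<..<t}. ennreal (t powr (1/2) * (s powr (-1) * LL s powr (-\<gamma>))) \<partial>lborel) \<le> ennreal (t powr (1/2) * (c * LL t powr (1 - \<gamma>)))"
        using c by (simp add: ennreal_mult)
      show "t powr (1/2) * (s powr (-1) * LL s powr (-\<gamma>)) \<le> t powr (1/2) * (2 / t * LL t powr (1 - \<gamma>))" if s: "t / 2 \<le> s" "s < t" for s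
      proof (intro mult_left_mono mult_mono)
        have "s powr (-1) = 1 / s" using s t powr_minus_divide[of s 1] by simp
        also have "\<dots> \<le> 1 / (t / 2)" using s t by (intro divide_left_mono) auto
        finally show "s powr (-1) \<le> 2 / t" by simp
        have "LL s powr (-\<gamma>) \<le> LL t powr (-\<gamma>)" using s t ga LL_pos[of t] LL_antimono[of s t] by (intro powr_mono2') auto
        also have "\<dots> \<le> LL t powr (1 - \<gamma>)" using Lt by (intro powr_mono) auto
        finally show "LL s powr (-\<gamma>) \<le> LL t powr (1 - \<gamma>)" .
      qed (use t in auto)
    qed (use c t in auto)
    also have "(t / 2) powr (-1/2) * (t powr (1/2) * (c * LL t powr (1 - \<gamma>))) + t powr (1/2) * (2 / t * LL t powr (1 - \<gamma>)) * (2 * sqrt t) = C * LL t powr (1 - \<gamma>)"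
    proof -
      have h: "(t / 2) powr (-1/2) = (1/2) powr (-1/2) * t powr (-1/2)" using t powr_mult[of "1/2" t "-1/2"] by simp
      have e1: "t powr (-1/2) * t powr (1/2) = 1" using t by (simp flip: powr_add)
      have e2: "t powr (1/2) * sqrt t = t" using t by (simp add: powr_half_sqrt)
      have "(t / 2) powr (-1/2) * (t powr (1/2) * (c * LL t powr (1 - \<gamma>))) + t powr (1/2) * (2 / t * LL t powr (1 - \<gamma>)) * (2 * sqrt t)
        = (1/2) powr (-1/2) * c * (t powr (-1/2) * t powr (1/2)) * LL t powr (1 - \<gamma>) + 4 / t * (t powr (1/2) * sqrt t) * LL t powr (1 - \<gamma>)"
        unfolding h by simp
      also have "\<dots> = C * LL t powr (1 - \<gamma>)" unfolding e1 e2 C_def using t by (simp add: algebra_simps)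
      finally show ?thesis .
    qed
    also have "ennreal (C * LL t powr (1 - \<gamma>)) \<le> ennreal (C * LL T powr (1 - \<gamma>))"
      using Lt ga C by (intro ennreal_leI mult_left_mono powr_mono2') auto
    finally show "(\<integral>\<^sup>+s\<in>{0<..<t}. ennreal (prof (1/2) \<gamma> s * ((t - s) powr (-1/2) * (t / s) powr (1/2))) \<partial>lborel)
      \<le> ennreal (C * prof 0 (\<gamma> - 1) T)" using t by (simp add: prof_def)
  qed
qed

section \<open>Sufficient thresholds for existence\<close>

lemma heat_cmult:
  assumes "0 \<le> c" and [measurable]: "f \<in> borel_measurable borel"
  shows "heat k (\<lambda>z. c * f z) x t = ennreal c * heat k f x t"
proof -
  have "heat k (\<lambda>z. c * f z) x t = (\<integral>\<^sup>+z. ennreal c * (ennreal (green k x z t * f z) * indicator (closed_half_space k) z) \<partial>lborel)"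
    unfolding heat_def
  proof (intro nn_integral_cong)
    fix z
    have "ennreal (green k x z t * (c * f z)) = ennreal c * ennreal (green k x z t * f z)"
      using assms by (subst ennreal_mult'[symmetric]) (auto simp: mult_ac)
    then show "ennreal (green k x z t * (c * f z)) * indicator (closed_half_space k) z = ennreal c * (ennreal (green k x z t * f z) * indicator (closed_half_space k) z)"
      by (simp add: mult.assoc)
  qed
  also have "\<dots> = ennreal c * heat k f x t" unfolding heat_def by (rule nn_integral_cmult) measurable
  finally show ?thesis .
qed

text \<open>
  The exponent \<open>b\<close> is \<open>B\<close> except when \<open>A = CARD('n)\<close>, where integrating the profile over a ball
  costs one logarithm and \<open>b = B - 1\<close>.
\<close>

lemma existence_threshold:
  fixes k :: "'n::finite" and p A B r b a' b' :: real
  assumes p: "1 < p" and r: "1 \<le> r"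
    and fin: "(\<integral>\<^sup>+z\<in>closed_half_space k. ennreal (psi k A B z) \<partial>lborel) < \<infinity>"
    and C0: "0 < C0" "\<And>x t. x \<in> closed_half_space k \<Longrightarrow> 0 < t \<Longrightarrow> t \<le> 1 \<Longrightarrow> heat k (psi k (A * r) (B * r)) x t \<le> ennreal (C0 * prof (A * r / 2) (b * r) t)"
    and C1: "0 < C1" "\<And>t T. 0 < t \<Longrightarrow> t \<le> T \<Longrightarrow> T \<le> 1 \<Longrightarrow>
      (\<integral>\<^sup>+s\<in>{0<..<t}. ennreal (prof (A * (p - 1) / 2) (b * (p - 1)) s * ((t - s) powr (-1/2) * (t / s) powr (1 / (2 * r)))) \<partial>lborel)
      \<le> ennreal (C1 * prof a' b' T powr (p - 1))"
  shows "\<exists>c>0. \<forall>\<kappa>>0. \<forall>T>0. T \<le> 1 \<longrightarrow> \<kappa> * prof a' b' T \<le> c \<longrightarrow> (\<exists>u. is_minimal_solution k p (\<lambda>x. \<kappa> * psi k A B x) T u)"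
proof -
  define c2 where "c2 = C0 powr ((p - 1) / r) * C1"
  have c2: "0 < c2" using C0 C1 by (simp add: c2_def)
  \<comment> \<open>Solves \<open>c2 * c powr (p - 1) = 4 powr (- p)\<close>, the smallness required
    by \<open>minimal_solution_exists\<close>.\<close>
  define c where "c = (4 powr (- p) / c2) powr (1 / (p - 1))"
  have c: "0 < c" using c2 by (simp add: c_def)
  show ?thesis
  proof (intro exI[of _ c] conjI c allI impI)
    fix \<kappa> T :: real assume k: "0 < \<kappa>" and T: "0 < T" "T \<le> 1" and le: "\<kappa> * prof a' b' T \<le> c"
    \<comment> \<open>The factor \<open>\<kappa> powr r\<close> becomes
      \<open>\<kappa> powr (p - 1)\<close> under the power \<open>(p - 1) / r\<close>, so the final
      condition is independent of \<open>r\<close> up to constants.\<close>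
    define \<Lambda> where "\<Lambda> t = \<kappa> powr r * (C0 * prof (A * r / 2) (b * r) t)" for t
    have pw: "(\<lambda>z. (\<kappa> * psi k A B z) powr r) = (\<lambda>z. \<kappa> powr r * psi k (A * r) (B * r) z)"
      using k r by (simp add: powr_mult psi_powr psi_nonneg)
    show "\<exists>u. is_minimal_solution k p (\<lambda>x. \<kappa> * psi k A B x) T u"
    proof (rule minimal_solution_exists[OF p r, where \<Lambda>=\<Lambda>])
      show "0 \<le> \<kappa> * psi k A B z" for z using k by (simp add: psi_nonneg)
      show "(\<integral>\<^sup>+z\<in>closed_half_space k. ennreal (\<kappa> * psi k A B z) \<partial>lborel) < \<infinity>"
      proof -
        have "(\<integral>\<^sup>+z\<in>closed_half_space k. ennreal (\<kappa> * psi k A B z) \<partial>lborel) = (\<integral>\<^sup>+z. ennreal \<kappa> * (ennreal (psi k A B z) * indicator (closed_half_space k) z) \<partial>lborel)"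
          using k by (intro nn_integral_cong) (simp add: ennreal_mult psi_nonneg mult.assoc)
        also have "\<dots> = ennreal \<kappa> * (\<integral>\<^sup>+z\<in>closed_half_space k. ennreal (psi k A B z) \<partial>lborel)"
          by (rule nn_integral_cmult) measurable
        finally show ?thesis using fin by (simp add: ennreal_mult_less_top)
      qed
      show "heat k (\<lambda>z. (\<kappa> * psi k A B z) powr r) x t \<le> ennreal (\<Lambda> t)" if "x \<in> closed_half_space k" "0 < t" "t < T" for x t
      proof -
        have "heat k (\<lambda>z. (\<kappa> * psi k A B z) powr r) x t = ennreal (\<kappa> powr r) * heat k (psi k (A * r) (B * r)) x t"
          unfolding pw by (rule heat_cmult) auto
        also have "\<dots> \<le> ennreal (\<kappa> powr r) * ennreal (C0 * prof (A * r / 2) (b * r) t)"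
          using that T by (intro mult_left_mono C0) auto
        finally show ?thesis unfolding \<Lambda>_def by (simp add: ennreal_mult')
      qed
      show "0 \<le> \<Lambda> t" for t using C0 by (simp add: \<Lambda>_def prof_nonneg)
      show "\<Lambda> \<in> borel_measurable borel" unfolding \<Lambda>_def by measurable
      show "\<exists>M. \<forall>t. \<epsilon> \<le> t \<and> t < T \<longrightarrow> \<Lambda> t \<le> M" if eps: "0 < \<epsilon>" for \<epsilon>
      proof -
        have "continuous_on {\<epsilon>..T} \<Lambda>"
          unfolding \<Lambda>_def prof_def
        proof (intro continuous_intros)
          have "0 < exp 1 + 1 / x" if "\<epsilon> \<le> x" for x using that eps by (intro add_pos_pos) auto
          then show "continuous_on {\<epsilon>..T} LL"
            unfolding LL_def using eps by (intro continuous_intros) (auto simp: less_imp_neq[symmetric])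
          show "\<forall>x\<in>{\<epsilon>..T}. LL x \<noteq> 0" using eps LL_pos by (auto simp: less_imp_neq[symmetric])
        qed (use eps in auto)
        then have "bounded (\<Lambda> ` {\<epsilon>..T})" by (intro compact_imp_bounded compact_continuous_image) auto
        then obtain M where "\<forall>t\<in>{\<epsilon>..T}. \<bar>\<Lambda> t\<bar> \<le> M" unfolding bounded_iff by auto
        then show ?thesis by (intro exI[of _ M]) (auto simp: abs_le_iff)
      qed
      show "(\<integral>\<^sup>+s\<in>{0<..<t}. ennreal (\<Lambda> s powr ((p - 1) / r) * ((t - s) powr (-1/2) * (t / s) powr (1 / (2 * r)))) \<partial>lborel) \<le> ennreal (4 powr (- p))"
        if t: "0 < t" "t < T" for t
      proof -
        define d where "d = \<kappa> powr (p - 1) * C0 powr ((p - 1) / r)"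
        have d: "0 \<le> d" by (simp add: d_def)
        have L: "\<Lambda> s powr ((p - 1) / r) = d * prof (A * (p - 1) / 2) (b * (p - 1)) s" for s
        proof -
          have "\<Lambda> s powr ((p - 1) / r) = (\<kappa> powr r) powr ((p - 1) / r) * (C0 powr ((p - 1) / r) * prof (A * r / 2) (b * r) s powr ((p - 1) / r))"
            unfolding \<Lambda>_def using C0 by (simp add: powr_mult prof_nonneg)
          also have "(\<kappa> powr r) powr ((p - 1) / r) = \<kappa> powr (p - 1)" using r by (simp add: powr_powr)
          also have "prof (A * r / 2) (b * r) s powr ((p - 1) / r) = prof (A * (p - 1) / 2) (b * (p - 1)) s"
            unfolding prof_powr using r by (intro arg_cong2[where f="\<lambda>x y. prof x y s"]) auto
          finally show ?thesis by (simp add: d_def)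
        qed
        have "(\<integral>\<^sup>+s\<in>{0<..<t}. ennreal (\<Lambda> s powr ((p - 1) / r) * ((t - s) powr (-1/2) * (t / s) powr (1 / (2 * r)))) \<partial>lborel)
          = (\<integral>\<^sup>+s. ennreal d * (ennreal (prof (A * (p - 1) / 2) (b * (p - 1)) s * ((t - s) powr (-1/2) * (t / s) powr (1 / (2 * r)))) * indicator {0<..<t} s) \<partial>lborel)"
          unfolding L using d by (intro nn_integral_cong) (simp add: ennreal_mult' mult.assoc)
        also have "\<dots> = ennreal d * (\<integral>\<^sup>+s\<in>{0<..<t}. ennreal (prof (A * (p - 1) / 2) (b * (p - 1)) s * ((t - s) powr (-1/2) * (t / s) powr (1 / (2 * r)))) \<partial>lborel)"
          by (rule nn_integral_cmult) measurable
        also have "\<dots> \<le> ennreal d * ennreal (C1 * prof a' b' T powr (p - 1))"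
          using t T by (intro mult_left_mono C1) auto
        also have "\<dots> = ennreal (c2 * (\<kappa> * prof a' b' T) powr (p - 1))"
          unfolding d_def c2_def using C1 k by (subst ennreal_mult'[symmetric]) (auto simp: powr_mult prof_nonneg mult_ac)
        also have "\<dots> \<le> ennreal (c2 * c powr (p - 1))"
          using c2 le k p by (intro ennreal_leI mult_left_mono powr_mono2) (auto simp: prof_nonneg)
        also have "c2 * c powr (p - 1) = 4 powr (- p)"
          unfolding c_def using c2 p by (simp add: powr_powr)
        finally show ?thesis .
      qed
    qed measurable
  qed
qed

lemma psi_integral_finite:
  fixes k :: "'n::finite"
  assumes "A < real CARD('n) \<or> A = real CARD('n) \<and> 1 < B"
  shows "(\<integral>\<^sup>+z\<in>closed_half_space k. ennreal (psi k A B z) \<partial>lborel) < \<infinity>"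
proof -
  have "(\<integral>\<^sup>+z\<in>closed_half_space k. ennreal (psi k A B z) \<partial>lborel) \<le> (\<integral>\<^sup>+(z::real^'n)\<in>ball 0 1. ennreal (prof A B (norm z)) \<partial>lborel)"
    by (intro nn_integral_mono) (auto simp: indicator_def psi_prof)
  also have "\<dots> < \<infinity>"
  proof (cases "A < real CARD('n)")
    case True
    then have "A < real DIM(real^'n)" by simp
    then show ?thesis
    proof (rule prof_ball_le[where b=B])
      fix C assume "\<And>\<sigma>. 0 < \<sigma> \<Longrightarrow> (\<integral>\<^sup>+(x::real^'n)\<in>ball 0 \<sigma>. ennreal (prof A B (norm x)) \<partial>lborel) \<le> ennreal (C * (\<sigma> powr real DIM(real^'n) * prof A B \<sigma>))"
      from this[of 1] show ?thesis by (simp add: le_less_trans[OF _ ennreal_less_top])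
    qed
  next
    case False
    then have AB: "A = real DIM(real^'n)" "1 < B" using assms by auto
    show ?thesis
    proof (rule prof_ball_le_critical[where 'a="real^'n", OF AB(2)])
      fix C assume "\<And>\<sigma>. 0 < \<sigma> \<Longrightarrow> \<sigma> \<le> 1 \<Longrightarrow> (\<integral>\<^sup>+(x::real^'n)\<in>ball 0 \<sigma>. ennreal (prof (real DIM(real^'n)) B (norm x)) \<partial>lborel) \<le> ennreal (C * LL \<sigma> powr (1 - B))"
      from this[of 1] show ?thesis unfolding AB(1) by (simp add: le_less_trans[OF _ ennreal_less_top])
    qed
  qed
  finally show ?thesis .
qed

text \<open>The sufficient half of the threshold \<open>\<kappa> * Q(T) \<le> const\<close>. Its
  constant is unrelated to the one of \<open>nonexistence_scale\<close>, which is why life spans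
  come out only up to constants.\<close>

definition existence_scale :: "'n::finite \<Rightarrow> real \<Rightarrow> real \<Rightarrow> real \<Rightarrow> real \<Rightarrow> real \<Rightarrow> bool" where
  "existence_scale k p A B \<eta> \<beta> \<longleftrightarrow> (\<exists>c>0. \<forall>\<kappa>>0. \<forall>T>0. T \<le> 1 \<longrightarrow> \<kappa> * prof (- \<eta>) \<beta> T \<le> c \<longrightarrow>
     (\<exists>u. is_minimal_solution k p (\<lambda>x. \<kappa> * psi k A B x) T u))"

text \<open>The necessary half. The condition is tested at \<open>S\<close> strictly before
  \<open>T\<close> because the blow-up argument uses that the solution is finite at time
  \<open>S\<close>.\<close>

definition nonexistence_scale :: "'n::finite \<Rightarrow> real \<Rightarrow> real \<Rightarrow> real \<Rightarrow> real \<Rightarrow> real \<Rightarrow> bool" where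
  "nonexistence_scale k p A B \<eta> \<beta> \<longleftrightarrow> (\<exists>C>0. \<exists>S0>0. \<forall>\<kappa>>0. \<forall>S>0. \<forall>T u. S < T \<longrightarrow> S \<le> S0 \<longrightarrow>
     is_solution k p (\<lambda>x. \<kappa> * psi k A B x) T u \<longrightarrow> \<kappa> * prof (- \<eta>) \<beta> S \<le> C)"

lemma nonexistence_scaleI:
  assumes "0 < C" "0 < S0" "\<And>\<kappa> S T u. 0 < \<kappa> \<Longrightarrow> 0 < S \<Longrightarrow> S < T \<Longrightarrow> S \<le> S0 \<Longrightarrow>
     is_solution k p (\<lambda>x. \<kappa> * psi k A B x) T u \<Longrightarrow> \<kappa> * prof (- \<eta>) \<beta> S \<le> C"
  shows "nonexistence_scale k p A B \<eta> \<beta>"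
  unfolding nonexistence_scale_def using assms by blast

text \<open>With \<open>r > 1\<close> the exponent \<open>A * (p - 1) / 2 + 1 / (2 * r)\<close>
  stays below \<open>1\<close> even for \<open>A * (p - 1) = 1\<close>. That borderline is covered
  when \<open>0 \<le> B\<close>, where the threshold is still almost increasing.\<close>

lemma existence_subcritical:
  fixes k :: "'n::finite"
  assumes p: "1 < p" and A: "0 \<le> A" "A < real CARD('n)" "A = 0 \<Longrightarrow> B \<le> 0"
    and Ap: "A * (p - 1) < 1 \<or> A * (p - 1) = 1 \<and> 0 \<le> B"
  shows "existence_scale k p A B ((1 / (p - 1) - A) / 2) B"
proof -
  define N where "N = real CARD('n)"
  \<comment> \<open>The gap between \<open>A\<close> and \<open>N\<close> leaves room for some
    \<open>r > 1\<close> whose power of the datum is still integrable; if \<open>A = 0\<close>, any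
    \<open>r > 1\<close> serves.\<close>
  obtain r where r: "1 < r" "A * r < N"
  proof (cases "A = 0")
    case True
    show ?thesis using True by (intro that[of 2]) (auto simp: N_def)
  next
    case False
    then have A0: "0 < A" using A by simp
    have "1 < N / A" using A A0 by (simp add: N_def)
    then show ?thesis using A0 by (intro that[of "(1 + N / A) / 2"]) (auto simp: field_simps)
  qed
  have "0 < A * r \<or> A * r = 0 \<and> B * r \<le> 0" using A r by (cases "A = 0") (auto simp: mult_le_0_iff)
  then obtain C0 where C0: "0 < C0" "\<And>x t. x \<in> closed_half_space k \<Longrightarrow> 0 < t \<Longrightarrow> t \<le> 1 \<Longrightarrow> heat k (psi k (A * r) (B * r)) x t \<le> ennreal (C0 * prof (A * r / 2) (B * r) t)"
    using heat_psi_le[of "A * r" "B * r" k] r unfolding N_def by metis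
  have ap: "0 \<le> A * (p - 1) / 2" "A * (p - 1) / 2 + 1 / (2 * r) < 1" "A * (p - 1) / 2 < 1/2 \<or> A * (p - 1) / 2 = 1/2 \<and> 0 \<le> B * (p - 1)"
  proof -
    have "1 / (2 * r) < 1 / 2" using r by (simp add: field_simps)
    then show "A * (p - 1) / 2 + 1 / (2 * r) < 1" using Ap by linarith
  qed (use A p Ap in auto)
  obtain C1 where C1: "0 < C1" "\<And>t T. 0 < t \<Longrightarrow> t \<le> T \<Longrightarrow>
    (\<integral>\<^sup>+s\<in>{0<..<t}. ennreal (prof (A * (p - 1) / 2) (B * (p - 1)) s * ((t - s) powr (-1/2) * (t / s) powr (1 / (2 * r)))) \<partial>lborel)
    \<le> ennreal (C1 * prof (A * (p - 1) / 2 - 1/2) (B * (p - 1)) T)"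
    using abel_integral_prof_le[OF less_imp_le[OF r(1)] ap] by auto
  have e: "prof (- ((1 / (p - 1) - A) / 2)) B T powr (p - 1) = prof (A * (p - 1) / 2 - 1/2) (B * (p - 1)) T" for T
    unfolding prof_powr using p by (intro arg_cong2[where f="\<lambda>x y. prof x y T"]) (auto simp: field_simps)
  show ?thesis
    unfolding existence_scale_def
  proof (rule existence_threshold[OF p less_imp_le[OF r(1)] _ C0 C1(1)])
    show "(\<integral>\<^sup>+z\<in>closed_half_space k. ennreal (psi k A B z) \<partial>lborel) < \<infinity>" using A by (intro psi_integral_finite) auto
    show "(\<integral>\<^sup>+s\<in>{0<..<t}. ennreal (prof (A * (p - 1) / 2) (B * (p - 1)) s * ((t - s) powr (-1/2) * (t / s) powr (1 / (2 * r)))) \<partial>lborel)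
      \<le> ennreal (C1 * prof (- ((1 / (p - 1) - A) / 2)) B T powr (p - 1))" if "0 < t" "t \<le> T" for t T
      unfolding e using that by (rule C1(2))
  qed auto
qed

text \<open>At \<open>A = CARD('n)\<close> there is no room for \<open>r > 1\<close>. Now
  \<open>r = 1\<close> suffices, since \<open>CARD('n) * (p - 1) < 1\<close> holds strictly.\<close>

lemma existence_full_singularity:
  fixes k :: "'n::finite"
  assumes p: "1 < p" "p < 1 + 1 / real CARD('n)" and B: "1 < B"
  shows "existence_scale k p (real CARD('n)) B ((1 / (p - 1) - real CARD('n)) / 2) (B - 1)"
proof -
  define N where "N = real CARD('n)"
  have N: "0 < N" by (simp add: N_def)
  have Np: "N * (p - 1) < 1" using p N unfolding N_def[symmetric] by (simp add: field_simps)
  obtain C0 where C0: "0 < C0" "\<And>x t. x \<in> closed_half_space k \<Longrightarrow> 0 < t \<Longrightarrow> t \<le> 1 \<Longrightarrow> heat k (psi k N B) x t \<le> ennreal (C0 * prof (N / 2) (B - 1) t)"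
    using heat_psi_le_critical[OF B, of k] unfolding N_def by metis
  have ap: "0 \<le> N * (p - 1) / 2" "N * (p - 1) / 2 + 1 / (2 * 1) < 1" "N * (p - 1) / 2 < 1/2 \<or> N * (p - 1) / 2 = 1/2 \<and> 0 \<le> (B - 1) * (p - 1)"
    using Np N p by auto
  obtain C1 where C1: "0 < C1" "\<And>t T. 0 < t \<Longrightarrow> t \<le> T \<Longrightarrow>
    (\<integral>\<^sup>+s\<in>{0<..<t}. ennreal (prof (N * (p - 1) / 2) ((B - 1) * (p - 1)) s * ((t - s) powr (-1/2) * (t / s) powr (1 / (2 * 1)))) \<partial>lborel)
    \<le> ennreal (C1 * prof (N * (p - 1) / 2 - 1/2) ((B - 1) * (p - 1)) T)"
    using abel_integral_prof_le[OF order_refl ap] by auto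
  have e: "prof (- ((1 / (p - 1) - N) / 2)) (B - 1) T powr (p - 1) = prof (N * (p - 1) / 2 - 1/2) ((B - 1) * (p - 1)) T" for T
    unfolding prof_powr using p by (intro arg_cong2[where f="\<lambda>x y. prof x y T"]) (auto simp: field_simps)
  show ?thesis
    unfolding existence_scale_def N_def[symmetric]
  proof (rule existence_threshold[where r=1 and b="B - 1", OF p(1) order_refl _ C0(1) _ C1(1)])
    show "(\<integral>\<^sup>+z\<in>closed_half_space k. ennreal (psi k N B z) \<partial>lborel) < \<infinity>" using B by (intro psi_integral_finite) (auto simp: N_def)
    show "heat k (psi k (N * 1) (B * 1)) x t \<le> ennreal (C0 * prof (N * 1 / 2) ((B - 1) * 1) t)" if "x \<in> closed_half_space k" "0 < t" "t \<le> 1" for x t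
      using C0(2)[OF that] by simp
    show "(\<integral>\<^sup>+s\<in>{0<..<t}. ennreal (prof (N * (p - 1) / 2) ((B - 1) * (p - 1)) s * ((t - s) powr (-1/2) * (t / s) powr (1 / (2 * 1)))) \<partial>lborel)
      \<le> ennreal (C1 * prof (- ((1 / (p - 1) - N) / 2)) (B - 1) T powr (p - 1))" if "0 < t" "t \<le> T" for t T
      unfolding e using that by (rule C1(2))
  qed
qed

text \<open>With \<open>r = 1\<close> the time integral is the borderline one. The exponent
  \<open>(B - 1) * (p - 1)\<close> of the logarithm exceeds \<open>1\<close> exactly when
  \<open>B > CARD('n) + 1\<close>, and after losing one it equals
  \<open>(B - CARD('n) - 1) * (p - 1)\<close>.\<close>

lemma existence_critical:
  fixes k :: "'n::finite"
  assumes p: "p = 1 + 1 / real CARD('n)" and B: "real CARD('n) + 1 < B"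
  shows "existence_scale k p (real CARD('n)) B 0 (B - real CARD('n) - 1)"
proof -
  define N where "N = real CARD('n)"
  have N: "0 < N" by (simp add: N_def)
  have p1: "1 < p" using N p by (simp add: N_def)
  have Np: "N * (p - 1) = 1" using p N by (simp add: N_def)
  have B1: "1 < B" using B N by (simp add: N_def)
  obtain C0 where C0: "0 < C0" "\<And>x t. x \<in> closed_half_space k \<Longrightarrow> 0 < t \<Longrightarrow> t \<le> 1 \<Longrightarrow> heat k (psi k N B) x t \<le> ennreal (C0 * prof (N / 2) (B - 1) t)"
    using heat_psi_le_critical[OF B1, of k] unfolding N_def by metis
  have g: "1 < (B - 1) * (p - 1)"
  proof -
    have "N * (p - 1) < (B - 1) * (p - 1)" using B p1 by (intro mult_strict_right_mono) (auto simp: N_def)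
    then show ?thesis using Np by simp
  qed
  obtain C1 where C1: "0 < C1" "\<And>t T. 0 < t \<Longrightarrow> t \<le> T \<Longrightarrow> T \<le> 1 \<Longrightarrow>
    (\<integral>\<^sup>+s\<in>{0<..<t}. ennreal (prof (1/2) ((B - 1) * (p - 1)) s * ((t - s) powr (-1/2) * (t / s) powr (1/2))) \<partial>lborel)
    \<le> ennreal (C1 * prof 0 ((B - 1) * (p - 1) - 1) T)"
    using abel_integral_critical_le[OF g] by auto
  have e: "prof (- 0) (B - N - 1) T powr (p - 1) = prof 0 ((B - 1) * (p - 1) - 1) T" for T
    unfolding prof_powr using Np by (intro arg_cong2[where f="\<lambda>x y. prof x y T"]) (auto simp: algebra_simps)
  show ?thesis
    unfolding existence_scale_def N_def[symmetric]
  proof (rule existence_threshold[where r=1 and b="B - 1", OF p1 order_refl _ C0(1) _ C1(1)])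
    show "(\<integral>\<^sup>+z\<in>closed_half_space k. ennreal (psi k N B z) \<partial>lborel) < \<infinity>" using B1 by (intro psi_integral_finite) (auto simp: N_def)
    show "heat k (psi k (N * 1) (B * 1)) x t \<le> ennreal (C0 * prof (N * 1 / 2) ((B - 1) * 1) t)" if "x \<in> closed_half_space k" "0 < t" "t \<le> 1" for x t
      using C0(2)[OF that] by simp
    show "(\<integral>\<^sup>+s\<in>{0<..<t}. ennreal (prof (N * (p - 1) / 2) ((B - 1) * (p - 1)) s * ((t - s) powr (-1/2) * (t / s) powr (1 / (2 * 1)))) \<partial>lborel)
      \<le> ennreal (C1 * prof (- 0) (B - N - 1) T powr (p - 1))" if "0 < t" "t \<le> T" "T \<le> 1" for t T
      unfolding e Np using C1(2)[OF that] by simp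
  qed
qed

section \<open>Necessary thresholds for existence\<close>

lemma psi_mass:
  fixes k :: "'n::finite"
  assumes k: "0 < \<kappa>" and s: "\<sigma> \<le> 1"
    and m: "ennreal m \<le> (\<integral>\<^sup>+x\<in>closed_half_space k. ennreal (prof A B (norm x)) * indicator (ball 0 \<sigma>) x \<partial>lborel)"
  shows "ennreal (\<kappa> * m) \<le> (\<integral>\<^sup>+z\<in>closed_half_space k. ennreal (\<kappa> * psi k A B z) * indicator (ball 0 \<sigma>) z \<partial>lborel)"
proof -
  have "ennreal (\<kappa> * m) = ennreal \<kappa> * ennreal m" using k by (simp add: ennreal_mult')
  also have "\<dots> \<le> ennreal \<kappa> * (\<integral>\<^sup>+x\<in>closed_half_space k. ennreal (prof A B (norm x)) * indicator (ball 0 \<sigma>) x \<partial>lborel)"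
    by (intro mult_left_mono m) simp
  also have "\<dots> = (\<integral>\<^sup>+x. ennreal \<kappa> * (ennreal (prof A B (norm x)) * indicator (ball 0 \<sigma>) x * indicator (closed_half_space k) x) \<partial>lborel)"
    by (rule nn_integral_cmult[symmetric]) measurable
  also have "\<dots> = (\<integral>\<^sup>+z\<in>closed_half_space k. ennreal (\<kappa> * psi k A B z) * indicator (ball 0 \<sigma>) z \<partial>lborel)"
    using s k by (intro nn_integral_cong) (auto simp: indicator_def psi_prof ennreal_mult')
  finally show ?thesis .
qed

text \<open>A lower bound for the mass in radius \<open>sqrt S\<close> is inserted into
  \<open>mass_bound\<close>; the volume factor cancels the power \<open>- CARD('n) / 2\<close> of
  \<open>S\<close>. The exponent \<open>\<beta>\<close> is left free so that masses with an extra
  logarithm are included.\<close>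

lemma nonexistence_from_mass:
  fixes k :: "'n::finite"
  assumes p: "1 < p" and s0: "0 < \<sigma>0" "\<sigma>0 \<le> 1"
    and c: "0 < c" "\<And>\<sigma>. 0 < \<sigma> \<Longrightarrow> \<sigma> \<le> \<sigma>0 \<Longrightarrow> ennreal (c * (\<sigma> powr real CARD('n) * prof A \<beta> \<sigma>)) \<le>
      (\<integral>\<^sup>+x\<in>closed_half_space k. ennreal (prof A B (norm x)) * indicator (ball 0 \<sigma>) x \<partial>lborel)"
  shows "nonexistence_scale k p A B ((1 / (p - 1) - A) / 2) \<beta>"
proof -
  define N where "N = real CARD('n)"
  obtain C where C: "0 < C" "\<And>\<phi> T u S \<mu>. is_solution k p \<phi> T u \<Longrightarrow> \<phi> \<in> borel_measurable borel \<Longrightarrow> (\<And>z. 0 \<le> \<phi> z) \<Longrightarrow>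
    0 < S \<Longrightarrow> S < T \<Longrightarrow> 0 < \<mu> \<Longrightarrow>
    ennreal \<mu> \<le> (\<integral>\<^sup>+z\<in>closed_half_space k. ennreal (\<phi> z) * indicator (ball 0 (sqrt S)) z \<partial>lborel) \<Longrightarrow>
    \<mu> * S powr (1 / (2 * (p - 1)) - N / 2) \<le> C"
    using mass_bound[OF p, of k] unfolding N_def by auto
  obtain C3 where C3: "0 < C3" "\<And>t. 0 < t \<Longrightarrow> t \<le> 1 \<Longrightarrow> prof (A / 2) \<beta> t \<le> C3 * prof A \<beta> (sqrt t)"
    using prof_sqrt_le[of A \<beta>] by metis
  show ?thesis
  proof (rule nonexistence_scaleI[of "C * C3 / c" "\<sigma>0\<^sup>2"])
    fix \<kappa> S T :: real and u
    assume k: "0 < \<kappa>" and S: "0 < S" "S < T" "S \<le> \<sigma>0\<^sup>2" and sol: "is_solution k p (\<lambda>x. \<kappa> * psi k A B x) T u"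
    have sS: "0 < sqrt S" "sqrt S \<le> \<sigma>0" using S s0 by (auto intro: real_le_lsqrt)
    have "sqrt S \<le> 1" using sS s0 by linarith
    then have S1: "S \<le> 1" by simp
    define m where "m = c * (sqrt S powr N * prof A \<beta> (sqrt S))"
    have m: "0 < m" using c S by (simp add: m_def prof_pos)
    have "\<kappa> * m * S powr (1 / (2 * (p - 1)) - N / 2) \<le> C"
    proof (rule C(2)[OF sol])
      show "ennreal (\<kappa> * m) \<le> (\<integral>\<^sup>+z\<in>closed_half_space k. ennreal (\<kappa> * psi k A B z) * indicator (ball 0 (sqrt S)) z \<partial>lborel)"
        using k S1 c(2)[OF sS] by (intro psi_mass) (auto simp: m_def N_def)
    qed (use k m S in \<open>auto simp: psi_nonneg\<close>)
    moreover have "m * S powr (1 / (2 * (p - 1)) - N / 2) = c * (S powr (1 / (2 * (p - 1))) * prof A \<beta> (sqrt S))"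
    proof -
      have "sqrt S powr N * S powr (1 / (2 * (p - 1)) - N / 2) = S powr (1 / (2 * (p - 1)))"
        using S by (simp add: powr_half_sqrt[symmetric] powr_powr flip: powr_add)
      then show ?thesis by (simp add: m_def mult_ac)
    qed
    ultimately have 1: "\<kappa> * (c * (S powr (1 / (2 * (p - 1))) * prof A \<beta> (sqrt S))) \<le> C" by (simp add: mult.assoc)
    have "prof (- ((1 / (p - 1) - A) / 2)) \<beta> S = S powr (1 / (2 * (p - 1))) * prof (A / 2) \<beta> S"
    proof -
      have "1 / (2 * (p - 1)) - A / 2 = (1 / (p - 1) - A) / 2" using p by (simp add: field_simps)
      then show ?thesis unfolding powr_mult_prof by (simp only: prof_def minus_minus)
    qed
    also have "\<dots> \<le> S powr (1 / (2 * (p - 1))) * (C3 * prof A \<beta> (sqrt S))"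
      using S S1 by (intro mult_left_mono C3) auto
    finally have "\<kappa> * prof (- ((1 / (p - 1) - A) / 2)) \<beta> S \<le> \<kappa> * (S powr (1 / (2 * (p - 1))) * (C3 * prof A \<beta> (sqrt S)))"
      using k by (intro mult_left_mono) auto
    also have "\<dots> = \<kappa> * (c * (S powr (1 / (2 * (p - 1))) * prof A \<beta> (sqrt S))) * (C3 / c)" using c by simp
    also have "\<dots> \<le> C * (C3 / c)" using C3 c by (intro mult_right_mono 1) auto
    finally show "\<kappa> * prof (- ((1 / (p - 1) - A) / 2)) \<beta> S \<le> C * C3 / c" by simp
  qed (use C C3 c s0 in auto)
qed

text \<open>Holds for all exponents \<open>A\<close> and \<open>B\<close>, in particular with a
  negative \<open>\<eta>\<close>, where it rules out local solutions altogether.\<close>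

lemma nonexistence_subcritical:
  fixes k :: "'n::finite"
  assumes p: "1 < p"
  shows "nonexistence_scale k p A B ((1 / (p - 1) - A) / 2) B"
proof -
  obtain c where "0 < c" "\<And>\<sigma>. 0 < \<sigma> \<Longrightarrow> ennreal (c * (\<sigma> powr real CARD('n) * prof A B \<sigma>)) \<le>
      (\<integral>\<^sup>+x\<in>closed_half_space k. ennreal (prof A B (norm x)) * indicator (ball 0 \<sigma>) x \<partial>lborel)"
    using half_ball_mass_ge[where k=k and a=A and b=B] by auto
  then show ?thesis by (intro nonexistence_from_mass[OF p zero_less_one order_refl]) auto
qed

lemma nonexistence_full_singularity:
  fixes k :: "'n::finite"
  assumes p: "1 < p" and B: "0 \<le> B"
  shows "nonexistence_scale k p (real CARD('n)) B ((1 / (p - 1) - real CARD('n)) / 2) (B - 1)"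
proof -
  obtain c where c: "0 < c" "\<And>\<sigma>. 0 < \<sigma> \<Longrightarrow> \<sigma> \<le> 1/16 \<Longrightarrow> ennreal (c * LL \<sigma> powr (1 - B)) \<le>
      (\<integral>\<^sup>+x\<in>closed_half_space k. ennreal (prof (real CARD('n)) B (norm x)) * indicator (ball 0 \<sigma>) x \<partial>lborel)"
    using half_ball_mass_ge_critical[OF B, of k] by auto
  show ?thesis
  proof (rule nonexistence_from_mass[OF p, of "1/16" c])
    show "ennreal (c * (\<sigma> powr real CARD('n) * prof (real CARD('n)) (B - 1) \<sigma>)) \<le>
      (\<integral>\<^sup>+x\<in>closed_half_space k. ennreal (prof (real CARD('n)) B (norm x)) * indicator (ball 0 \<sigma>) x \<partial>lborel)" if "0 < \<sigma>" "\<sigma> \<le> 1/16" for \<sigma>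
      using c(2)[OF that] that unfolding powr_mult_prof by simp
  qed (use c in auto)
qed

text \<open>The half ball of radius \<open>S\<close> has mass of order
  \<open>LL S powr (1 - B)\<close>, and \<open>mass_bound_critical\<close> contributes a logarithm
  to the power \<open>CARD('n)\<close>.\<close>

lemma nonexistence_critical:
  fixes k :: "'n::finite"
  assumes p: "p = 1 + 1 / real CARD('n)" and B: "0 \<le> B"
  shows "nonexistence_scale k p (real CARD('n)) B 0 (B - real CARD('n) - 1)"
proof -
  define N where "N = real CARD('n)"
  obtain c where c: "0 < c" "\<And>\<sigma>. 0 < \<sigma> \<Longrightarrow> \<sigma> \<le> 1/16 \<Longrightarrow> ennreal (c * LL \<sigma> powr (1 - B)) \<le>
      (\<integral>\<^sup>+x\<in>closed_half_space k. ennreal (prof N B (norm x)) * indicator (ball 0 \<sigma>) x \<partial>lborel)"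
    using half_ball_mass_ge_critical[OF B, of k] unfolding N_def by auto
  obtain C where C: "0 < C" "\<And>\<phi> T u \<sigma> \<mu>. is_solution k p \<phi> T u \<Longrightarrow> \<phi> \<in> borel_measurable borel \<Longrightarrow> (\<And>z. 0 \<le> \<phi> z) \<Longrightarrow>
    0 < \<sigma> \<Longrightarrow> \<sigma>\<^sup>2 \<le> T / 8 \<Longrightarrow> 0 < \<mu> \<Longrightarrow>
    ennreal \<mu> \<le> (\<integral>\<^sup>+z\<in>closed_half_space k. ennreal (\<phi> z) * indicator (ball 0 \<sigma>) z \<partial>lborel) \<Longrightarrow>
    \<mu> * ln (T / \<sigma>\<^sup>2) powr N \<le> C"
    using mass_bound_critical[OF p, of k] unfolding N_def by auto
  show ?thesis
    unfolding N_def[symmetric]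
  proof (rule nonexistence_scaleI[of "C * 2 powr N / c" "1/16"])
    fix \<kappa> S T :: real and u
    assume k: "0 < \<kappa>" and S: "0 < S" "S < T" "S \<le> 1/16" and sol: "is_solution k p (\<lambda>x. \<kappa> * psi k N B x) T u"
    have L: "0 < LL S" using S by (intro LL_pos)
    \<comment> \<open>The solution is restricted to \<open>[0, S)\<close> and the mass taken in
      radius \<open>S\<close>, not \<open>sqrt S\<close>. Then the ratio of the two time scales is
      \<open>S / S\<^sup>2 = 1 / S\<close>, large enough for its logarithm to be comparable to
      \<open>LL S\<close>.\<close>
    have sol': "is_solution k p (\<lambda>x. \<kappa> * psi k N B x) S u"
      using sol S by (intro solution_mono[OF sol]) auto
    have mass: "ennreal (\<kappa> * (c * LL S powr (1 - B))) \<le> (\<integral>\<^sup>+z\<in>closed_half_space k. ennreal (\<kappa> * psi k N B z) * indicator (ball 0 S) z \<partial>lborel)"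
      using k S by (intro psi_mass c) auto
    have "\<kappa> * (c * LL S powr (1 - B)) * ln (S / S\<^sup>2) powr N \<le> C"
      using k c L S by (intro C(2)[OF sol' _ _ _ _ _ mass]) (auto simp: psi_nonneg power2_eq_square)
    moreover have "S / S\<^sup>2 = 1 / S" by (simp add: power2_eq_square)
    moreover have "LL S powr N \<le> 2 powr N * ln (1 / S) powr N"
    proof -
      have "LL S powr N \<le> (2 * ln (1 / S)) powr N" using LL_le_ln[of S] S L by (intro powr_mono2) (auto simp: N_def)
      then show ?thesis using S by (simp add: powr_mult)
    qed
    ultimately have 1: "\<kappa> * (c * LL S powr (1 - B)) * ln (1 / S) powr N \<le> C" and 2: "LL S powr N \<le> 2 powr N * ln (1 / S) powr N" by auto
    have "prof (- 0) (B - N - 1) S = LL S powr (1 - B) * LL S powr N"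
      unfolding prof_def using S by (simp add: algebra_simps flip: powr_add)
    also have "\<dots> \<le> LL S powr (1 - B) * (2 powr N * ln (1 / S) powr N)" by (intro mult_left_mono 2) simp
    finally have "\<kappa> * prof (- 0) (B - N - 1) S \<le> \<kappa> * (LL S powr (1 - B) * (2 powr N * ln (1 / S) powr N))"
      using k by (intro mult_left_mono) auto
    also have "\<dots> = \<kappa> * (c * LL S powr (1 - B)) * ln (1 / S) powr N * (2 powr N / c)" using c by simp
    also have "\<dots> \<le> C * (2 powr N / c)" using c by (intro mult_right_mono 1) auto
    finally show "\<kappa> * prof (- 0) (B - N - 1) S \<le> C * 2 powr N / c" by simp
  qed (use C c in auto)
qed

subsection \<open>Life span asymptotics\<close>

lemma life_span_ge:
  assumes "0 < T" "is_minimal_solution k p \<phi> T u"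
  shows "ennreal T \<le> life_span k p \<phi>"
  unfolding life_span_def using assms by (intro Sup_upper) auto

text \<open>Solutions restrict to shorter intervals, so the absence of any solution up to
  \<open>T\<close> excludes minimal solutions beyond \<open>T\<close>.\<close>

lemma life_span_le:
  assumes "\<And>u. \<not> is_solution k p \<phi> T u"
  shows "life_span k p \<phi> \<le> ennreal T"
  unfolding life_span_def
proof (rule Sup_least, clarify)
  fix T' u assume "is_minimal_solution k p \<phi> T' u"
  then have sol: "is_solution k p \<phi> T' u" by (simp add: is_minimal_solution_def)
  show "ennreal T' \<le> ennreal T"
  proof (rule ccontr)
    assume "\<not> ennreal T' \<le> ennreal T"
    then have "T \<le> T'" by (metis ennreal_leI linear)
    from solution_mono[OF sol this] assms show False by blast
  qed
qed

text \<open>At a fixed small time the threshold is a positive number, so the necessary condition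
  fails there for all large \<open>\<kappa>\<close>.\<close>

lemma life_span_tendsto_0:
  assumes "nonexistence_scale k p A B \<eta> \<beta>"
  shows "((\<lambda>\<kappa>. life_span k p (\<lambda>x. \<kappa> * psi k A B x)) \<longlongrightarrow> 0) at_top"
proof -
  obtain C S0 where "0 < C" "0 < S0" "\<forall>\<kappa>>0. \<forall>S>0. \<forall>T u. S < T \<longrightarrow> S \<le> S0 \<longrightarrow>
     is_solution k p (\<lambda>x. \<kappa> * psi k A B x) T u \<longrightarrow> \<kappa> * prof (- \<eta>) \<beta> S \<le> C"
    using assms unfolding nonexistence_scale_def by blast
  note C = this(1,2) this(3)[rule_format]
  show ?thesis
  proof (rule order_tendstoI)
    fix y :: ennreal assume y: "0 < y"
    obtain z where z: "0 < z" "z < y" using dense[OF y] by auto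
    then have "z < top" by (metis top.extremum_strict top.not_eq_extremum)
    then obtain e where e: "z = ennreal e" "0 < e" using z by (cases z) auto
    define S where "S = min (e / 2) S0"
    have S: "0 < S" "S < e" "S \<le> S0" using e C by (auto simp: S_def)
    have "\<forall>\<^sub>F \<kappa> in at_top. C / prof (- \<eta>) \<beta> S < \<kappa>" by (rule eventually_gt_at_top)
    moreover have "\<forall>\<^sub>F \<kappa> in at_top. (0::real) < \<kappa>" by (rule eventually_gt_at_top)
    ultimately show "\<forall>\<^sub>F \<kappa> in at_top. life_span k p (\<lambda>x. \<kappa> * psi k A B x) < y"
    proof eventually_elim
      case (elim \<kappa>)
      have "C < \<kappa> * prof (- \<eta>) \<beta> S" using elim prof_pos[OF S(1), of "-\<eta>" \<beta>] by (simp add: field_simps)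
      then have "life_span k p (\<lambda>x. \<kappa> * psi k A B x) \<le> ennreal e"
        using C(3)[OF elim(2) S] by (intro life_span_le) (auto simp: not_le[symmetric])
      then show ?case using z e by simp
    qed
  qed simp
qed

text \<open>The inversion of \<open>Q\<close> in abstract form: \<open>\<tau> a\<close> is a family
  of candidate life spans along which \<open>\<kappa> * Q\<close> tends to \<open>l a\<close>. One
  parameter is chosen below the existence constant, another above the nonexistence constant; the
  factor \<open>2\<close> comes from testing the necessary condition at half the time.\<close>

lemma life_span_bounds:
  assumes ex: "existence_scale k p A B \<eta> \<beta>" and ne: "nonexistence_scale k p A B \<eta> \<beta>"
    and lim: "\<And>a. 0 < a \<Longrightarrow> ((\<lambda>\<kappa>. \<kappa> * prof (- \<eta>) \<beta> (\<tau> a \<kappa>)) \<longlongrightarrow> l a) at_top"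
    and t0: "\<And>a. 0 < a \<Longrightarrow> ((\<lambda>\<kappa>. \<tau> a \<kappa>) \<longlongrightarrow> 0) at_top" "\<And>a. 0 < a \<Longrightarrow> \<forall>\<^sub>F \<kappa> in at_top. 0 < \<tau> a \<kappa>"
    and small: "\<And>c. 0 < c \<Longrightarrow> \<exists>a>0. l a < c" and large: "\<And>c. 0 < c \<Longrightarrow> \<exists>a>0. c < l a"
  obtains a1 a2 where "0 < a1" "0 < a2"
    "\<forall>\<^sub>F \<kappa> in at_top. \<tau> a1 \<kappa> \<le> life_span_real k p (\<lambda>x. \<kappa> * psi k A B x) \<and> life_span_real k p (\<lambda>x. \<kappa> * psi k A B x) \<le> 2 * \<tau> a2 \<kappa>"
proof -
  obtain C S0 where "0 < C" "0 < S0" "\<forall>\<kappa>>0. \<forall>S>0. \<forall>T u. S < T \<longrightarrow> S \<le> S0 \<longrightarrow>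
     is_solution k p (\<lambda>x. \<kappa> * psi k A B x) T u \<longrightarrow> \<kappa> * prof (- \<eta>) \<beta> S \<le> C"
    using ne unfolding nonexistence_scale_def by blast
  note C = this(1,2) this(3)[rule_format]
  obtain c where "0 < c" "\<forall>\<kappa>>0. \<forall>T>0. T \<le> 1 \<longrightarrow> \<kappa> * prof (- \<eta>) \<beta> T \<le> c \<longrightarrow>
     (\<exists>u. is_minimal_solution k p (\<lambda>x. \<kappa> * psi k A B x) T u)"
    using ex unfolding existence_scale_def by blast
  note c = this(1) this(2)[rule_format]
  obtain a1 where a1: "0 < a1" "l a1 < c" using small[OF c(1)] by auto
  obtain a2 where a2: "0 < a2" "C < l a2" using large[OF C(1)] by auto
  have "\<forall>\<^sub>F \<kappa> in at_top. \<tau> a1 \<kappa> \<le> life_span_real k p (\<lambda>x. \<kappa> * psi k A B x) \<and> life_span_real k p (\<lambda>x. \<kappa> * psi k A B x) \<le> 2 * \<tau> a2 \<kappa>"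
    using order_tendstoD(2)[OF lim[OF a1(1)] a1(2)] order_tendstoD(1)[OF lim[OF a2(1)] a2(2)]
      order_tendstoD(2)[OF t0(1)[OF a1(1)] zero_less_one] order_tendstoD(2)[OF t0(1)[OF a2(1)] C(2)]
      t0(2)[OF a1(1)] t0(2)[OF a2(1)] eventually_gt_at_top[of "0::real"]
  proof eventually_elim
    case (elim \<kappa>)
    let ?L = "life_span k p (\<lambda>x. \<kappa> * psi k A B x)"
    obtain u where "is_minimal_solution k p (\<lambda>x. \<kappa> * psi k A B x) (\<tau> a1 \<kappa>) u"
      using c(2)[of \<kappa> "\<tau> a1 \<kappa>"] elim by auto
    then have 1: "ennreal (\<tau> a1 \<kappa>) \<le> ?L" using elim by (intro life_span_ge) auto
    have 2: "?L \<le> ennreal (2 * \<tau> a2 \<kappa>)"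
      using C(3)[of \<kappa> "\<tau> a2 \<kappa>" "2 * \<tau> a2 \<kappa>"] elim by (intro life_span_le) (auto simp: not_le[symmetric])
    have "?L < top" using 2 by (rule le_less_trans) simp
    then have "enn2real (ennreal (\<tau> a1 \<kappa>)) \<le> enn2real ?L" "enn2real ?L \<le> enn2real (ennreal (2 * \<tau> a2 \<kappa>))"
      using 1 2 by (auto intro!: enn2real_mono)
    then show ?case using elim by (simp add: life_span_real_def)
  qed
  then show ?thesis using a1 a2 that by blast
qed

text \<open>The logarithm of the candidate life span grows like \<open>e * ln \<kappa>\<close>, so
  \<open>LL\<close> may be traded for \<open>ln \<kappa>\<close> and all logarithms cancel, leaving
  the constant \<open>e powr (- \<beta>)\<close>.\<close>

lemma prof_scale_lim:
  fixes a e \<beta> :: real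
  assumes "0 < a" "0 < e"
  shows "((\<lambda>\<kappa>. \<kappa> * prof (- (1 / e)) \<beta> (a * (\<kappa> * ln \<kappa> powr (- \<beta>)) powr (- e))) \<longlongrightarrow> a powr (1 / e) * e powr (- \<beta>)) at_top"
proof -
  define \<tau> where "\<tau> \<kappa> = a * (\<kappa> * ln \<kappa> powr (- \<beta>)) powr (- e)" for \<kappa>
  have lim: "((\<lambda>\<kappa>. LL (\<tau> \<kappa>) / ln \<kappa>) \<longlongrightarrow> e) at_top"
    unfolding LL_def \<tau>_def using assms by real_asymp
  have "((\<lambda>\<kappa>. a powr (1 / e) * (LL (\<tau> \<kappa>) / ln \<kappa>) powr (- \<beta>)) \<longlongrightarrow> a powr (1 / e) * e powr (- \<beta>)) at_top"
    using lim assms by (intro tendsto_intros) auto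
  moreover have "\<forall>\<^sub>F \<kappa> in at_top. a powr (1 / e) * (LL (\<tau> \<kappa>) / ln \<kappa>) powr (- \<beta>) = \<kappa> * prof (- (1 / e)) \<beta> (\<tau> \<kappa>)"
    using eventually_gt_at_top[of 1]
  proof eventually_elim
    case (elim \<kappa>)
    have l: "0 < ln \<kappa>" using elim by simp
    have t: "0 < \<tau> \<kappa>" using assms elim l by (simp add: \<tau>_def)
    have "\<tau> \<kappa> powr (1 / e) = a powr (1 / e) * (\<kappa> * ln \<kappa> powr (- \<beta>)) powr (- 1)"
    proof -
      have "((\<kappa> * ln \<kappa> powr (- \<beta>)) powr (- e)) powr (1 / e) = (\<kappa> * ln \<kappa> powr (- \<beta>)) powr (- 1)"
        unfolding powr_powr using assms by (intro arg_cong2[where f="(powr)"]) auto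
      then show ?thesis unfolding \<tau>_def using assms by (simp only: powr_mult)
    qed
    also have "(\<kappa> * ln \<kappa> powr (- \<beta>)) powr (- 1) = ln \<kappa> powr \<beta> / \<kappa>"
    proof -
      have "(\<kappa> * ln \<kappa> powr (- \<beta>)) powr (- 1) = 1 / (\<kappa> * ln \<kappa> powr (- \<beta>))"
        using elim powr_minus_divide[of "\<kappa> * ln \<kappa> powr (- \<beta>)" 1] by simp
      then show ?thesis unfolding powr_minus_divide[of _ \<beta>] by simp
    qed
    finally have "\<tau> \<kappa> powr (1 / e) = a powr (1 / e) * (ln \<kappa> powr \<beta> / \<kappa>)" .
    then show ?case unfolding prof_def using elim l LL_pos[OF t]
      by (simp add: powr_divide powr_minus_divide[of _ \<beta>])
  qed
  ultimately show ?thesis unfolding \<tau>_def by (rule Lim_transform_eventually)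
qed

lemma life_span_comparable_power:
  assumes ex: "existence_scale k p A B \<eta> \<beta>" and ne: "nonexistence_scale k p A B \<eta> \<beta>" and eta: "0 < \<eta>"
  shows "comparable_at_top (\<lambda>\<kappa>. life_span_real k p (\<lambda>x. \<kappa> * psi k A B x)) (\<lambda>\<kappa>. (\<kappa> * ln \<kappa> powr (- \<beta>)) powr (- (1 / \<eta>)))"
proof -
  define e where "e = 1 / \<eta>"
  have e: "0 < e" "\<eta> = 1 / e" using eta by (auto simp: e_def)
  define X where "X \<kappa> = (\<kappa> * ln \<kappa> powr (- \<beta>)) powr (- e)" for \<kappa>
  define c where "c = e powr (- \<beta>)"
  have c: "0 < c" using e by (simp add: c_def)
  obtain a1 a2 where a: "0 < a1" "0 < a2" and ev: "\<forall>\<^sub>F \<kappa> in at_top. a1 * X \<kappa> \<le> life_span_real k p (\<lambda>x. \<kappa> * psi k A B x) \<and> life_span_real k p (\<lambda>x. \<kappa> * psi k A B x) \<le> 2 * (a2 * X \<kappa>)"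
  proof (rule life_span_bounds[OF ex ne, where \<tau>="\<lambda>a \<kappa>. a * X \<kappa>" and l="\<lambda>a. a powr (1 / e) * c"])
    show "((\<lambda>\<kappa>. \<kappa> * prof (- \<eta>) \<beta> (a * X \<kappa>)) \<longlongrightarrow> a powr (1 / e) * c) at_top" if "0 < a" for a
      unfolding X_def c_def e(2) using prof_scale_lim[OF that e(1)] by simp
    show "((\<lambda>\<kappa>. a * X \<kappa>) \<longlongrightarrow> 0) at_top" if "0 < a" for a
      unfolding X_def using that e(1) by real_asymp
    show "\<forall>\<^sub>F \<kappa> in at_top. 0 < a * X \<kappa>" if "0 < a" for a
      using eventually_gt_at_top[of 1] by eventually_elim (use that in \<open>auto simp: X_def\<close>)
    show "\<exists>a>0. a powr (1 / e) * c < d" if "0 < d" for d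
      using that c e by (intro exI[of _ "(d / (2 * c)) powr e"]) (auto simp: powr_powr)
    show "\<exists>a>0. d < a powr (1 / e) * c" if "0 < d" for d
      using that c e by (intro exI[of _ "(2 * d / c) powr e"]) (auto simp: powr_powr)
  qed auto
  define C where "C = max (1 / a1) (2 * a2)"
  have C: "0 < C" "inverse C \<le> a1" "2 * a2 \<le> C"
  proof -
    show C0: "0 < C" using a by (auto simp: C_def max_def)
    have "1 / a1 \<le> C" by (simp add: C_def)
    then show "inverse C \<le> a1" using a C0 by (simp add: field_simps)
  qed (simp add: C_def)
  show ?thesis
    unfolding comparable_at_top_def
  proof (intro exI[of _ C] conjI C(1))
    show "\<forall>\<^sub>F \<kappa> in at_top. inverse C * (\<kappa> * ln \<kappa> powr (- \<beta>)) powr (- (1 / \<eta>)) \<le> life_span_real k p (\<lambda>x. \<kappa> * psi k A B x) \<and>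
       life_span_real k p (\<lambda>x. \<kappa> * psi k A B x) \<le> C * (\<kappa> * ln \<kappa> powr (- \<beta>)) powr (- (1 / \<eta>))"
      using ev
    proof eventually_elim
      case (elim \<kappa>)
      have X0: "0 \<le> X \<kappa>" by (simp add: X_def)
      have "inverse C * X \<kappa> \<le> a1 * X \<kappa>" "2 * a2 * X \<kappa> \<le> C * X \<kappa>" using C X0 by (auto intro: mult_right_mono)
      then show ?case using elim unfolding X_def e_def by auto
    qed
  qed
qed

text \<open>With \<open>\<eta> = 0\<close> the threshold is a pure power of the logarithm, so
  solving \<open>\<kappa> * LL T powr (- \<beta>) = const\<close> gives \<open>LL T\<close> of order
  \<open>\<kappa> powr (1 / \<beta>)\<close>. The limit \<open>a powr (- \<beta>)\<close> now
  decreases in \<open>a\<close>.\<close>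

lemma life_span_comparable_exponential:
  assumes ex: "existence_scale k p A B 0 \<beta>" and ne: "nonexistence_scale k p A B 0 \<beta>" and be: "0 < \<beta>"
  shows "comparable_at_top (\<lambda>\<kappa>. \<bar>ln (life_span_real k p (\<lambda>x. \<kappa> * psi k A B x))\<bar>) (\<lambda>\<kappa>. \<kappa> powr (1 / \<beta>))"
proof -
  define d where "d = 1 / \<beta>"
  have d: "0 < d" using be by (simp add: d_def)
  obtain a1 a2 where a: "0 < a1" "0 < a2" and ev: "\<forall>\<^sub>F \<kappa> in at_top. exp (- (a1 * \<kappa> powr d)) \<le> life_span_real k p (\<lambda>x. \<kappa> * psi k A B x) \<and> life_span_real k p (\<lambda>x. \<kappa> * psi k A B x) \<le> 2 * exp (- (a2 * \<kappa> powr d))"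
  proof (rule life_span_bounds[OF ex ne, where \<tau>="\<lambda>a \<kappa>. exp (- (a * \<kappa> powr d))" and l="\<lambda>a. a powr (- \<beta>)"])
    show "((\<lambda>\<kappa>. \<kappa> * prof (- 0) \<beta> (exp (- (a * \<kappa> powr d)))) \<longlongrightarrow> a powr (- \<beta>)) at_top" if a: "0 < a" for a
    proof -
      have "((\<lambda>\<kappa>. LL (exp (- (a * \<kappa> powr d))) / \<kappa> powr d) \<longlongrightarrow> a) at_top"
        unfolding LL_def using a d by real_asymp
      then have "((\<lambda>\<kappa>. (LL (exp (- (a * \<kappa> powr d))) / \<kappa> powr d) powr (- \<beta>)) \<longlongrightarrow> a powr (- \<beta>)) at_top"
        using a by (intro tendsto_intros) auto
      moreover have "\<forall>\<^sub>F \<kappa> in at_top. (LL (exp (- (a * \<kappa> powr d))) / \<kappa> powr d) powr (- \<beta>) = \<kappa> * prof (- 0) \<beta> (exp (- (a * \<kappa> powr d)))"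
        using eventually_gt_at_top[of 0]
      proof eventually_elim
        case (elim \<kappa>)
        have "(\<kappa> powr d) powr (- \<beta>) = 1 / \<kappa>" using elim be by (simp add: powr_powr d_def powr_minus_divide)
        then show ?case unfolding prof_def using LL_pos[of "exp (- (a * \<kappa> powr d))"] elim
          by (simp add: powr_divide)
      qed
      ultimately show ?thesis by (rule Lim_transform_eventually)
    qed
    show "((\<lambda>\<kappa>. exp (- (a * \<kappa> powr d))) \<longlongrightarrow> 0) at_top" if "0 < a" for a
      using that d by real_asymp
    show "\<exists>a>0. a powr (- \<beta>) < c" if "0 < c" for c
      using that be by (intro exI[of _ "(c / 2) powr (- (1 / \<beta>))"]) (auto simp: powr_powr)
    show "\<exists>a>0. c < a powr (- \<beta>)" if "0 < c" for c
      using that be by (intro exI[of _ "(2 * c) powr (- (1 / \<beta>))"]) (auto simp: powr_powr)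
  qed auto
  define C where "C = max a1 (2 / a2)"
  have C: "0 < C" "inverse C \<le> a2 / 2" "a1 \<le> C"
  proof -
    show C0: "0 < C" using a by (auto simp: C_def max_def)
    have "2 / a2 \<le> C" by (simp add: C_def)
    then show "inverse C \<le> a2 / 2" using a C0 by (simp add: field_simps)
  qed (simp add: C_def)
  \<comment> \<open>The factor \<open>2\<close> of \<open>life_span_bounds\<close> is absorbed by
    halving the rate in the exponent.\<close>
  have ev2: "\<forall>\<^sub>F \<kappa> in at_top. 2 * exp (- (a2 * \<kappa> powr d)) \<le> exp (- (a2 / 2 * \<kappa> powr d))"
    using a d by real_asymp
  show ?thesis
    unfolding comparable_at_top_def
  proof (intro exI[of _ C] conjI C(1))
    show "\<forall>\<^sub>F \<kappa> in at_top. inverse C * \<kappa> powr (1 / \<beta>) \<le> \<bar>ln (life_span_real k p (\<lambda>x. \<kappa> * psi k A B x))\<bar> \<and>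
       \<bar>ln (life_span_real k p (\<lambda>x. \<kappa> * psi k A B x))\<bar> \<le> C * \<kappa> powr (1 / \<beta>)"
      using ev ev2
    proof eventually_elim
      case (elim \<kappa>)
      define L where "L = life_span_real k p (\<lambda>x. \<kappa> * psi k A B x)"
      have b: "exp (- (a1 * \<kappa> powr d)) \<le> L" "L \<le> exp (- (a2 / 2 * \<kappa> powr d))" using elim by (auto simp: L_def)
      have L0: "0 < L" using b(1) by (meson exp_gt_zero less_le_trans)
      have 1: "- (a1 * \<kappa> powr d) \<le> ln L" using b(1) L0 by (simp add: ln_ge_iff)
      have "ln L \<le> ln (exp (- (a2 / 2 * \<kappa> powr d)))" using b(2) L0 by (subst ln_le_cancel_iff) auto
      then have 2: "ln L \<le> - (a2 / 2 * \<kappa> powr d)" by simp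
      have X0: "0 \<le> \<kappa> powr d" by simp
      have "inverse C * \<kappa> powr d \<le> a2 / 2 * \<kappa> powr d" "a1 * \<kappa> powr d \<le> C * \<kappa> powr d"
        using mult_right_mono[OF C(2) X0] mult_right_mono[OF C(3) X0] by simp_all
      moreover have "0 \<le> inverse C * \<kappa> powr d" using C by simp
      ultimately show ?case using 1 2 unfolding L_def[symmetric] d_def[symmetric] by linarith
    qed
  qed
qed

text \<open>The necessary condition must hold at all small \<open>S\<close>, but under
  \<open>sing\<close> the threshold tends to infinity as \<open>S\<close> tends to
  \<open>0\<close>.\<close>

lemma no_local_solution:
  assumes ne: "nonexistence_scale k p A B \<eta> \<beta>" and sing: "\<eta> < 0 \<or> \<eta> = 0 \<and> \<beta> < 0" and k: "0 < \<kappa>"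
  shows "\<not> has_local_solution k p (\<lambda>x. \<kappa> * psi k A B x)"
proof
  assume "has_local_solution k p (\<lambda>x. \<kappa> * psi k A B x)"
  then obtain T u where T: "0 < T" "is_solution k p (\<lambda>x. \<kappa> * psi k A B x) T u" unfolding has_local_solution_def by auto
  obtain C S0 where "0 < C" "0 < S0" "\<forall>\<kappa>>0. \<forall>S>0. \<forall>T u. S < T \<longrightarrow> S \<le> S0 \<longrightarrow>
     is_solution k p (\<lambda>x. \<kappa> * psi k A B x) T u \<longrightarrow> \<kappa> * prof (- \<eta>) \<beta> S \<le> C"
    using ne unfolding nonexistence_scale_def by blast
  note C = this(1,2) this(3)[rule_format]
  have "filterlim (\<lambda>S. prof (- \<eta>) \<beta> S) at_top (at_right 0)"
  proof (cases "\<eta> < 0")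
    case True
    then show ?thesis unfolding prof_def LL_def by real_asymp
  next
    case False
    then have e: "\<eta> = 0" "\<beta> < 0" using sing by auto
    have "filterlim (\<lambda>S. LL S powr (- \<beta>)) at_top (at_right 0)"
      unfolding LL_def using e(2) by real_asymp
    moreover have "\<forall>\<^sub>F S in at_right 0. LL S powr (- \<beta>) = prof (- \<eta>) \<beta> S"
      unfolding e prof_def by (auto simp: eventually_at_filter)
    ultimately show ?thesis by (rule filterlim_cong[THEN iffD1, OF refl refl, rotated])
  qed
  then have "\<forall>\<^sub>F S in at_right 0. C / \<kappa> < prof (- \<eta>) \<beta> S" by (simp add: filterlim_at_top_dense)
  moreover have "\<forall>\<^sub>F S in at_right 0. 0 < S \<and> S < min T S0"
    using T C by (auto simp: eventually_at_right_field intro!: exI[of _ "min T S0"])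
  ultimately have "\<forall>\<^sub>F S in at_right (0::real). False"
  proof eventually_elim
    case (elim S)
    then have "\<kappa> * prof (- \<eta>) \<beta> S \<le> C" using C(3)[OF k _ _ _ T(2), of S] by auto
    then show False using elim k by (simp add: field_simps)
  qed
  then show False by simp
qed

text \<open>For \<open>\<eta> = \<beta> = 0\<close> the threshold is identically \<open>1\<close>,
  and the necessary condition reads \<open>\<kappa> \<le> C\<close>.\<close>

lemma no_local_solution_large:
  assumes ne: "nonexistence_scale k p A B 0 0"
  shows "\<forall>\<^sub>F \<kappa> in at_top. \<not> has_local_solution k p (\<lambda>x. \<kappa> * psi k A B x)"
proof -
  obtain C S0 where "0 < C" "0 < S0" "\<forall>\<kappa>>0. \<forall>S>0. \<forall>T u. S < T \<longrightarrow> S \<le> S0 \<longrightarrow>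
     is_solution k p (\<lambda>x. \<kappa> * psi k A B x) T u \<longrightarrow> \<kappa> * prof (- 0) 0 S \<le> C"
    using ne unfolding nonexistence_scale_def by blast
  note C = this(1,2) this(3)[rule_format]
  show ?thesis
    using eventually_gt_at_top[of C]
  proof eventually_elim
    case (elim \<kappa>)
    show ?case
    proof
      assume "has_local_solution k p (\<lambda>x. \<kappa> * psi k A B x)"
      then obtain T u where T: "0 < T" "is_solution k p (\<lambda>x. \<kappa> * psi k A B x) T u" unfolding has_local_solution_def by auto
      define S where "S = min (T / 2) S0"
      have S: "0 < S" "S < T" "S \<le> S0" using T C by (auto simp: S_def)
      have "\<kappa> * prof (- 0) 0 S \<le> C" using C elim by (intro C(3)[OF _ S T(2)]) auto
      then show False using elim S LL_pos[OF S(1)] by (simp add: prof_def)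
    qed
  qed
qed

theorem theorem1p1:
  fixes k :: "'n::finite" and p A B :: real
  assumes "1 < p"
    and "0 \<le> A" and "A \<le> real CARD('n)"
    and "A = 0 \<Longrightarrow> B < 0"
    and "A = real CARD('n) \<Longrightarrow> 1 < B"
    and "psi k A B \<in> L1_half_space k - Linf_half_space k"
  shows "((\<lambda>\<kappa>. life_span k p (\<lambda>x. \<kappa> * psi k A B x)) \<longlongrightarrow> 0) at_top
    \<and> (A < min (real CARD('n)) (1 / (p - 1)) \<longrightarrow>
        comparable_at_top (\<lambda>\<kappa>. life_span_real k p (\<lambda>x. \<kappa> * psi k A B x))
          (\<lambda>\<kappa>. (\<kappa> * ln \<kappa> powr (- B)) powr (- (2 * (p - 1) / (- A * (p - 1) + 1)))))
    \<and> (p < 1 + 1 / real CARD('n) \<and> A = real CARD('n) \<and> 1 < B \<longrightarrow>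
        comparable_at_top (\<lambda>\<kappa>. life_span_real k p (\<lambda>x. \<kappa> * psi k A B x))
          (\<lambda>\<kappa>. (\<kappa> * ln \<kappa> powr (- B + 1)) powr (- (2 * (p - 1) / (- A * (p - 1) + 1)))))
    \<and> (p > 1 + 1 / real CARD('n) \<and> A = 1 / (p - 1) \<and> B > 0 \<longrightarrow>
        comparable_at_top (\<lambda>\<kappa>. \<bar>ln (life_span_real k p (\<lambda>x. \<kappa> * psi k A B x))\<bar>)
          (\<lambda>\<kappa>. \<kappa> powr (1 / B)))
    \<and> (p = 1 + 1 / real CARD('n) \<and> A = real CARD('n) \<and> B > real CARD('n) + 1 \<longrightarrow>
        comparable_at_top (\<lambda>\<kappa>. \<bar>ln (life_span_real k p (\<lambda>x. \<kappa> * psi k A B x))\<bar>)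
          (\<lambda>\<kappa>. \<kappa> powr (1 / (B - real CARD('n) - 1))))
    \<and> (p > 1 + 1 / real CARD('n) \<longrightarrow>
        (A > 1 / (p - 1) \<or> A = 1 / (p - 1) \<and> B < 0 \<longrightarrow>
          (\<forall>\<kappa>>0. \<not> has_local_solution k p (\<lambda>x. \<kappa> * psi k A B x)))
        \<and> (A = 1 / (p - 1) \<and> B = 0 \<longrightarrow>
          (\<forall>\<^sub>F \<kappa> in at_top. \<not> has_local_solution k p (\<lambda>x. \<kappa> * psi k A B x))))
    \<and> (p = 1 + 1 / real CARD('n) \<longrightarrow>
        (A = real CARD('n) \<and> B < real CARD('n) + 1 \<longrightarrow>
          (\<forall>\<kappa>>0. \<not> has_local_solution k p (\<lambda>x. \<kappa> * psi k A B x)))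
        \<and> (A = real CARD('n) \<and> B = real CARD('n) + 1 \<longrightarrow>
          (\<forall>\<^sub>F \<kappa> in at_top. \<not> has_local_solution k p (\<lambda>x. \<kappa> * psi k A B x))))"
proof -
  note p = \<open>1 < p\<close>
  define N where "N = real CARD('n)"
  have N: "0 < N" by (simp add: N_def)
  define \<eta> where "\<eta> = (1 / (p - 1) - A) / 2"
  \<comment> \<open>Also valid for \<open>A = CARD('n)\<close>, where it is weaker than the bounds
    with extra logarithms but still enough for the limit of the life span.\<close>
  have ne: "nonexistence_scale k p A B \<eta> B" unfolding \<eta>_def by (rule nonexistence_subcritical[OF p])
  have rate: "2 * (p - 1) / (- A * (p - 1) + 1) = 1 / \<eta>"
  proof -
    have "\<eta> = (- A * (p - 1) + 1) / (2 * (p - 1))" unfolding \<eta>_def using p by (simp add: field_simps)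
    then show ?thesis by simp
  qed
  show ?thesis
    unfolding N_def[symmetric] rate
  proof (intro conjI impI allI)
    show "((\<lambda>\<kappa>. life_span k p (\<lambda>x. \<kappa> * psi k A B x)) \<longlongrightarrow> 0) at_top" by (rule life_span_tendsto_0[OF ne])
  next
    assume A: "A < min N (1 / (p - 1))"
    then have "A * (p - 1) < 1" using p by (simp add: field_simps)
    moreover have "0 < \<eta>" using A by (simp add: \<eta>_def)
    ultimately show "comparable_at_top (\<lambda>\<kappa>. life_span_real k p (\<lambda>x. \<kappa> * psi k A B x)) (\<lambda>\<kappa>. (\<kappa> * ln \<kappa> powr (- B)) powr (- (1 / \<eta>)))"
      using A p assms(2,4) ne unfolding \<eta>_def
      by (intro life_span_comparable_power existence_subcritical) (auto simp: N_def)
  next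
    assume *: "p < 1 + 1 / N \<and> A = N \<and> 1 < B"
    then have "N * (p - 1) < 1" using N by (simp add: field_simps)
    then have "0 < \<eta>" using * p N by (simp add: \<eta>_def field_simps)
    moreover have "existence_scale k p A B \<eta> (B - 1)"
      using existence_full_singularity[of p B k] p * by (simp add: \<eta>_def N_def)
    moreover have "nonexistence_scale k p A B \<eta> (B - 1)"
      using nonexistence_full_singularity[OF p, of B k] * by (simp add: \<eta>_def N_def)
    ultimately have "comparable_at_top (\<lambda>\<kappa>. life_span_real k p (\<lambda>x. \<kappa> * psi k A B x)) (\<lambda>\<kappa>. (\<kappa> * ln \<kappa> powr (- (B - 1))) powr (- (1 / \<eta>)))"
      by (intro life_span_comparable_power)
    then show "comparable_at_top (\<lambda>\<kappa>. life_span_real k p (\<lambda>x. \<kappa> * psi k A B x)) (\<lambda>\<kappa>. (\<kappa> * ln \<kappa> powr (- B + 1)) powr (- (1 / \<eta>)))"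
      by simp
  next
    assume *: "1 + 1 / N < p \<and> A = 1 / (p - 1) \<and> 0 < B"
    then have "1 < N * (p - 1)" using N by (simp add: field_simps)
    then have "1 / (p - 1) < N" using p by (simp add: pos_divide_less_eq)
    then have "A < N" using * by simp
    then have "existence_scale k p A B \<eta> B"
      unfolding \<eta>_def using * p assms(2,4) by (intro existence_subcritical) (auto simp: N_def)
    moreover have "\<eta> = 0" using * by (simp add: \<eta>_def)
    ultimately show "comparable_at_top (\<lambda>\<kappa>. \<bar>ln (life_span_real k p (\<lambda>x. \<kappa> * psi k A B x))\<bar>) (\<lambda>\<kappa>. \<kappa> powr (1 / B))"
      using ne * by (intro life_span_comparable_exponential) auto
  next
    assume *: "p = 1 + 1 / N \<and> A = N \<and> N + 1 < B"
    then show "comparable_at_top (\<lambda>\<kappa>. \<bar>ln (life_span_real k p (\<lambda>x. \<kappa> * psi k A B x))\<bar>) (\<lambda>\<kappa>. \<kappa> powr (1 / (B - N - 1)))"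
      using N existence_critical[of p B k] nonexistence_critical[of p B k]
      by (intro life_span_comparable_exponential) (auto simp: N_def)
  next
    fix \<kappa> :: real
    assume *: "1 + 1 / N < p" "1 / (p - 1) < A \<or> A = 1 / (p - 1) \<and> B < 0" "0 < \<kappa>"
    then show "\<not> has_local_solution k p (\<lambda>x. \<kappa> * psi k A B x)"
      by (intro no_local_solution[OF ne]) (auto simp: \<eta>_def)
  next
    assume *: "1 + 1 / N < p" "A = 1 / (p - 1) \<and> B = 0"
    then have "\<eta> = 0" by (simp add: \<eta>_def)
    then show "\<forall>\<^sub>F \<kappa> in at_top. \<not> has_local_solution k p (\<lambda>x. \<kappa> * psi k A B x)"
      using ne * by (intro no_local_solution_large) simp
  next
    fix \<kappa> :: real
    assume *: "p = 1 + 1 / N" "A = N \<and> B < N + 1" "0 < \<kappa>"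
    \<comment> \<open>The condition for an integrable datum at \<open>A = CARD('n)\<close>; it
      supplies the sign of \<open>B\<close> that \<open>nonexistence_critical\<close>
      requires.\<close>
    then have "1 < B" using assms(5) by (simp add: N_def)
    then show "\<not> has_local_solution k p (\<lambda>x. \<kappa> * psi k A B x)"
      using * nonexistence_critical[of p B k]
      by (intro no_local_solution[where \<eta>=0 and \<beta>="B - N - 1"]) (auto simp: N_def)
  next
    assume *: "p = 1 + 1 / N" "A = N \<and> B = N + 1"
    then show "\<forall>\<^sub>F \<kappa> in at_top. \<not> has_local_solution k p (\<lambda>x. \<kappa> * psi k A B x)"
      using nonexistence_critical[of p B k] by (intro no_local_solution_large) (auto simp: N_def)
  qed
qed

end
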